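(* There is a universal constant $C>0$ such that the following holds. Suppose $m_0\in H^s(\mathbb{R})$ with $s>\frac12$, and let $u_0$ be determined by $m_0=u_0-u_{0,xx}$. Let $T^*>0$ be the maximal existence time of the strong solution $m$ to the Cauchy problem $$m_t+[\sin(u^2-u_x^2)\,m]_x=0,\qquad m=u-u_{xx},\qquad m(0,x)=m_0(x)\qquad (x\in\mathbb{R}).$$ Let $M=\cos(u^2-u_x^2)\,m\,u_x$, and let $q(t,x)$ solve $$\frac{d}{dt}q(t,x)=\sin(u^2-u_x^2)(t,q(t,x)),\qquad q(0,x)=x.$$ Let $m_0(x)\ge0$ for all $x\in\mathbb{R}$ and $m_0(x_0)>0$ for some $x_0\in\mathbb{R}$. Set $\bar M(t)=M(t,q(t,x_0))$, $\bar m(t)=m(t,q(t,x_0))$, $$C_1=C\big(\|u_0\|_{H^1}^5+\|u_0\|_{H^1}^3\big),\qquad \xi=-\frac{\bar M(0)}{C_1\bar m(0)}.$$ If $$\bar M(0)<0\quad\text{and}\quad \frac{\bar M(0)}{\bar m(0)}\,\xi+\frac12C_1\xi^2+\frac1{\bar m(0)}<0,$$ then the solution $m$ blows up at a time $T^*\in(0,\xi)$.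
   Context: The unknown is a real-valued function $u(t,x)$, $x\in\mathbb{R}$, with $m=u-u_{xx}$, equivalently $u=p*m$ with $p(x)=\frac12e^{-|x|}$ and $*$ the convolution in $x$. For $m_0\in H^s(\mathbb{R})$ with $s>1/2$ (i.e. $u_0\in H^{s+2}(\mathbb{R})$) the Cauchy problem has a unique strong solution $u\in C([0,T];H^{s+2})\cap C^1([0,T];H^{s+1})$ for some $T>0$; the maximal existence time $T^*$ is the supremum of all such $T$. Blow-up at time $T^*$ means that the maximal existence time $T^*$ is finite. *)

theory Defs
  imports "HOL-Analysis.Analysis"
begin

(* g is the L^2 Fourier transform of f with the unitary normalisation: by Plancherel, the
   L^2 limit of the transforms of the truncations of f to [-n, n].  It determines g up to
   null sets. *)
definition L2_fourier :: "(real \<Rightarrow> real) \<Rightarrow> (real \<Rightarrow> complex) \<Rightarrow> bool" where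
  "L2_fourier f g \<longleftrightarrow>
     f \<in> borel_measurable lborel \<and> integrable lborel (\<lambda>x. (f x)\<^sup>2) \<and>
     g \<in> borel_measurable lborel \<and> integrable lborel (\<lambda>k. (norm (g k))\<^sup>2) \<and>
     (\<lambda>n::nat. \<integral>\<^sup>+ k. ennreal ((norm (g k -
          (LBINT x:{- real n..real n}. f x *\<^sub>R cis (- (k * x))) / complex_of_real (sqrt (2 * pi))))\<^sup>2)
        \<partial>lborel) \<longlonglongrightarrow> 0"

(* Membership of a real function in H^r(R), for r >= 0 only (H^r is then contained in L^2).
   Elements are functions, not classes: the continuous representative has to be asked for
   separately where pointwise values matter. *)
definition in_sobolev :: "real \<Rightarrow> (real \<Rightarrow> real) \<Rightarrow> bool" where
  "in_sobolev r f \<longleftrightarrow>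
     (\<exists>g. L2_fourier f g \<and> integrable lborel (\<lambda>k. (1 + k\<^sup>2) powr r * (norm (g k))\<^sup>2))"

definition sobolev_norm :: "real \<Rightarrow> (real \<Rightarrow> real) \<Rightarrow> real" where
  "sobolev_norm r f =
     sqrt (\<integral>k. (1 + k\<^sup>2) powr r * (norm ((SOME g. L2_fourier f g) k))\<^sup>2 \<partial>lborel)"

(* u in C(I; H^r), where u t is the function x |-> u(t,x) *)
definition sobolev_C0 :: "real \<Rightarrow> real set \<Rightarrow> (real \<Rightarrow> real \<Rightarrow> real) \<Rightarrow> bool" where
  "sobolev_C0 r I u \<longleftrightarrow>
     (\<forall>t\<in>I. in_sobolev r (u t)) \<and>
     (\<forall>t\<in>I. ((\<lambda>\<tau>. sobolev_norm r (\<lambda>x. u \<tau> x - u t x)) \<longlongrightarrow> 0) (at t within I))"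

(* u in C^1(I; H^r), with one-sided derivatives at the end points of I *)
definition sobolev_C1 :: "real \<Rightarrow> real set \<Rightarrow> (real \<Rightarrow> real \<Rightarrow> real) \<Rightarrow> bool" where
  "sobolev_C1 r I u \<longleftrightarrow>
     sobolev_C0 r I u \<and>
     (\<exists>v. sobolev_C0 r I v \<and>
       (\<forall>t\<in>I. ((\<lambda>\<tau>. sobolev_norm r (\<lambda>x. (u \<tau> x - u t x) / (\<tau> - t) - v t x)) \<longlongrightarrow> 0)
          (at t within I)))"

definition momentum :: "(real \<Rightarrow> real) \<Rightarrow> real \<Rightarrow> real" where
  "momentum w x = w x - deriv (deriv w) x"

definition velocity :: "(real \<Rightarrow> real) \<Rightarrow> real \<Rightarrow> real" where
  "velocity w x = sin ((w x)\<^sup>2 - (deriv w x)\<^sup>2)"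

definition M_fun :: "(real \<Rightarrow> real) \<Rightarrow> real \<Rightarrow> real" where
  "M_fun w x = cos ((w x)\<^sup>2 - (deriv w x)\<^sup>2) * momentum w x * deriv w x"

definition test_function :: "(real \<Rightarrow> real) \<Rightarrow> bool" where
  "test_function \<phi> \<longleftrightarrow>
     (\<forall>k x. ((deriv ^^ k) \<phi>) differentiable (at x)) \<and> compact (closure {x. \<phi> x \<noteq> 0})"

(* Strong solution on [0,T] with m(0) = m0, for s > 1/2.  Every u t is the continuous
   representative, hence C^2 because s + 2 > 5/2, so momentum (u t) is a classical expression.
   In contrast m_t and the x-derivative of the flux only lie in H^(s-1), where s - 1 may be
   negative, so for every t the equation is an identity of distributions in x. *)
definition strong_solution ::
    "real \<Rightarrow> (real \<Rightarrow> real) \<Rightarrow> real \<Rightarrow> (real \<Rightarrow> real \<Rightarrow> real) \<Rightarrow> bool" where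
  "strong_solution s m0 T u \<longleftrightarrow>
     (\<forall>t\<in>{0..T}. continuous_on UNIV (u t)) \<and>
     sobolev_C0 (s + 2) {0..T} u \<and>
     sobolev_C1 (s + 1) {0..T} u \<and>
     (\<forall>t\<in>{0..T}. \<forall>\<phi>. test_function \<phi> \<longrightarrow>
        ((\<lambda>\<tau>. \<integral>x. momentum (u \<tau>) x * \<phi> x \<partial>lborel) has_real_derivative
           (\<integral>x. velocity (u t) x * momentum (u t) x * deriv \<phi> x \<partial>lborel))
          (at t within {0..T})) \<and>
     (\<forall>x. momentum (u 0) x = m0 x)"

definition max_existence_time :: "real \<Rightarrow> (real \<Rightarrow> real) \<Rightarrow> ereal" where
  "max_existence_time s m0 = (SUP T\<in>{T. 0 < T \<and> (\<exists>u. strong_solution s m0 T u)}. ereal T)"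

definition maximal_strong_solution ::
    "real \<Rightarrow> (real \<Rightarrow> real) \<Rightarrow> ereal \<Rightarrow> (real \<Rightarrow> real \<Rightarrow> real) \<Rightarrow> bool" where
  "maximal_strong_solution s m0 Tstar u \<longleftrightarrow>
     Tstar = max_existence_time s m0 \<and> 0 < Tstar \<and>
     (\<forall>T>0. ereal T < Tstar \<longrightarrow> strong_solution s m0 T u)"

definition characteristic_flow ::
    "ereal \<Rightarrow> (real \<Rightarrow> real \<Rightarrow> real) \<Rightarrow> (real \<Rightarrow> real \<Rightarrow> real) \<Rightarrow> bool" where
  "characteristic_flow Tstar u q \<longleftrightarrow>
     (\<forall>x. q 0 x = x \<and>
       (\<forall>t\<ge>0. ereal t < Tstar \<longrightarrow>
          ((\<lambda>\<tau>. q \<tau> x) has_real_derivative velocity (u t) (q t x))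
            (at t within {\<tau>. 0 \<le> \<tau> \<and> ereal \<tau> < Tstar})))"

end

theory Submission
  imports Defs "HOL-Probability.Characteristic_Functions"
begin

text \<open>Put $N = M/m = \cos(u^2-u_x^2)\,u_x$. By Gaussian summation the $L^2$ Fourier transform can be inverted for
  $u(t)$, so $u$, $u_x$, $u_{xx}$ are bounded and $u$, $u_x$ are differentiable in time, uniformly in $x$. Testing
  the equation shows that $F = u_{tx} - \sin(u^2-u_x^2)\,m$ satisfies $F_x = u_t$. Hence the mass
  between two characteristics is conserved, which gives $m \ge 0$, and a comparison argument gives $|u_x| \le u$
  and $|F|, |u_t| \le \kappa u$ whenever $|\sin(u^2-u_x^2)| \le \kappa$. The energy $\int u^2 + u_x^2$ is conserved,
  so $u \le 5 \|u_0\|_{H^1}$, and along every characteristic $N$ grows at a rate of at most $C_1$.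

  The distance between two neighbouring characteristics divided by the mass between them is positive,
  tends to $1/m_0$ at time $0$ as the characteristics merge, and its time derivative is twice a weighted mean of $N$.
  Therefore $0 \le 1/m_0 + 2 N_0 t + C_1 t^2$ as long as the solution exists, and this fails for $t = \xi/2$.\<close>

section \<open>The $L^2$ Fourier transform\<close>

text \<open>Formally m satisfies dm/dt = -2 N m^2 along a characteristic, so 1/m has derivative 2 N
  there, and an upper bound for N would force 1/m below 0. The obstacle is regularity: for s > 1/2
  the momentum is merely continuous, m_t and m_x are distributions, and this equation has no
  pointwise meaning. Everything therefore runs one derivative lower: u_t and u_tx are the highest
  time derivatives in use. N can still be differentiated along a characteristic, because the m
  contained in u_tx cancels against the transport term. With S = sin(u^2 - u_x^2) one has F - F_xx =
  -S m, so F is -p * (S m). Bounds usually read off from the kernel p come from a comparison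
  principle for w - w'' \<ge> 0 instead, and no convolution occurs. The powers in C_1 come from |S|
  \<le> u^2: if u \<le> P, then u and u_x change along characteristics at a rate of at most 2 P^3,
  and N grows at a rate of at most 8 P^5 + 2 P^3. With P = 5 times the H^1 norm this gives the
  constant 25000 = 8 * 5^5.\<close>

definition trunc_ft :: "(real \<Rightarrow> real) \<Rightarrow> nat \<Rightarrow> real \<Rightarrow> complex" where
  "trunc_ft f n k =
     (LBINT x:{- real n..real n}. f x *\<^sub>R cis (- (k * x))) / complex_of_real (sqrt (2 * pi))"

definition inv_ft :: "(real \<Rightarrow> complex) \<Rightarrow> real \<Rightarrow> complex" where
  "inv_ft g x = (LBINT k. g k * cis (k * x)) / complex_of_real (sqrt (2 * pi))"

lemma borel_measurable_cis [measurable]: "cis \<in> borel_measurable borel"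
  by (intro borel_measurable_continuous_onI continuous_intros)

lemma integrable_mult_of_L2:
  fixes f g :: "'a \<Rightarrow> 'b::{real_normed_algebra, banach, second_countable_topology}"
  assumes [measurable]: "f \<in> borel_measurable M" "g \<in> borel_measurable M"
    and "integrable M (\<lambda>x. (norm (f x))\<^sup>2)" "integrable M (\<lambda>x. (norm (g x))\<^sup>2)"
  shows "integrable M (\<lambda>x. f x * g x)"
proof (rule Bochner_Integration.integrable_bound)
  show "integrable M (\<lambda>x. (norm (f x))\<^sup>2 + (norm (g x))\<^sup>2)"
    using assms by simp
  show "AE x in M. norm (f x * g x) \<le> norm ((norm (f x))\<^sup>2 + (norm (g x))\<^sup>2)"
  proof (rule AE_I2)
    fix x
    have "norm (f x * g x) \<le> norm (f x) * norm (g x)"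
      by (rule norm_mult_ineq)
    also have "\<dots> \<le> (norm (f x))\<^sup>2 + (norm (g x))\<^sup>2"
      using sum_squares_bound[of "norm (f x)" "norm (g x)"]
        mult_nonneg_nonneg[OF norm_ge_zero[of "f x"] norm_ge_zero[of "g x"]] by linarith
    finally show "norm (f x * g x) \<le> norm ((norm (f x))\<^sup>2 + (norm (g x))\<^sup>2)" by simp
  qed
qed simp

lemma integrable_interval_of_L2:
  fixes f :: "real \<Rightarrow> real"
  assumes "f \<in> borel_measurable lborel" "integrable lborel (\<lambda>x. (f x)\<^sup>2)"
  shows "integrable lborel (\<lambda>x. f x * indicator {a..b} x)"
proof -
  have "integrable lborel (indicat_real {a..b})"
    by (intro integrable_real_indicator) (auto simp: emeasure_lborel_Icc_eq)
  then have "integrable lborel (\<lambda>x. (indicat_real {a..b} x)\<^sup>2)"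
    by (simp add: power2_eq_square indicator_inter_arith[symmetric])
  with assms show ?thesis
    by (intro integrable_mult_of_L2) auto
qed

lemma set_integrable_trunc:
  fixes f :: "real \<Rightarrow> real"
  assumes [measurable]: "f \<in> borel_measurable lborel" and "integrable lborel (\<lambda>x. (f x)\<^sup>2)"
  shows "set_integrable lborel {a..b} (\<lambda>x. f x *\<^sub>R cis (- (k * x)))"
  unfolding set_integrable_def
  by (rule Bochner_Integration.integrable_bound[OF integrable_interval_of_L2[OF assms, of a b]])
     (auto simp: indicator_def intro!: AE_I2)

lemma borel_measurable_trunc_ft [measurable]:
  assumes [measurable]: "f \<in> borel_measurable lborel"
  shows "trunc_ft f n \<in> borel_measurable lborel"
  unfolding trunc_ft_def[abs_def] set_lebesgue_integral_def by measurable

abbreviation L2_dist_sq :: "(real \<Rightarrow> complex) \<Rightarrow> (real \<Rightarrow> complex) \<Rightarrow> ennreal" where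
  "L2_dist_sq g h \<equiv> \<integral>\<^sup>+ k. ennreal ((norm (g k - h k))\<^sup>2) \<partial>lborel"

lemma L2_fourier_iff:
  "L2_fourier f g \<longleftrightarrow>
     f \<in> borel_measurable lborel \<and> integrable lborel (\<lambda>x. (f x)\<^sup>2) \<and>
     g \<in> borel_measurable lborel \<and> integrable lborel (\<lambda>k. (norm (g k))\<^sup>2) \<and>
     (\<lambda>n. L2_dist_sq g (trunc_ft f n)) \<longlonglongrightarrow> 0"
  unfolding L2_fourier_def trunc_ft_def ..

lemma norm_diff_squared_le:
  fixes x y z :: "'a::real_normed_vector"
  shows "(norm (x - y))\<^sup>2 \<le> 2 * (norm (x - z))\<^sup>2 + 2 * (norm (y - z))\<^sup>2"
proof -
  have "norm (x - y) \<le> norm (x - z) + norm (y - z)"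
    using norm_triangle_ineq4[of "x - z" "y - z"] by simp
  then have "(norm (x - y))\<^sup>2 \<le> (norm (x - z) + norm (y - z))\<^sup>2"
    by (intro power_mono) auto
  also have "\<dots> \<le> 2 * (norm (x - z))\<^sup>2 + 2 * (norm (y - z))\<^sup>2"
    using sum_squares_bound[of "norm (x - z)" "norm (y - z)"] by (simp add: power2_sum)
  finally show ?thesis .
qed

text \<open>Both functions are L^2 limits of the same truncated transforms. Uniqueness matters
  because \<open>sobolev_norm\<close> picks a transform by \<open>SOME\<close>.\<close>

lemma L2_fourier_unique:
  assumes "L2_fourier f g" "L2_fourier f h"
  shows "AE k in lborel. g k = h k"
proof -
  have [measurable]: "f \<in> borel_measurable lborel" "g \<in> borel_measurable lborel" "h \<in> borel_measurable lborel"
    and lim: "(\<lambda>n. L2_dist_sq g (trunc_ft f n)) \<longlonglongrightarrow> 0"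
      "(\<lambda>n. L2_dist_sq h (trunc_ft f n)) \<longlonglongrightarrow> 0"
    using assms by (auto simp: L2_fourier_iff)
  have bd: "(L2_dist_sq g h) \<le>
     2 * (L2_dist_sq g (trunc_ft f n)) +
     2 * (L2_dist_sq h (trunc_ft f n))" for n
  proof -
    have "(L2_dist_sq g h) \<le>
      (\<integral>\<^sup>+ k. 2 * ennreal ((norm (g k - trunc_ft f n k))\<^sup>2)
         + 2 * ennreal ((norm (h k - trunc_ft f n k))\<^sup>2) \<partial>lborel)"
    proof (intro nn_integral_mono)
      fix k
      have "ennreal ((norm (g k - h k))\<^sup>2) \<le>
         ennreal (2 * (norm (g k - trunc_ft f n k))\<^sup>2 + 2 * (norm (h k - trunc_ft f n k))\<^sup>2)"
        by (intro ennreal_leI norm_diff_squared_le)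
      then show "ennreal ((norm (g k - h k))\<^sup>2) \<le> 2 * ennreal ((norm (g k - trunc_ft f n k))\<^sup>2)
         + 2 * ennreal ((norm (h k - trunc_ft f n k))\<^sup>2)"
        by (simp add: ennreal_plus ennreal_mult)
    qed
    also have "\<dots> = 2 * (L2_dist_sq g (trunc_ft f n)) +
     2 * (L2_dist_sq h (trunc_ft f n))"
      by (subst nn_integral_add) (simp_all add: nn_integral_cmult)
    finally show ?thesis .
  qed
  have "(\<lambda>n. 2 * (L2_dist_sq g (trunc_ft f n)) +
     2 * (L2_dist_sq h (trunc_ft f n))) \<longlonglongrightarrow> 2 * 0 + 2 * 0"
    by (intro tendsto_add ennreal_tendsto_cmult lim) auto
  then have "(L2_dist_sq g h) \<le> 2 * 0 + 2 * 0"
    using bd by (intro LIMSEQ_le_const) auto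
  then have "(L2_dist_sq g h) = 0" by simp
  then have "AE k in lborel. ennreal ((norm (g k - h k))\<^sup>2) = 0"
    by (subst (asm) nn_integral_0_iff_AE) auto
  then show ?thesis by eventually_elim (simp add: ennreal_eq_0_iff)
qed

lemma trunc_ft_linear:
  assumes "f \<in> borel_measurable lborel" "integrable lborel (\<lambda>x. (f x)\<^sup>2)"
    and "f' \<in> borel_measurable lborel" "integrable lborel (\<lambda>x. (f' x)\<^sup>2)"
  shows "trunc_ft (\<lambda>x. a * f x + b * f' x) n k =
    complex_of_real a * trunc_ft f n k + complex_of_real b * trunc_ft f' n k"
proof -
  let ?c = "\<lambda>x. cis (- (k * x))" and ?I = "{- real n..real n}"
  have "(LBINT x:?I. (a * f x + b * f' x) *\<^sub>R ?c x) =
      (LBINT x:?I. a *\<^sub>R (f x *\<^sub>R ?c x) + b *\<^sub>R (f' x *\<^sub>R ?c x))"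
    by (simp add: scaleR_add_left)
  also have "\<dots> = (LBINT x:?I. a *\<^sub>R (f x *\<^sub>R ?c x)) + (LBINT x:?I. b *\<^sub>R (f' x *\<^sub>R ?c x))"
    by (intro set_integral_add set_integrable_scaleR_right impI set_integrable_trunc assms)
  also have "\<dots> = a *\<^sub>R (LBINT x:?I. f x *\<^sub>R ?c x) + b *\<^sub>R (LBINT x:?I. f' x *\<^sub>R ?c x)"
    by (simp only: set_integral_scaleR_right)
  finally show ?thesis
    by (simp add: trunc_ft_def add_divide_distrib scaleR_conv_of_real)
qed

text \<open>Differences and difference quotients of time slices are measured in
  \<open>sobolev_norm\<close>; linearity expresses their transforms through those of the single
  slices.\<close>

lemma L2_fourier_linear:
  assumes f: "L2_fourier f g" and f': "L2_fourier f' g'"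
  shows "L2_fourier (\<lambda>x. a * f x + b * f' x)
           (\<lambda>k. complex_of_real a * g k + complex_of_real b * g' k)"
proof -
  let ?f = "\<lambda>x. a * f x + b * f' x" and ?g = "\<lambda>k. complex_of_real a * g k + complex_of_real b * g' k"
  have m [measurable]: "f \<in> borel_measurable lborel" "g \<in> borel_measurable lborel"
      "f' \<in> borel_measurable lborel" "g' \<in> borel_measurable lborel"
    and i: "integrable lborel (\<lambda>x. (f x)\<^sup>2)" "integrable lborel (\<lambda>x. (f' x)\<^sup>2)"
      "integrable lborel (\<lambda>x. (norm (g x))\<^sup>2)" "integrable lborel (\<lambda>x. (norm (g' x))\<^sup>2)"
    and lim: "(\<lambda>n. L2_dist_sq g (trunc_ft f n)) \<longlonglongrightarrow> 0"
      "(\<lambda>n. L2_dist_sq g' (trunc_ft f' n)) \<longlonglongrightarrow> 0"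
    using assms by (auto simp: L2_fourier_iff)
  have sq: "(norm (of_real a * z + of_real b * w))\<^sup>2 \<le> 2 * a\<^sup>2 * (norm z)\<^sup>2 + 2 * b\<^sup>2 * (norm w)\<^sup>2"
    for z w :: complex
    using norm_diff_squared_le[of "of_real a * z" "- (of_real b * w)" 0]
    by (simp add: norm_mult power_mult_distrib)
  have sqr: "(a * z + b * w)\<^sup>2 \<le> 2 * a\<^sup>2 * z\<^sup>2 + 2 * b\<^sup>2 * w\<^sup>2" for z w :: real
    using norm_diff_squared_le[of "a * z" "- (b * w)" 0]
    by (simp add: power_mult_distrib)
  have bd: "(L2_dist_sq ?g (trunc_ft ?f n)) \<le>
     ennreal (2 * a\<^sup>2) * (L2_dist_sq g (trunc_ft f n)) +
     ennreal (2 * b\<^sup>2) * (L2_dist_sq g' (trunc_ft f' n))" for n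
  proof -
    have "(L2_dist_sq ?g (trunc_ft ?f n)) \<le>
      (\<integral>\<^sup>+ k. ennreal (2 * a\<^sup>2) * ennreal ((norm (g k - trunc_ft f n k))\<^sup>2)
         + ennreal (2 * b\<^sup>2) * ennreal ((norm (g' k - trunc_ft f' n k))\<^sup>2) \<partial>lborel)"
    proof (intro nn_integral_mono)
      fix k
      have "of_real a * g k + of_real b * g' k - trunc_ft (\<lambda>x. a * f x + b * f' x) n k
        = of_real a * (g k - trunc_ft f n k) + of_real b * (g' k - trunc_ft f' n k)"
        by (simp add: trunc_ft_linear m i algebra_simps)
      with sq[of "g k - trunc_ft f n k" "g' k - trunc_ft f' n k"]
      show "ennreal ((norm (?g k - trunc_ft ?f n k))\<^sup>2) \<le>
         ennreal (2 * a\<^sup>2) * ennreal ((norm (g k - trunc_ft f n k))\<^sup>2)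
         + ennreal (2 * b\<^sup>2) * ennreal ((norm (g' k - trunc_ft f' n k))\<^sup>2)"
        by (simp add: ennreal_plus[symmetric] ennreal_mult'[symmetric] ennreal_leI del: ennreal_plus)
    qed
    also have "\<dots> = ennreal (2 * a\<^sup>2) * (L2_dist_sq g (trunc_ft f n)) +
     ennreal (2 * b\<^sup>2) * (L2_dist_sq g' (trunc_ft f' n))"
      by (subst nn_integral_add) (simp_all add: nn_integral_cmult)
    finally show ?thesis .
  qed
  have 0: "(\<lambda>n. ennreal (2 * a\<^sup>2) * (L2_dist_sq g (trunc_ft f n)) +
     ennreal (2 * b\<^sup>2) * (L2_dist_sq g' (trunc_ft f' n))) \<longlonglongrightarrow>
      ennreal (2 * a\<^sup>2) * 0 + ennreal (2 * b\<^sup>2) * 0"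
    by (intro tendsto_add ennreal_tendsto_cmult lim) auto
  have "(\<lambda>n. L2_dist_sq ?g (trunc_ft ?f n)) \<longlonglongrightarrow> 0"
    by (rule tendsto_sandwich[OF _ _ tendsto_const 0[simplified]]) (use bd in auto)
  moreover have "integrable lborel (\<lambda>x. (a * f x + b * f' x)\<^sup>2)"
  proof (rule Bochner_Integration.integrable_bound)
    show "integrable lborel (\<lambda>x. 2 * a\<^sup>2 * (f x)\<^sup>2 + 2 * b\<^sup>2 * (f' x)\<^sup>2)"
      using i by simp
  qed (use sqr in \<open>auto intro!: AE_I2 simp: abs_of_nonneg\<close>)
  moreover have "integrable lborel (\<lambda>x. (norm (of_real a * g x + of_real b * g' x))\<^sup>2)"
  proof (rule Bochner_Integration.integrable_bound)
    show "integrable lborel (\<lambda>x. 2 * a\<^sup>2 * (norm (g x))\<^sup>2 + 2 * b\<^sup>2 * (norm (g' x))\<^sup>2)"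
      using i by simp
  qed (use sq in \<open>auto intro!: AE_I2 simp: abs_of_nonneg\<close>)
  moreover have "(\<lambda>x. a * f x + b * f' x) \<in> borel_measurable lborel"
    "(\<lambda>k. complex_of_real a * g k + complex_of_real b * g' k) \<in> borel_measurable lborel"
    by measurable
  ultimately show ?thesis
    unfolding L2_fourier_iff by blast
qed

text \<open>Strong L^2 convergence implies weak convergence, by Cauchy-Schwarz. Integrability of
  \<psi> itself is asked for because the truncated transforms are at this stage only known to be
  bounded.\<close>

lemma trunc_ft_pairing:
  assumes fg: "L2_fourier f g" and [measurable]: "\<psi> \<in> borel_measurable lborel"
    and \<psi>1: "integrable lborel \<psi>" and \<psi>2: "integrable lborel (\<lambda>k. (norm (\<psi> k))\<^sup>2)"
  shows "(\<lambda>n. LBINT k. trunc_ft f n k * \<psi> k) \<longlonglongrightarrow> (LBINT k. g k * \<psi> k)"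
proof -
  have m [measurable]: "f \<in> borel_measurable lborel" "g \<in> borel_measurable lborel"
    and i: "integrable lborel (\<lambda>x. (f x)\<^sup>2)" "integrable lborel (\<lambda>x. (norm (g x))\<^sup>2)"
    and lim: "(\<lambda>n. L2_dist_sq g (trunc_ft f n)) \<longlonglongrightarrow> 0"
    using fg by (auto simp: L2_fourier_iff)
  have bdd: "norm (trunc_ft f n k) \<le> (LBINT x. \<bar>f x * indicator {- real n..real n} x\<bar>)" for n k
  proof -
    have "norm (LBINT x:{- real n..real n}. f x *\<^sub>R cis (- (k * x))) \<le>
       (LBINT x. norm (indicator {- real n..real n} x *\<^sub>R (f x *\<^sub>R cis (- (k * x)))))"
      unfolding set_lebesgue_integral_def by (rule integral_norm_bound)
    also have "\<dots> = (LBINT x. \<bar>f x * indicator {- real n..real n} x\<bar>)"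
      by (intro Bochner_Integration.integral_cong) (auto simp: indicator_def)
    finally have 1: "norm (LBINT x:{- real n..real n}. f x *\<^sub>R cis (- (k * x))) \<le>
       (LBINT x. \<bar>f x * indicator {- real n..real n} x\<bar>)" .
    have "1 \<le> sqrt (2 * pi)" using pi_ge_two by simp
    then have "norm (trunc_ft f n k) \<le> norm (LBINT x:{- real n..real n}. f x *\<^sub>R cis (- (k * x)))"
      unfolding trunc_ft_def
      by (auto simp: norm_divide divide_le_eq mult_le_cancel_left1)
    with 1 show ?thesis by simp
  qed
  have i1: "integrable lborel (\<lambda>k. trunc_ft f n k * \<psi> k)" for n
  proof (rule Bochner_Integration.integrable_bound)
    show "integrable lborel (\<lambda>k. (LBINT x. \<bar>f x * indicator {- real n..real n} x\<bar>) * norm (\<psi> k))"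
      using \<psi>1 by simp
  qed (use bdd in \<open>auto intro!: AE_I2 mult_right_mono simp: norm_mult abs_mult intro: order_trans\<close>)
  have i2: "integrable lborel (\<lambda>k. g k * \<psi> k)"
    using i \<psi>2 by (intro integrable_mult_of_L2) auto
  let ?d = "\<lambda>n. norm ((LBINT k. trunc_ft f n k * \<psi> k) - (LBINT k. g k * \<psi> k))"
  let ?N = "\<integral>\<^sup>+ k. ennreal ((norm (\<psi> k))\<^sup>2) \<partial>lborel"
  have N: "?N < \<infinity>"
    using \<psi>2 by (simp add: nn_integral_eq_integral)
  have bd: "ennreal (?d n ^ 2)
      \<le> ?N * (L2_dist_sq g (trunc_ft f n))" for n
  proof -
    have "ennreal (?d n)
       = ennreal (norm (LBINT k. trunc_ft f n k * \<psi> k - g k * \<psi> k))"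
      using i1 i2 by simp
    also have "\<dots> \<le> (\<integral>\<^sup>+k. ennreal (norm (trunc_ft f n k * \<psi> k - g k * \<psi> k)) \<partial>lborel)"
      using i1 i2 by (intro integral_norm_bound_ennreal) auto
    also have "\<dots> = (\<integral>\<^sup>+k. ennreal (norm (g k - trunc_ft f n k)) * ennreal (norm (\<psi> k)) \<partial>lborel)"
      by (intro nn_integral_cong)
         (simp add: left_diff_distrib[symmetric] norm_mult norm_minus_commute ennreal_mult)
    finally have "(ennreal (?d n))\<^sup>2
      \<le> (\<integral>\<^sup>+k. ennreal (norm (g k - trunc_ft f n k)) * ennreal (norm (\<psi> k)) \<partial>lborel)\<^sup>2"
      by (intro power_mono) auto
    also have "\<dots> \<le> (\<integral>\<^sup>+k. (ennreal (norm (g k - trunc_ft f n k)))\<^sup>2 \<partial>lborel) *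
         (\<integral>\<^sup>+k. (ennreal (norm (\<psi> k)))\<^sup>2 \<partial>lborel)"
      by (intro Cauchy_Schwarz_nn_integral) auto
    finally show ?thesis
      by (simp add: ennreal_power mult.commute)
  qed
  have "(\<lambda>n. ?N * (L2_dist_sq g (trunc_ft f n))) \<longlonglongrightarrow> ?N * 0"
    using N by (intro ennreal_tendsto_cmult lim) auto
  then have lim0: "(\<lambda>n. ?N * (L2_dist_sq g (trunc_ft f n))) \<longlonglongrightarrow> 0"
    by simp
  have "(\<lambda>n. ennreal (?d n ^ 2)) \<longlonglongrightarrow> ennreal 0"
    unfolding ennreal_0 by (rule tendsto_sandwich[OF _ _ tendsto_const lim0]) (use bd in auto)
  then have "(\<lambda>n. ?d n ^ 2) \<longlonglongrightarrow> 0"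
    by (rule tendsto_ennrealD) auto
  then have "(\<lambda>n. sqrt (?d n ^ 2)) \<longlonglongrightarrow> sqrt 0"
    by (rule tendsto_real_sqrt)
  then have "?d \<longlonglongrightarrow> 0" by simp
  then show ?thesis
    using tendsto_norm_zero_iff LIM_zero_iff by blast
qed

section \<open>Inversion\<close>

text \<open>Fubini on the truncation interval, where f is integrable. The forward transform of
  \<psi> is written \<open>inv_ft \<psi> (- y)\<close>, so that one notion of transform for
  integrable functions suffices.\<close>

lemma trunc_ft_multiplication:
  assumes m [measurable]: "f \<in> borel_measurable lborel" "\<psi> \<in> borel_measurable lborel"
    and f: "integrable lborel (\<lambda>x. (f x)\<^sup>2)" and \<psi>: "integrable lborel \<psi>"
  shows "(LBINT k. trunc_ft f n k * \<psi> k) =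
    (LBINT y. indicator {- real n..real n} y *\<^sub>R (f y *\<^sub>R inv_ft \<psi> (- y)))"
proof -
  let ?s = "complex_of_real (sqrt (2 * pi))"
  let ?I = "indicat_real {- real n..real n}"
  let ?h = "\<lambda>k y. (?I y *\<^sub>R (f y *\<^sub>R cis (- (k * y)))) * \<psi> k"
  have int: "integrable (lborel \<Otimes>\<^sub>M lborel) (\<lambda>(k, y). ?h k y)"
  proof (rule lborel_pair.Fubini_integrable)
    show "(\<lambda>(k, y). ?h k y) \<in> borel_measurable (lborel \<Otimes>\<^sub>M lborel)"
      by measurable
    have "norm (?h k y) = \<bar>f y * ?I y\<bar> * norm (\<psi> k)" for k y
      by (simp add: norm_mult abs_mult mult_ac)
    then have "(\<lambda>k. LBINT y. norm (?h k y)) = (\<lambda>k. (LBINT y. \<bar>f y * ?I y\<bar>) * norm (\<psi> k))"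
      by (simp only: integral_mult_left_zero)
    then show "integrable lborel (\<lambda>k. LBINT y. norm (case (k, y) of (k, y) \<Rightarrow> ?h k y))"
      using \<psi> by simp
    have "integrable lborel (\<lambda>y. ?h k y)" for k
      using set_integrable_trunc[OF m(1) f, of "- real n" "real n" k]
      by (intro integrable_mult_left) (simp add: set_integrable_def)
    then show "AE k in lborel. integrable lborel (\<lambda>y. case (k, y) of (k, y) \<Rightarrow> ?h k y)"
      by simp
  qed
  have "(LBINT k. trunc_ft f n k * \<psi> k) = (LBINT k. (LBINT y. ?h k y) / ?s)"
    unfolding trunc_ft_def set_lebesgue_integral_def integral_mult_left_zero by simp
  also have "\<dots> = (LBINT k. (LBINT y. ?h k y)) / ?s"
    by simp
  also have "(LBINT k. (LBINT y. ?h k y)) = (LBINT y. (LBINT k. ?h k y))"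
    using lborel_pair.Fubini_integral[OF int] by simp
  also have "(\<lambda>y. LBINT k. ?h k y) =
     (\<lambda>y. (?I y *\<^sub>R (f y *\<^sub>R inv_ft \<psi> (- y))) * ?s)"
  proof
    fix y
    have "?h k y = of_real (?I y * f y) * (\<psi> k * cis (- (k * y)))" for k
      by (simp add: scaleR_conv_of_real mult_ac)
    then have "(LBINT k. ?h k y) = of_real (?I y * f y) * (LBINT k. \<psi> k * cis (- (k * y)))"
      by (simp only: integral_mult_right_zero)
    then show "(LBINT k. ?h k y) = (?I y *\<^sub>R (f y *\<^sub>R inv_ft \<psi> (- y))) * ?s"
      by (simp add: inv_ft_def scaleR_conv_of_real)
  qed
  finally show ?thesis by (simp only: integral_mult_left_zero) simp
qed

lemma borel_measurable_inv_ft [measurable]: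
  assumes [measurable]: "g \<in> borel_measurable lborel"
  shows "inv_ft g \<in> borel_measurable lborel"
  unfolding inv_ft_def[abs_def] by measurable

text \<open>The truncation is removed by weak convergence on one side and dominated convergence on
  the other. Inversion and Plancherel both come from this formula by a choice of \<psi>.\<close>

lemma L2_fourier_multiplication:
  assumes fg: "L2_fourier f g" and [measurable]: "\<psi> \<in> borel_measurable lborel"
    and \<psi>1: "integrable lborel \<psi>" and \<psi>2: "integrable lborel (\<lambda>k. (norm (\<psi> k))\<^sup>2)"
    and f\<psi>: "integrable lborel (\<lambda>y. f y *\<^sub>R inv_ft \<psi> (- y))"
  shows "(LBINT k. g k * \<psi> k) = (LBINT y. f y *\<^sub>R inv_ft \<psi> (- y))"
proof (rule LIMSEQ_unique)
  have [measurable]: "f \<in> borel_measurable lborel" and f: "integrable lborel (\<lambda>x. (f x)\<^sup>2)"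
    using fg by (auto simp: L2_fourier_def)
  show "(\<lambda>n. LBINT k. trunc_ft f n k * \<psi> k) \<longlonglongrightarrow> (LBINT k. g k * \<psi> k)"
    by (rule trunc_ft_pairing) (use assms in auto)
  have "(\<lambda>n. LBINT y. indicator {- real n..real n} y *\<^sub>R (f y *\<^sub>R inv_ft \<psi> (- y)))
     \<longlonglongrightarrow> (LBINT y. f y *\<^sub>R inv_ft \<psi> (- y))"
  proof (rule integral_dominated_convergence)
    show "integrable lborel (\<lambda>y. norm (f y *\<^sub>R inv_ft \<psi> (- y)))"
      using f\<psi> by (rule integrable_norm)
    show "AE y in lborel. (\<lambda>n. indicat_real {- real n..real n} y *\<^sub>R (f y *\<^sub>R inv_ft \<psi> (- y)))
        \<longlonglongrightarrow> f y *\<^sub>R inv_ft \<psi> (- y)"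
    proof (rule AE_I2)
      fix y
      have "eventually (\<lambda>n. \<bar>y\<bar> \<le> real n) sequentially"
        using eventually_ge_at_top[of "nat \<lceil>\<bar>y\<bar>\<rceil>"] by eventually_elim linarith
      then have "eventually (\<lambda>n. indicat_real {- real n..real n} y *\<^sub>R (f y *\<^sub>R inv_ft \<psi> (- y)) =
          f y *\<^sub>R inv_ft \<psi> (- y)) sequentially"
        by eventually_elim (auto simp: indicator_def)
      then show "(\<lambda>n. indicat_real {- real n..real n} y *\<^sub>R (f y *\<^sub>R inv_ft \<psi> (- y)))
        \<longlonglongrightarrow> f y *\<^sub>R inv_ft \<psi> (- y)"
        by (rule tendsto_eventually)
    qed
  qed (auto simp: indicator_def)
  then show "(\<lambda>n. LBINT k. trunc_ft f n k * \<psi> k) \<longlonglongrightarrow> (LBINT y. f y *\<^sub>R inv_ft \<psi> (- y))"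
    using \<psi>1 f by (simp add: trunc_ft_multiplication)
qed

section \<open>Gaussian kernels\<close>

lemma integral_std_gaussian_cis:
  "integrable lborel (\<lambda>t. complex_of_real (exp (- t\<^sup>2 / 2)) * cis (t * s))" (is ?int)
  "(LBINT t. complex_of_real (exp (- t\<^sup>2 / 2)) * cis (t * s)) =
     complex_of_real (sqrt (2 * pi) * exp (- s\<^sup>2 / 2))" (is ?eq)
proof -
  have "integrable lborel std_normal_density" by simp
  then have "integrable lborel (\<lambda>t. sqrt (2 * pi) * std_normal_density t)" by simp
  then have "integrable lborel (\<lambda>t. exp (- t\<^sup>2 / 2) :: real)"
    by (simp add: std_normal_density_def)
  then show ?int
    by (rule Bochner_Integration.integrable_bound) (auto simp: norm_mult)
  \<comment> \<open>The Gaussian integral is the characteristic function of the standard normal law,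
    up to the normalisation of the density.\<close>
  have "complex_of_real (exp (- s\<^sup>2 / 2)) = (\<integral>t. cis (s * t) \<partial>std_normal_distribution)"
    using fun_cong[OF char_std_normal_distribution, of s]
    by (simp add: char_def cis_conv_exp)
  also have "\<dots> = (LBINT t. std_normal_density t *\<^sub>R cis (s * t))"
    by (rule integral_density) auto
  also have "\<dots> = (LBINT t. complex_of_real (1 / sqrt (2 * pi)) * (complex_of_real (exp (- t\<^sup>2 / 2)) * cis (t * s)))"
    by (intro Bochner_Integration.integral_cong refl)
       (simp add: std_normal_density_def scaleR_conv_of_real mult.commute[of _ s])
  also have "\<dots> = complex_of_real (1 / sqrt (2 * pi)) * (LBINT t. complex_of_real (exp (- t\<^sup>2 / 2)) * cis (t * s))"
    by (rule integral_mult_right_zero)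
  finally show ?eq by simp
qed

text \<open>An approximate identity at scale 1/m. Its total mass is sqrt (2 \<pi>), the factor by
  which \<open>inv_ft\<close> divides.\<close>

definition gauss_kernel :: "real \<Rightarrow> real \<Rightarrow> real" where
  "gauss_kernel m z = m * exp (- (m * z)\<^sup>2 / 2)"

lemma borel_measurable_gauss_kernel [measurable]:
  "gauss_kernel m \<in> borel_measurable borel"
  unfolding gauss_kernel_def[abs_def]
  by (intro borel_measurable_continuous_onI continuous_intros) auto

lemma borel_measurable_cnj [measurable]: "cnj \<in> borel_measurable borel"
  by (intro borel_measurable_continuous_onI continuous_intros)

text \<open>\<psi> is a Gaussian cutoff modulated to the point x. Tested against it, the
  multiplication formula equates the regularised inversion integral with a local average of f around
  x.\<close>

lemma inv_ft_gauss:
  fixes m x :: real assumes "m > 0"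
  defines "\<psi> \<equiv> \<lambda>k. cis (k * x) * complex_of_real (exp (- (k / m)\<^sup>2 / 2))"
  shows "integrable lborel \<psi>" "inv_ft \<psi> (- y) = complex_of_real (gauss_kernel m (y - x))"
    "integrable lborel (\<lambda>k. (norm (\<psi> k))\<^sup>2)"
proof -
  have *: "integrable lborel (\<lambda>t. complex_of_real (exp (- t\<^sup>2 / 2)) * cis (t * (m * s)))
     \<longleftrightarrow> integrable lborel (\<lambda>k. complex_of_real (exp (- (k / m)\<^sup>2 / 2)) * cis (k * s))" for s
    using lborel_integrable_real_affine_iff[of "m" "\<lambda>k. complex_of_real (exp (- (k / m)\<^sup>2 / 2)) * cis (k * s)" 0] assms(1)
    by (simp add: mult_ac)
  show "integrable lborel \<psi>"
    using *[of x] integral_std_gaussian_cis(1)[of "m * x"] by (simp add: \<psi>_def mult_ac)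
  have "(LBINT k. \<psi> k * cis (k * (- y))) =
     (LBINT k. complex_of_real (exp (- (k / m)\<^sup>2 / 2)) * cis (k * (x - y)))"
    unfolding \<psi>_def
    by (intro Bochner_Integration.integral_cong refl) (simp add: mult_ac cis_mult algebra_simps)
  also have "\<dots> = m *\<^sub>R (LBINT t. complex_of_real (exp (- t\<^sup>2 / 2)) * cis (t * (m * (x - y))))"
    using lborel_integral_real_affine[of "m" "\<lambda>k. complex_of_real (exp (- (k / m)\<^sup>2 / 2)) * cis (k * (x - y))" 0] assms(1)
    by (simp add: mult_ac)
  also have "\<dots> = m *\<^sub>R complex_of_real (sqrt (2 * pi) * exp (- (m * (x - y))\<^sup>2 / 2))"
    by (simp only: integral_std_gaussian_cis(2))
  also have "(m * (x - y))\<^sup>2 = (m * (y - x))\<^sup>2"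
    by (simp add: power_mult_distrib power2_commute)
  finally show "inv_ft \<psi> (- y) = complex_of_real (gauss_kernel m (y - x))"
    by (simp add: inv_ft_def gauss_kernel_def scaleR_conv_of_real)
  have [measurable]: "\<psi> \<in> borel_measurable lborel" unfolding \<psi>_def by measurable
  show "integrable lborel (\<lambda>k. (norm (\<psi> k))\<^sup>2)"
  proof (rule Bochner_Integration.integrable_bound[OF \<open>integrable lborel \<psi>\<close>])
    have "norm (\<psi> k) \<le> 1" for k by (simp add: \<psi>_def norm_mult)
    then show "AE k in lborel. norm ((norm (\<psi> k))\<^sup>2) \<le> norm (\<psi> k)"
      by (intro AE_I2) (simp add: power2_eq_square mult_left_le)
  qed simp
qed

lemma add_divide_Suc_tendsto: "(\<lambda>n. c + z / real (Suc n)) \<longlonglongrightarrow> c"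
  using tendsto_add[OF tendsto_const tendsto_mult[OF tendsto_const LIMSEQ_inverse_real_of_nat], of c z]
  by (simp add: divide_inverse)

lemma gaussian_L2:
  fixes m x :: real assumes "m > 0"
  shows "integrable lborel (\<lambda>y. (exp (- (m * (y - x))\<^sup>2 / 2))\<^sup>2)"
proof -
  have "integrable lborel (\<lambda>t. exp (- t\<^sup>2 / 2) :: real)"
    using integrable_norm[OF integral_std_gaussian_cis(1)[of 0]] by (simp add: norm_mult)
  then have i: "integrable lborel (\<lambda>y. exp (- (m * (y - x))\<^sup>2 / 2))"
    using lborel_integrable_real_affine_iff[of m "\<lambda>t. exp (- t\<^sup>2 / 2)" "- m * x"] assms
    by (simp add: algebra_simps)
  show ?thesis
  proof (rule Bochner_Integration.integrable_bound[OF i])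
    show "AE y in lborel. norm ((exp (- (m * (y - x))\<^sup>2 / 2))\<^sup>2) \<le> norm (exp (- (m * (y - x))\<^sup>2 / 2))"
    proof (rule AE_I2)
      fix y
      have "exp (- (m * (y - x))\<^sup>2 / 2) \<le> 1" by simp
      then show "norm ((exp (- (m * (y - x))\<^sup>2 / 2))\<^sup>2) \<le> norm (exp (- (m * (y - x))\<^sup>2 / 2))"
        by (simp add: power2_eq_square mult_left_le del: exp_le_one_iff)
    qed
  qed simp
qed

text \<open>Two bounds at distance at least 1 from the centre: a square integrable majorant
  independent of m, and decay as m grows. The first rests on m \<le> exp (m - 1) \<le> exp ((m^2 -
  1) / 2) and z^2 \<ge> 1.\<close>

lemma gauss_kernel_tail:
  assumes "m \<ge> 1" "\<bar>z\<bar> \<ge> 1"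
  shows "gauss_kernel m z \<le> exp (- z\<^sup>2 / 2)" "gauss_kernel m z \<le> 2 / m"
proof -
  have z: "1 \<le> z\<^sup>2" using assms(2) abs_le_square_iff[of 1 z] by simp
  have m2: "1 \<le> m\<^sup>2" using assms by simp
  have "m \<le> exp (m - 1)" using exp_ge_add_one_self[of "m - 1"] by simp
  also have "m - 1 \<le> (m\<^sup>2 - 1) / 2"
    using zero_le_power2[of "m - 1"] by (simp add: power2_eq_square algebra_simps)
  then have "exp (m - 1) \<le> exp ((m\<^sup>2 - 1) * 1 / 2)" by simp
  also have "\<dots> \<le> exp ((m\<^sup>2 - 1) * z\<^sup>2 / 2)"
    using z m2 mult_left_mono[of 1 "z\<^sup>2" "m\<^sup>2 - 1"] by simp
  finally have "gauss_kernel m z \<le> exp ((m\<^sup>2 - 1) * z\<^sup>2 / 2) * exp (- (m * z)\<^sup>2 / 2)"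
    unfolding gauss_kernel_def by (intro mult_right_mono) auto
  also have "\<dots> = exp (- z\<^sup>2 / 2)"
    by (simp add: exp_add[symmetric] power_mult_distrib field_simps)
  finally show "gauss_kernel m z \<le> exp (- z\<^sup>2 / 2)" .
  have "m\<^sup>2 \<le> (m * z)\<^sup>2"
    using z m2 mult_left_mono[of 1 "z\<^sup>2" "m\<^sup>2"] by (simp add: power_mult_distrib)
  then have "m\<^sup>2 / 2 \<le> exp ((m * z)\<^sup>2 / 2)"
    using exp_ge_add_one_self[of "(m * z)\<^sup>2 / 2"] by linarith
  then have "m * exp (- (m * z)\<^sup>2 / 2) \<le> 2 / m"
    using assms by (simp add: exp_minus field_simps power2_eq_square)
  then show "gauss_kernel m z \<le> 2 / m" by (simp add: gauss_kernel_def)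
qed

text \<open>f is only continuous and square integrable, so no global bound for f is at hand as a
  majorant. The Gaussian average is therefore split at distance 1 from x: outside, the tail bounds
  allow dominated convergence to 0; inside, f is bounded by compactness and its continuity at x
  decides the limit.\<close>

theorem L2_fourier_inversion:
  assumes fg: "L2_fourier f g" and g: "integrable lborel g" and f: "continuous_on UNIV f"
  shows "inv_ft g x = complex_of_real (f x)"
proof -
  let ?\<psi> = "\<lambda>n k. cis (k * x) * complex_of_real (exp (- (k / real (Suc n))\<^sup>2 / 2))"
  let ?W = "\<lambda>n z. indicat_real {- real (Suc n)..real (Suc n)} z * (f (x + z / real (Suc n)) * exp (- z\<^sup>2 / 2))"
  let ?K = "\<lambda>n y. gauss_kernel (real (Suc n)) (y - x)"
  let ?I = "\<lambda>n y. indicat_real {x - 1..x + 1} y * (f y * ?K n y)"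
    and ?O = "\<lambda>n y. indicat_real (- {x - 1..x + 1}) y * (f y * ?K n y)"
  have [measurable]: "f \<in> borel_measurable lborel" "g \<in> borel_measurable lborel"
    and f2: "integrable lborel (\<lambda>x. (f x)\<^sup>2)"
    using fg by (auto simp: L2_fourier_def)
  have fK: "integrable lborel (\<lambda>y. f y * ?K n y)" for n
  proof (rule integrable_mult_of_L2)
    show "integrable lborel (\<lambda>y. (norm (?K n y))\<^sup>2)"
      using integrable_mult_right[OF gaussian_L2[of "real (Suc n)" x], of "(real (Suc n))\<^sup>2"]
      by (simp add: gauss_kernel_def power_mult_distrib)
  qed (use f2 in auto)
  have eq: "(LBINT k. g k * ?\<psi> n k) = complex_of_real (LBINT y. f y * ?K n y)" for n
  proof -
    have "(LBINT k. g k * ?\<psi> n k) = (LBINT y. f y *\<^sub>R inv_ft (?\<psi> n) (- y))"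
    proof (rule L2_fourier_multiplication[OF fg])
      have "integrable lborel (\<lambda>y. complex_of_real (f y * ?K n y))"
        using fK[of n] by (rule integrable_of_real)
      then show "integrable lborel (\<lambda>y. f y *\<^sub>R inv_ft (?\<psi> n) (- y))"
        by (subst inv_ft_gauss) (auto simp: scaleR_conv_of_real)
    qed (use inv_ft_gauss[of "real (Suc n)" x] in auto)
    also have "\<dots> = (LBINT y. complex_of_real (f y * ?K n y))"
      by (subst inv_ft_gauss) (auto simp: scaleR_conv_of_real)
    also have "\<dots> = complex_of_real (LBINT y. f y * ?K n y)"
      by (rule integral_complex_of_real)
    finally show ?thesis .
  qed
  have lim1: "(\<lambda>n. LBINT k. g k * ?\<psi> n k) \<longlonglongrightarrow> (LBINT k. g k * cis (k * x))"
  proof (rule integral_dominated_convergence)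
    show "integrable lborel (\<lambda>k. norm (g k))" using g by simp
    show "AE k in lborel. (\<lambda>n. g k * ?\<psi> n k) \<longlonglongrightarrow> g k * cis (k * x)"
    proof (rule AE_I2)
      fix k
      have "(\<lambda>n. k / real (Suc n)) \<longlonglongrightarrow> 0"
        using add_divide_Suc_tendsto[of 0 k] by simp
      then have "(\<lambda>n. g k * ?\<psi> n k) \<longlonglongrightarrow> g k * (cis (k * x) * complex_of_real (exp (- 0\<^sup>2 / 2)))"
        by (intro tendsto_intros) auto
      then show "(\<lambda>n. g k * ?\<psi> n k) \<longlonglongrightarrow> g k * cis (k * x)" by simp
    qed
    show "AE k in lborel. norm (g k * ?\<psi> n k) \<le> norm (g k)" for n
      by (intro AE_I2) (simp add: norm_mult mult_left_le)
  qed auto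
  have outer: "(\<lambda>n. LBINT y. ?O n y) \<longlonglongrightarrow> integral\<^sup>L lborel (\<lambda>y::real. 0)"
  proof (rule integral_dominated_convergence)
    have "integrable lborel (\<lambda>y. f y * exp (- (1 * (y - x))\<^sup>2 / 2))"
      by (rule integrable_mult_of_L2) (use f2 gaussian_L2[of 1 x] in auto)
    then show "integrable lborel (\<lambda>y. \<bar>f y * exp (- (y - x)\<^sup>2 / 2)\<bar>)" by simp
    show "AE y in lborel. norm (?O n y)
            \<le> \<bar>f y * exp (- (y - x)\<^sup>2 / 2)\<bar>" for n
    proof (rule AE_I2)
      fix y
      have "0 \<le> ?K n y" by (simp add: gauss_kernel_def)
      then show "norm (?O n y) \<le> \<bar>f y * exp (- (y - x)\<^sup>2 / 2)\<bar>"
        using gauss_kernel_tail(1)[of "real (Suc n)" "y - x"]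
        by (auto simp: indicator_def abs_mult intro!: mult_left_mono)
    qed
    show "AE y in lborel. (\<lambda>n. ?O n y) \<longlonglongrightarrow> 0"
    proof (rule AE_I2)
      fix y
      show "(\<lambda>n. ?O n y) \<longlonglongrightarrow> 0"
      proof (rule Lim_null_comparison[OF always_eventually])
        show "(\<lambda>n. \<bar>f y\<bar> * (2 / real (Suc n))) \<longlonglongrightarrow> 0"
          using add_divide_Suc_tendsto[of 0 "\<bar>f y\<bar> * 2"] by simp
        show "\<forall>n. norm (?O n y) \<le> \<bar>f y\<bar> * (2 / real (Suc n))"
        proof
          fix n
          have "0 \<le> ?K n y" by (simp add: gauss_kernel_def)
          then show "norm (?O n y) \<le> \<bar>f y\<bar> * (2 / real (Suc n))"
            using gauss_kernel_tail(2)[of "real (Suc n)" "y - x"]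
            by (auto simp: indicator_def abs_mult simp del: of_nat_Suc times_divide_eq_right intro!: mult_left_mono)
        qed
      qed
    qed
  qed auto
  have "compact (f ` {x - 1..x + 1})"
    using f by (intro compact_continuous_image) (auto intro: continuous_on_subset)
  then obtain B where B: "\<And>y. y \<in> {x - 1..x + 1} \<Longrightarrow> \<bar>f y\<bar> \<le> B"
    by (metis bounded_iff compact_imp_bounded imageI real_norm_def)
  have gint: "integrable lborel (\<lambda>t. exp (- t\<^sup>2 / 2) :: real)"
    using integrable_norm[OF integral_std_gaussian_cis(1)[of 0]] by (simp add: norm_mult)
  have gval: "(LBINT t. exp (- t\<^sup>2 / 2)) = sqrt (2 * pi)"
    using integral_std_gaussian_cis(2)[of 0] of_real_eq_iff[where 'a=complex]
    by (simp del: of_real_mult of_real_eq_iff)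
  \<comment> \<open>\<open>?W\<close> is the inner part after the substitution y = x + z / (n + 1):
    the Gaussian weight becomes fixed and the window grows to the whole line.\<close>
  have "(\<lambda>n. LBINT z. ?W n z) \<longlonglongrightarrow> (LBINT z. f x * exp (- z\<^sup>2 / 2))"
  proof (rule integral_dominated_convergence)
    show "integrable lborel (\<lambda>z. B * exp (- z\<^sup>2 / 2))" using gint by simp
    have B0: "0 \<le> B" using B[of x] by auto
    show "AE z in lborel. norm (?W n z) \<le> B * exp (- z\<^sup>2 / 2)" for n
    proof (rule AE_I2)
      fix z :: real
      have "z \<in> {- real (Suc n)..real (Suc n)} \<Longrightarrow> x + z / real (Suc n) \<in> {x - 1..x + 1}"
        by (simp add: field_simps)
      then show "norm (?W n z) \<le> B * exp (- z\<^sup>2 / 2)"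
        using B[of "x + z / real (Suc n)"] B0
        by (auto simp: indicator_def abs_mult intro!: mult_right_mono)
    qed
    show "AE z in lborel. (\<lambda>n. ?W n z) \<longlonglongrightarrow> f x * exp (- z\<^sup>2 / 2)"
    proof (rule AE_I2)
      fix z
      have ev: "eventually (\<lambda>n. indicat_real {- real (Suc n)..real (Suc n)} z = 1) sequentially"
        using eventually_ge_at_top[of "nat \<lceil>\<bar>z\<bar>\<rceil>"]
        by eventually_elim (auto simp: indicator_def; linarith)
      have "isCont f x" using f continuous_on_eq_continuous_at[of UNIV] by auto
      then have "(\<lambda>n. f (x + z / real (Suc n))) \<longlonglongrightarrow> f x"
        by (rule isCont_tendsto_compose[OF _ add_divide_Suc_tendsto])
      then have "(\<lambda>n. 1 * (f (x + z / real (Suc n)) * exp (- z\<^sup>2 / 2))) \<longlonglongrightarrow> 1 * (f x * exp (- z\<^sup>2 / 2))"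
        by (intro tendsto_mult tendsto_const)
      then show "(\<lambda>n. ?W n z) \<longlonglongrightarrow> f x * exp (- z\<^sup>2 / 2)"
        using ev by (subst tendsto_cong[where g = "\<lambda>n. 1 * (f (x + z / real (Suc n)) * exp (- z\<^sup>2 / 2))"])
          (auto elim: eventually_mono)
    qed
  qed auto
  moreover have "(LBINT z. ?W n z) =
         (LBINT y. ?I n y)" for n
  proof -
    define m where "m = real (Suc n)"
    have m: "m > 0" by (simp add: m_def)
    have i: "indicat_real {x - 1..x + 1} (x + z / m) = indicat_real {- m..m} z" for z
      using m by (auto simp: indicator_def field_simps)
    have "(LBINT y. indicat_real {x - 1..x + 1} y * (f y * gauss_kernel m (y - x))) =
       \<bar>1 / m\<bar> *\<^sub>R (LBINT z. indicat_real {x - 1..x + 1} (x + 1 / m * z) *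
          (f (x + 1 / m * z) * gauss_kernel m (x + 1 / m * z - x)))"
      by (rule lborel_integral_real_affine) (use m in simp)
    also have "\<dots> = (LBINT z. indicat_real {- m..m} z * (f (x + z / m) * exp (- z\<^sup>2 / 2)))"
      unfolding integral_scaleR_right[symmetric] using m i
      by (intro Bochner_Integration.integral_cong refl) (simp add: gauss_kernel_def)
    finally show ?thesis by (simp add: m_def)
  qed
  ultimately have inner: "(\<lambda>n. LBINT y. ?I n y)
      \<longlonglongrightarrow> f x * sqrt (2 * pi)"
    using gval by (simp del: of_nat_Suc)
  have "(LBINT y. ?I n y) +
     (LBINT y. ?O n y) = (LBINT y. f y * ?K n y)" for n
  proof -
    have i: "integrable lborel (\<lambda>y. indicat_real A y * (f y * ?K n y))" if "A \<in> sets lborel" for A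
      using integrable_mult_indicator[OF that fK[of n]] by simp
    have "(LBINT y. ?I n y) +
      (LBINT y. ?O n y) =
      (LBINT y. ?I n y +
         ?O n y)"
      by (intro Bochner_Integration.integral_add[symmetric] i) auto
    also have "\<dots> = (LBINT y. f y * ?K n y)"
      by (intro Bochner_Integration.integral_cong refl) (simp add: indicator_def)
    finally show ?thesis .
  qed
  then have "(\<lambda>n. LBINT y. f y * ?K n y) \<longlonglongrightarrow> f x * sqrt (2 * pi)"
    using tendsto_add[OF inner outer] by simp
  then have "(\<lambda>n. LBINT k. g k * ?\<psi> n k) \<longlonglongrightarrow> complex_of_real (f x * sqrt (2 * pi))"
    unfolding eq by (rule tendsto_of_real)
  then have "(LBINT k. g k * cis (k * x)) = complex_of_real (f x * sqrt (2 * pi))"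
    using lim1 LIMSEQ_unique by blast
  then show ?thesis by (simp add: inv_ft_def)
qed

text \<open>The multiplication formula with the conjugate of g as test function; its transform is f,
  since f is real and the inversion formula can be conjugated.\<close>

lemma L2_fourier_plancherel:
  assumes fg: "L2_fourier f g" and g: "integrable lborel g" and f: "continuous_on UNIV f"
  shows "(LBINT x. (f x)\<^sup>2) = (LBINT k. (norm (g k))\<^sup>2)"
proof -
  have [measurable]: "f \<in> borel_measurable lborel" "g \<in> borel_measurable lborel"
    and f2: "integrable lborel (\<lambda>x. (f x)\<^sup>2)" and g2: "integrable lborel (\<lambda>x. (norm (g x))\<^sup>2)"
    using fg by (auto simp: L2_fourier_def)
  have inv: "inv_ft (\<lambda>k. cnj (g k)) (- y) = complex_of_real (f y)" for y
  proof -
    have "(LBINT k. cnj (g k) * cis (k * (- y))) = (LBINT k. cnj (g k * cis (k * y)))"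
      by (simp add: cis_cnj)
    also have "\<dots> = cnj (LBINT k. g k * cis (k * y))"
      by (rule Bochner_Integration.integral_cnj)
    finally have "inv_ft (\<lambda>k. cnj (g k)) (- y) = cnj (inv_ft g y)"
      by (simp add: inv_ft_def)
    then show ?thesis by (simp add: L2_fourier_inversion[OF assms])
  qed
  have eq: "(\<lambda>y. f y *\<^sub>R inv_ft (\<lambda>k. cnj (g k)) (- y)) = (\<lambda>y. complex_of_real ((f y)\<^sup>2))"
    by (simp add: inv scaleR_conv_of_real power2_eq_square)
  have "(LBINT k. g k * cnj (g k)) = (LBINT y. f y *\<^sub>R inv_ft (\<lambda>k. cnj (g k)) (- y))"
  proof (rule L2_fourier_multiplication[OF fg])
    show "integrable lborel (\<lambda>y. f y *\<^sub>R inv_ft (\<lambda>k. cnj (g k)) (- y))"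
      unfolding eq using f2 by (rule integrable_of_real)
  qed (use g g2 in auto)
  then have "(LBINT k. complex_of_real ((norm (g k))\<^sup>2)) = (LBINT y. complex_of_real ((f y)\<^sup>2))"
    unfolding eq complex_norm_square by simp
  then show ?thesis by (simp only: integral_complex_of_real of_real_eq_iff)
qed

section \<open>Sobolev embedding\<close>

lemma abs_integral_mult_le:
  fixes a b :: "'a \<Rightarrow> real"
  assumes [measurable]: "a \<in> borel_measurable M" "b \<in> borel_measurable M"
    and a: "integrable M (\<lambda>x. (a x)\<^sup>2)" and b: "integrable M (\<lambda>x. (b x)\<^sup>2)"
  shows "(\<integral>x. \<bar>a x * b x\<bar> \<partial>M) \<le> sqrt (\<integral>x. (a x)\<^sup>2 \<partial>M) * sqrt (\<integral>x. (b x)\<^sup>2 \<partial>M)"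
proof -
  have i: "integrable M (\<lambda>x. \<bar>a x * b x\<bar>)"
    using integrable_mult_of_L2[of a M b] a b by simp
  have "(ennreal (\<integral>x. \<bar>a x * b x\<bar> \<partial>M))\<^sup>2 = (\<integral>\<^sup>+x. ennreal \<bar>a x\<bar> * ennreal \<bar>b x\<bar> \<partial>M)\<^sup>2"
    using i by (simp add: nn_integral_eq_integral[symmetric] abs_mult ennreal_mult)
  also have "\<dots> \<le> (\<integral>\<^sup>+x. (ennreal \<bar>a x\<bar>)\<^sup>2 \<partial>M) * (\<integral>\<^sup>+x. (ennreal \<bar>b x\<bar>)\<^sup>2 \<partial>M)"
    by (intro Cauchy_Schwarz_nn_integral) auto
  also have "\<dots> = ennreal (\<integral>x. (a x)\<^sup>2 \<partial>M) * ennreal (\<integral>x. (b x)\<^sup>2 \<partial>M)"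
    using a b by (simp add: ennreal_power nn_integral_eq_integral)
  finally have "ennreal ((\<integral>x. \<bar>a x * b x\<bar> \<partial>M)\<^sup>2) \<le> ennreal ((\<integral>x. (a x)\<^sup>2 \<partial>M) * (\<integral>x. (b x)\<^sup>2 \<partial>M))"
    by (simp add: ennreal_power ennreal_mult)
  then have "(\<integral>x. \<bar>a x * b x\<bar> \<partial>M)\<^sup>2 \<le> (\<integral>x. (a x)\<^sup>2 \<partial>M) * (\<integral>x. (b x)\<^sup>2 \<partial>M)"
    by (subst (asm) ennreal_le_iff) auto
  then show ?thesis
    unfolding real_sqrt_mult[symmetric] by (intro real_le_rsqrt)
qed

text \<open>Comparison with (1 + |k|)^(-2a), which has an explicit primitive, through (1 + |k|)^2
  \<le> 2 (1 + k^2).\<close>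

lemma integrable_japanese_bracket:
  fixes a :: real
  assumes "a > 1/2"
  shows "integrable lborel (\<lambda>k. (1 + k\<^sup>2) powr - a)"
proof -
  let ?f = "\<lambda>k::real. (1 + \<bar>k\<bar>) powr (- 2 * a)"
  have "(\<integral>\<^sup>+k. ennreal (?f k) * indicator {0..} k \<partial>lborel) =
     (\<integral>\<^sup>+k. ennreal ((1 + k) powr (- 2 * a)) * indicator {0..} k \<partial>lborel)"
    by (intro nn_integral_cong) (auto simp: indicator_def)
  also have "\<dots> = ennreal (0 - (- ((1 + 0) powr (1 - 2 * a)) / (2 * a - 1)))"
  proof (rule nn_integral_FTC_atLeast)
    show "(\<lambda>k. (1 + k) powr (- 2 * a)) \<in> borel_measurable borel" by measurable
    show "((\<lambda>k. - ((1 + k) powr (1 - 2 * a)) / (2 * a - 1)) has_real_derivative (1 + k) powr (- 2 * a)) (at k)"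
      if "0 \<le> k" for k
    proof -
      have "((\<lambda>k. (1 + k) powr (1 - 2 * a)) has_real_derivative (1 - 2 * a) * (1 + k) powr (1 - 2 * a - 1) * (0 + 1)) (at k)"
        by (rule DERIV_chain2[OF has_real_derivative_powr]) (use that in \<open>auto intro!: derivative_eq_intros\<close>)
      then have "((\<lambda>k. - ((1 + k) powr (1 - 2 * a)) / (2 * a - 1)) has_real_derivative
          - ((1 - 2 * a) * (1 + k) powr (1 - 2 * a - 1) * (0 + 1)) / (2 * a - 1)) (at k)"
        by (intro DERIV_cdivide DERIV_minus)
      moreover have "- ((1 - 2 * a) * (1 + k) powr (1 - 2 * a - 1) * (0 + 1)) / (2 * a - 1) = (1 + k) powr (- 2 * a)"
        using assms by (simp add: divide_simps) (simp add: algebra_simps)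
      ultimately show ?thesis by simp
    qed
    have "((\<lambda>k. (1 + k) powr (1 - 2 * a)) \<longlongrightarrow> 0) at_top"
      by (rule tendsto_neg_powr)
         (use assms in \<open>auto intro!: filterlim_tendsto_add_at_top tendsto_const filterlim_ident\<close>)
    then have "((\<lambda>k. - ((1 + k) powr (1 - 2 * a)) / (2 * a - 1)) \<longlongrightarrow> - 0 / (2 * a - 1)) at_top"
      using assms by (intro tendsto_intros) auto
    then show "((\<lambda>k. - ((1 + k) powr (1 - 2 * a)) / (2 * a - 1)) \<longlongrightarrow> 0) at_top" by simp
  qed simp
  finally have nn: "(\<integral>\<^sup>+k. ennreal (?f k) * indicator {0..} k \<partial>lborel) < \<infinity>" by simp
  have "integrable lborel (\<lambda>k. indicator {0..} k *\<^sub>R ?f k)"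
  proof (rule integrableI_bounded)
    have "(\<integral>\<^sup>+k. ennreal (norm (indicator {0..} k *\<^sub>R ?f k)) \<partial>lborel) =
       (\<integral>\<^sup>+k. ennreal (?f k) * indicator {0..} k \<partial>lborel)"
      by (intro nn_integral_cong) (auto simp: indicator_def)
    then show "(\<integral>\<^sup>+k. ennreal (norm (indicator {0..} k *\<^sub>R ?f k)) \<partial>lborel) < \<infinity>"
      using nn by simp
  qed measurable
  then obtain z where "has_bochner_integral lborel (\<lambda>k. indicator {0..} k *\<^sub>R ?f k) z"
    using has_bochner_integral_integrable by blast
  from has_bochner_integral_even_function[OF this]
  have "integrable lborel ?f" by (auto dest: integrable.intros)
  then have "integrable lborel (\<lambda>k. 2 powr a * ?f k)" by simp
  then show ?thesis
  proof (rule Bochner_Integration.integrable_bound)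
    show "AE k in lborel. norm ((1 + k\<^sup>2) powr - a) \<le> norm (2 powr a * ?f k)"
    proof (rule AE_I2)
      fix k :: real
      have "(1 + \<bar>k\<bar>)\<^sup>2 \<le> 2 * (1 + k\<^sup>2)"
        using zero_le_power2[of "1 - \<bar>k\<bar>"] by (simp add: power2_eq_square algebra_simps)
      then have "(2 * (1 + k\<^sup>2)) powr - a \<le> ((1 + \<bar>k\<bar>)\<^sup>2) powr - a"
        using assms by (intro powr_mono2') auto
      also have "((1 + \<bar>k\<bar>)\<^sup>2) powr - a = ?f k"
        by (simp add: powr_powr powr_numeral[symmetric] del: powr_numeral)
      finally have "2 powr - a * (1 + k\<^sup>2) powr - a \<le> ?f k"
        by (subst (asm) powr_mult) (auto simp: add_nonneg_nonneg)
      then have "2 powr a * (2 powr - a * (1 + k\<^sup>2) powr - a) \<le> 2 powr a * ?f k"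
        by (rule mult_left_mono) simp
      also have "2 powr a * (2 powr - a * (1 + k\<^sup>2) powr - a) = (1 + k\<^sup>2) powr - a"
        by (simp add: mult.assoc[symmetric] powr_add[symmetric])
      finally show "norm ((1 + k\<^sup>2) powr - a) \<le> norm (2 powr a * ?f k)" by simp
    qed
  qed measurable
qed

section \<open>Sobolev spaces on the Fourier side\<close>

definition weighted_L2 :: "real \<Rightarrow> (real \<Rightarrow> complex) set" where
  "weighted_L2 r = {g. g \<in> borel_measurable lborel \<and> integrable lborel (\<lambda>k. (1 + k\<^sup>2) powr r * (norm (g k))\<^sup>2)}"

definition weighted_norm :: "real \<Rightarrow> (real \<Rightarrow> complex) \<Rightarrow> real" where
  "weighted_norm r g = sqrt (LBINT k. (1 + k\<^sup>2) powr r * (norm (g k))\<^sup>2)"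

text \<open>The Cauchy-Schwarz constant of the embedding of H^r into C^j, meaningful for r > j +
  1/2.\<close>

definition embedding_const :: "real \<Rightarrow> nat \<Rightarrow> real" where
  "embedding_const r j = sqrt (LBINT k. (1 + k\<^sup>2) powr - (r - j))"

lemma weighted_L2_measurable [measurable_dest]: "g \<in> weighted_L2 r \<Longrightarrow> g \<in> borel_measurable lborel"
  by (simp add: weighted_L2_def)

lemma weighted_L2_linear:
  assumes "g \<in> weighted_L2 r" "h \<in> weighted_L2 r"
  shows "(\<lambda>k. complex_of_real a * g k + complex_of_real b * h k) \<in> weighted_L2 r"
proof -
  let ?s = "\<lambda>k. complex_of_real a * g k + complex_of_real b * h k"
  let ?A = "\<lambda>k. (1 + k\<^sup>2) powr r * (norm (?s k))\<^sup>2"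
    and ?B = "\<lambda>k. 2 * a\<^sup>2 * ((1 + k\<^sup>2) powr r * (norm (g k))\<^sup>2) + 2 * b\<^sup>2 * ((1 + k\<^sup>2) powr r * (norm (h k))\<^sup>2)"
  have [measurable]: "g \<in> borel_measurable lborel" "h \<in> borel_measurable lborel"
    using assms by (auto simp: weighted_L2_def)
  have "integrable lborel (\<lambda>k. ?A k)"
  proof (rule Bochner_Integration.integrable_bound)
    show "integrable lborel (\<lambda>k. ?B k)"
      using assms by (auto simp: weighted_L2_def)
    show "AE k in lborel. norm (?A k)
      \<le> norm (?B k)"
    proof (rule AE_I2)
      fix k
      have "(norm (?s k))\<^sup>2 \<le> 2 * a\<^sup>2 * (norm (g k))\<^sup>2 + 2 * b\<^sup>2 * (norm (h k))\<^sup>2"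
        using norm_diff_squared_le[of "of_real a * g k" "- (of_real b * h k)" 0]
        by (simp add: norm_mult power_mult_distrib)
      then have "?A k
          \<le> (1 + k\<^sup>2) powr r * (2 * a\<^sup>2 * (norm (g k))\<^sup>2 + 2 * b\<^sup>2 * (norm (h k))\<^sup>2)"
        by (intro mult_left_mono) auto
      then show "norm (?A k)
      \<le> norm (?B k)"
        by (simp add: algebra_simps)
    qed
  qed measurable
  then show ?thesis by (simp add: weighted_L2_def)
qed

text \<open>Cauchy-Schwarz after distributing the weight: |k|^j |g| is at most the product of (1 +
  k^2)^((j - r)/2) and (1 + k^2)^(r/2) |g|.\<close>

lemma weighted_L2_moment:
  assumes g: "g \<in> weighted_L2 r" and r: "r > real j + 1/2"
  shows "integrable lborel (\<lambda>k. \<bar>k\<bar> ^ j * norm (g k))"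
    and "(LBINT k. \<bar>k\<bar> ^ j * norm (g k)) \<le> embedding_const r j * weighted_norm r g"
proof -
  have [measurable]: "g \<in> borel_measurable lborel"
    and gi: "integrable lborel (\<lambda>k. (1 + k\<^sup>2) powr r * (norm (g k))\<^sup>2)"
    using g by (auto simp: weighted_L2_def)
  let ?a = "\<lambda>k::real. (1 + k\<^sup>2) powr ((real j - r) / 2)"
  let ?b = "\<lambda>k. (1 + k\<^sup>2) powr (r / 2) * norm (g k)"
  have sq: "((1 + k\<^sup>2) powr (c / 2))\<^sup>2 = (1 + k\<^sup>2) powr c" for k c :: real
    by (simp add: power2_eq_square powr_add[symmetric])
  have a: "integrable lborel (\<lambda>k. (?a k)\<^sup>2)"
    unfolding sq using integrable_japanese_bracket[of "r - j"] r by simp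
  have b: "integrable lborel (\<lambda>k. (?b k)\<^sup>2)"
    using gi by (simp add: power_mult_distrib sq)
  have le: "\<bar>k\<bar> ^ j * norm (g k) \<le> \<bar>?a k * ?b k\<bar>" for k
  proof -
    \<comment> \<open>The point k = 0 is kept apart: for j = 0 the natural power gives 1 there,
      whereas \<open>0 powr 0\<close> is 0.\<close>
    have "\<bar>k\<bar> ^ j = (\<bar>k\<bar> powr 2) powr (j / 2)" if "k \<noteq> 0"
      using that by (simp only: powr_powr) (simp add: powr_realpow)
    also have "(\<bar>k\<bar> powr 2) powr (j / 2) = (k\<^sup>2) powr (j / 2)" if "k \<noteq> 0"
      using that by simp
    also have "(k\<^sup>2) powr (j / 2) \<le> (1 + k\<^sup>2) powr (j / 2)"
      by (intro powr_mono2) auto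
    finally have k: "\<bar>k\<bar> ^ j \<le> (1 + k\<^sup>2) powr (j / 2)"
      by (cases "k = 0"; cases j) auto
    have "?a k * ?b k = (1 + k\<^sup>2) powr (j / 2) * norm (g k)"
      by (simp add: powr_add[symmetric] mult.assoc[symmetric] diff_divide_distrib)
    then have "\<bar>?a k * ?b k\<bar> = (1 + k\<^sup>2) powr (j / 2) * norm (g k)" by simp
    then show ?thesis using k by (simp only:) (intro mult_right_mono norm_ge_zero)
  qed
  have ab: "integrable lborel (\<lambda>k. ?a k * ?b k)"
    by (rule integrable_mult_of_L2) (use a b in auto)
  then show i: "integrable lborel (\<lambda>k. \<bar>k\<bar> ^ j * norm (g k))"
    by (rule Bochner_Integration.integrable_bound) (use le in auto)
  have "(LBINT k. \<bar>k\<bar> ^ j * norm (g k)) \<le> (LBINT k. \<bar>?a k * ?b k\<bar>)"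
    using le ab i by (intro integral_mono) auto
  also have "\<dots> \<le> sqrt (LBINT k. (?a k)\<^sup>2) * sqrt (LBINT k. (?b k)\<^sup>2)"
    by (rule abs_integral_mult_le) (use a b in auto)
  finally show "(LBINT k. \<bar>k\<bar> ^ j * norm (g k)) \<le> embedding_const r j * weighted_norm r g"
    by (simp add: sq power_mult_distrib embedding_const_def weighted_norm_def)
qed

lemma weighted_L2_mono:
  assumes "g \<in> weighted_L2 r" "r' \<le> r"
  shows "g \<in> weighted_L2 r'"
proof -
  note [measurable] = weighted_L2_measurable[OF assms(1)]
  have "integrable lborel (\<lambda>k. (1 + k\<^sup>2) powr r' * (norm (g k))\<^sup>2)"
    by (rule Bochner_Integration.integrable_bound[where f="\<lambda>k. (1 + k\<^sup>2) powr r * (norm (g k))\<^sup>2"])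
       (use assms in \<open>auto simp: weighted_L2_def intro!: AE_I2 mult_right_mono powr_mono\<close>)
  then show ?thesis by (simp add: weighted_L2_def)
qed

text \<open>The j-th derivative as a Fourier multiplier. The real part yields a real function
  without any symmetry of g having to be established.\<close>

definition inv_ft_deriv :: "nat \<Rightarrow> (real \<Rightarrow> complex) \<Rightarrow> real \<Rightarrow> real" where
  "inv_ft_deriv j g x = Re (inv_ft (\<lambda>k. (\<i> * complex_of_real k) ^ j * g k) x)"

lemma integrable_moment_complex:
  assumes "g \<in> weighted_L2 r" "r > real j + 1/2"
  shows "integrable lborel (\<lambda>k. (\<i> * complex_of_real k) ^ j * g k)"
proof (rule Bochner_Integration.integrable_bound[OF weighted_L2_moment(1)[OF assms]])
  note [measurable] = weighted_L2_measurable[OF assms(1)]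
  show "(\<lambda>k. (\<i> * complex_of_real k) ^ j * g k) \<in> borel_measurable lborel" by measurable
qed (auto simp: norm_mult norm_power)

text \<open>The integrand has modulus |k|^j |g|, and the factor 1 / sqrt (2 \<pi>) is at most 1.
  Through this bound convergence in H^r turns into uniform convergence of derivatives.\<close>

lemma abs_inv_ft_deriv_le:
  assumes "g \<in> weighted_L2 r" "r > real j + 1/2"
  shows "\<bar>inv_ft_deriv j g x\<bar> \<le> embedding_const r j * weighted_norm r g"
proof -
  let ?G = "\<lambda>k. (\<i> * complex_of_real k) ^ j * g k * cis (k * x)"
  have "\<bar>inv_ft_deriv j g x\<bar> \<le> norm ((LBINT k. ?G k) / complex_of_real (sqrt (2 * pi)))"
    unfolding inv_ft_deriv_def inv_ft_def by (rule abs_Re_le_cmod)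
  also have "\<dots> \<le> norm (LBINT k. ?G k)"
    using pi_ge_two by (auto simp: norm_divide divide_le_eq mult_le_cancel_left1)
  also have "\<dots> \<le> (LBINT k. norm (?G k))"
    by (rule integral_norm_bound)
  also have "\<dots> = (LBINT k. \<bar>k\<bar> ^ j * norm (g k))"
    by (simp add: norm_mult norm_power)
  also have "\<dots> \<le> embedding_const r j * weighted_norm r g"
    by (rule weighted_L2_moment[OF assms])
  finally show ?thesis .
qed

lemma inv_ft_deriv_linear:
  assumes "g \<in> weighted_L2 r" "h \<in> weighted_L2 r" "r > real j + 1/2"
  shows "inv_ft_deriv j (\<lambda>k. complex_of_real a * g k + complex_of_real b * h k) x =
    a * inv_ft_deriv j g x + b * inv_ft_deriv j h x"
proof -
  have i: "integrable lborel (\<lambda>k. (\<i> * complex_of_real k) ^ j * f k * cis (k * x))"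
    if "f \<in> weighted_L2 r" for f
    by (rule Bochner_Integration.integrable_bound[OF integrable_moment_complex[OF that assms(3)]])
       (use that in \<open>auto simp: norm_mult weighted_L2_def\<close>)
  have "(LBINT k. (\<i> * complex_of_real k) ^ j * (complex_of_real a * g k + complex_of_real b * h k) * cis (k * x))
    = (LBINT k. complex_of_real a * ((\<i> * complex_of_real k) ^ j * g k * cis (k * x)) +
        complex_of_real b * ((\<i> * complex_of_real k) ^ j * h k * cis (k * x)))"
    by (intro Bochner_Integration.integral_cong refl) (simp add: algebra_simps)
  also have "\<dots> = complex_of_real a * (LBINT k. (\<i> * complex_of_real k) ^ j * g k * cis (k * x))
      + complex_of_real b * (LBINT k. (\<i> * complex_of_real k) ^ j * h k * cis (k * x))"
    using i[OF assms(1)] i[OF assms(2)] by simp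
  finally show ?thesis
    by (simp add: inv_ft_deriv_def inv_ft_def add_divide_distrib)
qed

lemma norm_cis_diff_le: "norm (cis a - cis b) \<le> \<bar>a - b\<bar>"
proof -
  have "cis a - cis b = cis b * (cis (a - b) - 1)"
    by (simp add: cis_mult algebra_simps)
  then have "norm (cis a - cis b) = norm (iexp (a - b) - (\<Sum>k\<le>0. (\<i> * (a - b)) ^ k / fact k))"
    by (simp add: norm_mult cis_conv_exp)
  also have "\<dots> \<le> \<bar>a - b\<bar> ^ Suc 0 / fact (Suc 0)"
    using iexp_approx1[of "a - b" 0] by simp
  finally show ?thesis by simp
qed

lemma has_vector_derivative_iff_quotient:
  fixes f :: "real \<Rightarrow> 'a::real_normed_vector"
  shows "(f has_vector_derivative D) (at x within S) \<longleftrightarrow>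
    ((\<lambda>y. (f y - f x) /\<^sub>R (y - x)) \<longlongrightarrow> D) (at x within S)"
proof -
  let ?r = "\<lambda>y. ((f y - f x) - (y - x) *\<^sub>R D) /\<^sub>R norm (y - x)"
  have "norm (?r y) = norm ((f y - f x) /\<^sub>R (y - x) - D)" if "y \<noteq> x" for y
  proof -
    have "(f y - f x) - (y - x) *\<^sub>R D = (y - x) *\<^sub>R ((f y - f x) /\<^sub>R (y - x) - D)"
      using that by (simp add: scaleR_diff_right)
    then show ?thesis using that by (simp only: norm_scaleR) simp
  qed
  then have "((\<lambda>y. norm (?r y)) \<longlongrightarrow> 0) (at x within S) \<longleftrightarrow>
     ((\<lambda>y. norm ((f y - f x) /\<^sub>R (y - x) - D)) \<longlongrightarrow> 0) (at x within S)"
    by (intro tendsto_cong) (auto simp: eventually_at_filter)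
  then have "(?r \<longlongrightarrow> 0) (at x within S) \<longleftrightarrow> ((\<lambda>y. (f y - f x) /\<^sub>R (y - x) - D) \<longlongrightarrow> 0) (at x within S)"
    by (simp only: tendsto_norm_zero_iff)
  then show ?thesis
    unfolding has_vector_derivative_def has_derivative_at_within
    by (simp add: bounded_linear_scaleR_left LIM_zero_iff)
qed

text \<open>Dominated convergence along arbitrary sequences: difference quotients of
  \<open>cis (k * x)\<close> in x are at most |k| in modulus, so |k g| is a majorant.\<close>

lemma has_vector_derivative_inv_ft:
  assumes [measurable]: "g \<in> borel_measurable lborel" and g: "integrable lborel g"
    and kg: "integrable lborel (\<lambda>k. \<i> * complex_of_real k * g k)"
  shows "(inv_ft g has_vector_derivative inv_ft (\<lambda>k. \<i> * complex_of_real k * g k) x) (at x)"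
proof -
  have gi: "integrable lborel (\<lambda>k. g k * cis (k * y))" for y
    by (rule Bochner_Integration.integrable_bound[OF g]) (auto simp: norm_mult)
  have "((\<lambda>y. (inv_ft g y - inv_ft g x) /\<^sub>R (y - x)) \<longlongrightarrow> inv_ft (\<lambda>k. \<i> * complex_of_real k * g k) x) (at x)"
    unfolding tendsto_at_iff_sequentially comp_def
  proof safe
    fix X :: "nat \<Rightarrow> real"
    assume X: "\<forall>i. X i \<in> UNIV - {x}" and lim: "X \<longlonglongrightarrow> x"
    let ?D = "\<lambda>i k. g k * ((cis (k * X i) - cis (k * x)) /\<^sub>R (X i - x))"
    have "(\<lambda>i. LBINT k. ?D i k) \<longlonglongrightarrow> (LBINT k. \<i> * complex_of_real k * g k * cis (k * x))"
    proof (rule integral_dominated_convergence)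
      show "integrable lborel (\<lambda>k. norm (\<i> * complex_of_real k * g k))" using kg by simp
      show "AE k in lborel. norm (?D i k) \<le> norm (\<i> * complex_of_real k * g k)" for i
      proof (rule AE_I2)
        fix k
        have "norm (cis (k * X i) - cis (k * x)) \<le> \<bar>k\<bar> * \<bar>X i - x\<bar>"
          using norm_cis_diff_le[of "k * X i" "k * x"]
          by (simp add: abs_mult[symmetric] right_diff_distrib)
        then have "norm ((cis (k * X i) - cis (k * x)) /\<^sub>R (X i - x)) \<le> \<bar>k\<bar>"
          using X by (simp only: norm_scaleR) (simp add: divide_simps mult.commute)
        then have "norm (g k) * norm ((cis (k * X i) - cis (k * x)) /\<^sub>R (X i - x)) \<le> norm (g k) * \<bar>k\<bar>"
          by (intro mult_left_mono) auto
        then show "norm (?D i k) \<le> norm (\<i> * complex_of_real k * g k)"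
          by (simp only: norm_mult) (simp add: mult.commute)
      qed
      show "AE k in lborel. (\<lambda>i. ?D i k) \<longlonglongrightarrow> \<i> * complex_of_real k * g k * cis (k * x)"
      proof (rule AE_I2)
        fix k
        have "((\<lambda>y. cis (k * y)) has_vector_derivative (k * 1) *\<^sub>R (\<i> * cis (k * x))) (at x)"
          unfolding has_vector_derivative_def
          by (rule has_derivative_eq_rhs[OF has_derivative_cis[OF has_derivative_mult_right[OF has_derivative_ident]]])
             (auto simp: mult_ac)
        then have "((\<lambda>y. (cis (k * y) - cis (k * x)) /\<^sub>R (y - x)) \<longlongrightarrow> k *\<^sub>R (\<i> * cis (k * x))) (at x)"
          by (simp only: has_vector_derivative_iff_quotient mult_1_right)
        then have "(\<lambda>i. (cis (k * X i) - cis (k * x)) /\<^sub>R (X i - x)) \<longlonglongrightarrow> k *\<^sub>R (\<i> * cis (k * x))"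
          using X lim unfolding tendsto_at_iff_sequentially comp_def by auto
        then have "(\<lambda>i. ?D i k) \<longlonglongrightarrow> g k * (k *\<^sub>R (\<i> * cis (k * x)))"
          by (intro tendsto_mult tendsto_const)
        then show "(\<lambda>i. ?D i k) \<longlonglongrightarrow> \<i> * complex_of_real k * g k * cis (k * x)"
          by (simp add: scaleR_conv_of_real mult_ac)
      qed
    qed measurable
    then have "(\<lambda>i. (LBINT k. ?D i k) / complex_of_real (sqrt (2 * pi))) \<longlonglongrightarrow> inv_ft (\<lambda>k. \<i> * complex_of_real k * g k) x"
      unfolding inv_ft_def by (intro tendsto_divide tendsto_const) auto
    moreover have "(LBINT k. ?D i k) / complex_of_real (sqrt (2 * pi)) = (inv_ft g (X i) - inv_ft g x) /\<^sub>R (X i - x)" for i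
    proof -
      have "(LBINT k. ?D i k) = (LBINT k. (g k * cis (k * X i) - g k * cis (k * x)) /\<^sub>R (X i - x))"
        by (intro Bochner_Integration.integral_cong refl) (simp add: right_diff_distrib)
      also have "\<dots> = (LBINT k. g k * cis (k * X i) - g k * cis (k * x)) /\<^sub>R (X i - x)"
        by (rule integral_scaleR_right)
      also have "\<dots> = ((LBINT k. g k * cis (k * X i)) - (LBINT k. g k * cis (k * x))) /\<^sub>R (X i - x)"
        using gi by simp
      finally have *: "(LBINT k. ?D i k) =
        ((LBINT k. g k * cis (k * X i)) - (LBINT k. g k * cis (k * x))) /\<^sub>R (X i - x)" .
      show ?thesis
        unfolding * inv_ft_def by (simp add: scaleR_conv_of_real diff_divide_distrib[symmetric])
    qed
    ultimately show "(\<lambda>i. (inv_ft g (X i) - inv_ft g x) /\<^sub>R (X i - x)) \<longlonglongrightarrow> inv_ft (\<lambda>k. \<i> * complex_of_real k * g k) x"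
      by simp
  qed
  then show ?thesis
    by (simp only: has_vector_derivative_iff_quotient)
qed


lemma inv_ft_deriv_has_derivative:
  assumes g: "g \<in> weighted_L2 r" and r: "r > real (Suc j) + 1/2"
  shows "(inv_ft_deriv j g has_real_derivative inv_ft_deriv (Suc j) g x) (at x)"
proof -
  note [measurable] = weighted_L2_measurable[OF g]
  let ?G = "\<lambda>k. (\<i> * complex_of_real k) ^ j * g k"
  have "(inv_ft ?G has_vector_derivative inv_ft (\<lambda>k. \<i> * complex_of_real k * ?G k) x) (at x)"
  proof (rule has_vector_derivative_inv_ft)
    show "integrable lborel ?G" using integrable_moment_complex[OF g, of j] r by simp
    show "integrable lborel (\<lambda>k. \<i> * complex_of_real k * ?G k)"
      using integrable_moment_complex[OF g r] by (simp add: mult.assoc)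
  qed measurable
  then have "((\<lambda>x. Re (inv_ft ?G x)) has_real_derivative Re (inv_ft (\<lambda>k. \<i> * complex_of_real k * ?G k) x)) (at x)"
    by (intro has_field_derivative_Re)
  then show ?thesis
    by (simp add: inv_ft_deriv_def[abs_def] mult.assoc)
qed

lemma isCont_inv_ft_deriv:
  assumes g: "g \<in> weighted_L2 r" and r: "r > real j + 1/2"
  shows "isCont (inv_ft_deriv j g) x"
proof -
  note [measurable] = weighted_L2_measurable[OF g]
  let ?G = "\<lambda>k. (\<i> * complex_of_real k) ^ j * g k"
  have G: "integrable lborel ?G" by (rule integrable_moment_complex[OF g r])
  have "isCont (inv_ft ?G) x"
    unfolding continuous_within tendsto_at_iff_sequentially comp_def inv_ft_def
  proof safe
    fix X :: "nat \<Rightarrow> real"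
    assume lim: "X \<longlonglongrightarrow> x"
    have "(\<lambda>i. LBINT k. ?G k * cis (k * X i)) \<longlonglongrightarrow> (LBINT k. ?G k * cis (k * x))"
    proof (rule integral_dominated_convergence)
      show "integrable lborel (\<lambda>k. norm (?G k))" using G by simp
      show "AE k in lborel. (\<lambda>i. ?G k * cis (k * X i)) \<longlonglongrightarrow> ?G k * cis (k * x)"
        by (intro AE_I2 tendsto_intros lim)
      show "AE k in lborel. norm (?G k * cis (k * X i)) \<le> norm (?G k)" for i
        by (intro AE_I2) (simp add: norm_mult)
    qed measurable
    then show "(\<lambda>i. (LBINT k. ?G k * cis (k * X i)) / complex_of_real (sqrt (2 * pi))) \<longlonglongrightarrow>
       (LBINT k. ?G k * cis (k * x)) / complex_of_real (sqrt (2 * pi))"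
      by (intro tendsto_divide tendsto_const) auto
  qed
  then show ?thesis
    unfolding inv_ft_deriv_def[abs_def] by (rule continuous_Re)
qed

section \<open>Sobolev functions and their dependence on time\<close>

definition fourier :: "(real \<Rightarrow> real) \<Rightarrow> real \<Rightarrow> complex" where
  "fourier f = (SOME g. L2_fourier f g)"

lemma L2_fourier_fourier: "L2_fourier f g \<Longrightarrow> L2_fourier f (fourier f)"
  unfolding fourier_def by (rule someI[of "L2_fourier f"])

text \<open>Membership in H^r is witnessed by some transform, while \<open>sobolev_norm\<close>
  refers to the chosen one; weighted integrability carries over by almost everywhere
  uniqueness.\<close>

lemma in_sobolev_fourier:
  assumes "in_sobolev r f"
  shows "L2_fourier f (fourier f)" "fourier f \<in> weighted_L2 r"
proof -
  obtain g where g: "L2_fourier f g" "integrable lborel (\<lambda>k. (1 + k\<^sup>2) powr r * (norm (g k))\<^sup>2)"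
    using assms unfolding in_sobolev_def by blast
  show f: "L2_fourier f (fourier f)" using g(1) by (rule L2_fourier_fourier)
  have [measurable]: "g \<in> borel_measurable lborel" "fourier f \<in> borel_measurable lborel"
    using f g by (auto simp: L2_fourier_def)
  have "AE k in lborel. (1 + k\<^sup>2) powr r * (norm (g k))\<^sup>2 = (1 + k\<^sup>2) powr r * (norm (fourier f k))\<^sup>2"
    using L2_fourier_unique[OF g(1) f] by eventually_elim simp
  then have "integrable lborel (\<lambda>k. (1 + k\<^sup>2) powr r * (norm (fourier f k))\<^sup>2)"
    using g(2) by (subst (asm) integrable_cong_AE) auto
  then show "fourier f \<in> weighted_L2 r" by (simp add: weighted_L2_def)
qed

text \<open>Frees the norm from the choice of transform, so that it can be computed from linear
  combinations.\<close>

lemma sobolev_norm_eq: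
  assumes g: "L2_fourier f g"
  shows "sobolev_norm r f = weighted_norm r g"
proof -
  have f: "L2_fourier f (fourier f)" using g by (rule L2_fourier_fourier)
  have [measurable]: "g \<in> borel_measurable lborel" "fourier f \<in> borel_measurable lborel"
    using f g by (auto simp: L2_fourier_def)
  have "AE k in lborel. (1 + k\<^sup>2) powr r * (norm (fourier f k))\<^sup>2 = (1 + k\<^sup>2) powr r * (norm (g k))\<^sup>2"
    using L2_fourier_unique[OF g f] by eventually_elim simp
  then show ?thesis
    unfolding sobolev_norm_def weighted_norm_def fourier_def[symmetric]
    by (subst integral_cong_AE) auto
qed

abbreviation fourier_deriv :: "nat \<Rightarrow> (real \<Rightarrow> real) \<Rightarrow> real \<Rightarrow> real" where
  "fourier_deriv j f \<equiv> inv_ft_deriv j (fourier f)"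

lemma in_sobolev_inversion:
  assumes f: "in_sobolev r f" "continuous_on UNIV f" and r: "r > 1/2"
  shows "f = fourier_deriv 0 f"
proof
  fix x
  have "integrable lborel (fourier f)"
    using integrable_moment_complex[OF in_sobolev_fourier(2)[OF f(1)], of 0] r by simp
  then show "f x = fourier_deriv 0 f x"
    using L2_fourier_inversion[OF in_sobolev_fourier(1)[OF f(1)] _ f(2)]
    by (simp add: inv_ft_deriv_def)
qed

lemma in_sobolev_C2:
  assumes f: "in_sobolev r f" "continuous_on UNIV f" and r: "r > 5/2"
  shows "(f has_real_derivative deriv f x) (at x)" "(deriv f has_real_derivative deriv (deriv f) x) (at x)"
    "deriv f = fourier_deriv 1 f" "deriv (deriv f) = fourier_deriv 2 f"
    "isCont (deriv (deriv f)) x"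
proof -
  note g = in_sobolev_fourier(2)[OF f(1)]
  have f0: "f = fourier_deriv 0 f"
    using f r by (intro in_sobolev_inversion) auto
  have d0: "(f has_real_derivative fourier_deriv 1 f x) (at x)" for x
    using inv_ft_deriv_has_derivative[OF g, of 0 x] r f0 by simp
  have d1: "(fourier_deriv 1 f has_real_derivative fourier_deriv 2 f x) (at x)" for x
    using inv_ft_deriv_has_derivative[OF g, of 1 x] r by (simp add: numeral_2_eq_2)
  show 1: "deriv f = fourier_deriv 1 f"
    using d0 by (auto intro: DERIV_imp_deriv)
  show 2: "deriv (deriv f) = fourier_deriv 2 f"
    unfolding 1 using d1 by (auto intro: DERIV_imp_deriv)
  show "(f has_real_derivative deriv f x) (at x)" unfolding 1 by (rule d0)
  show "(deriv f has_real_derivative deriv (deriv f) x) (at x)" by (simp only: 2) (simp only: 1 d1)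
  show "isCont (deriv (deriv f)) x" unfolding 2 using r by (intro isCont_inv_ft_deriv[OF g]) simp
qed

text \<open>Plancherel together with 1 \<le> 1 + k^2. The energy estimate involves only the L^2 norm
  of u_0, and this bound brings in the H^1 norm of the theorem.\<close>

lemma in_sobolev_L2_bound:
  assumes f: "in_sobolev r f" "continuous_on UNIV f" and r: "r \<ge> 1"
  shows "integrable lborel (\<lambda>x. (f x)\<^sup>2)" "(LBINT x. (f x)\<^sup>2) \<le> (sobolev_norm 1 f)\<^sup>2"
proof -
  note F = in_sobolev_fourier[OF f(1)]
  have [measurable]: "fourier f \<in> borel_measurable lborel" using F(1) by (simp add: L2_fourier_def)
  show "integrable lborel (\<lambda>x. (f x)\<^sup>2)" using F(1) by (simp add: L2_fourier_def)
  have i: "integrable lborel (fourier f)"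
    using integrable_moment_complex[OF F(2), of 0] r by simp
  have "(LBINT x. (f x)\<^sup>2) = (LBINT k. (norm (fourier f k))\<^sup>2)"
    by (rule L2_fourier_plancherel[OF F(1) i f(2)])
  also have "\<dots> \<le> (LBINT k. (1 + k\<^sup>2) powr 1 * (norm (fourier f k))\<^sup>2)"
  proof (rule integral_mono)
    show "integrable lborel (\<lambda>k. (norm (fourier f k))\<^sup>2)" using F(1) by (simp add: L2_fourier_def)
    show "integrable lborel (\<lambda>k. (1 + k\<^sup>2) powr 1 * (norm (fourier f k))\<^sup>2)"
      using weighted_L2_mono[OF F(2) r] by (simp add: weighted_L2_def)
    show "(norm (fourier f k))\<^sup>2 \<le> (1 + k\<^sup>2) powr 1 * (norm (fourier f k))\<^sup>2" for k
      by (simp add: powr_one add_nonneg_nonneg algebra_simps)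
  qed
  also have "\<dots> = (sobolev_norm 1 f)\<^sup>2"
    unfolding sobolev_norm_eq[OF F(1)] weighted_norm_def by (intro real_sqrt_pow2[symmetric]) simp
  finally show "(LBINT x. (f x)\<^sup>2) \<le> (sobolev_norm 1 f)\<^sup>2" .
qed

text \<open>By linearity the embedding bound applies to the difference of two time slices.\<close>

lemma sobolev_C0_uniform:
  assumes u: "sobolev_C0 r I u" and r: "r > real j + 1/2" and t: "t \<in> I" and e: "e > 0"
  shows "\<forall>\<^sub>F t' in at t within I. \<forall>x.
     \<bar>fourier_deriv j (u t') x - fourier_deriv j (u t) x\<bar> \<le> e"
proof -
  have I: "\<And>t'. t' \<in> I \<Longrightarrow> in_sobolev r (u t')"
    and lim: "((\<lambda>t'. sobolev_norm r (\<lambda>x. u t' x - u t x)) \<longlongrightarrow> 0) (at t within I)"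
    using u t by (auto simp: sobolev_C0_def)
  note F = in_sobolev_fourier[OF I]
  have "((\<lambda>t'. embedding_const r j * sobolev_norm r (\<lambda>x. u t' x - u t x)) \<longlongrightarrow> embedding_const r j * 0) (at t within I)"
    by (intro tendsto_mult tendsto_const lim)
  then have "\<forall>\<^sub>F t' in at t within I. embedding_const r j * sobolev_norm r (\<lambda>x. u t' x - u t x) < e"
    using e by (auto dest: order_tendstoD(2))
  moreover have "\<forall>\<^sub>F t' in at t within I. t' \<in> I" by (simp add: eventually_at_filter)
  ultimately show ?thesis
  proof eventually_elim
    case (elim t')
    let ?g = "\<lambda>k. complex_of_real 1 * fourier (u t') k + complex_of_real (-1) * fourier (u t) k"
    have "L2_fourier (\<lambda>x. u t' x - u t x) ?g"
      using L2_fourier_linear[OF F(1)[OF elim(2)] F(1)[OF t], of 1 "-1"] by simp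
    then have n: "sobolev_norm r (\<lambda>x. u t' x - u t x) = weighted_norm r ?g"
      by (rule sobolev_norm_eq)
    have W: "?g \<in> weighted_L2 r"
      by (intro weighted_L2_linear F elim t)
    have "\<bar>fourier_deriv j (u t') x - fourier_deriv j (u t) x\<bar> \<le> e" for x
      using abs_inv_ft_deriv_le[OF W r, of x] elim(1) n
        inv_ft_deriv_linear[OF F(2)[OF elim(2)] F(2)[OF t] r, of 1 "-1" x] by simp
    then show ?case by blast
  qed
qed

text \<open>The time derivative $v(t)$ need not be continuous in $x$. It enters only through its transform $w(t)$, whose
  inverse transform serves as the continuous representative.\<close>
lemma sobolev_C1_uniform:
  assumes u: "sobolev_C1 r I u"
  obtains w where "\<And>t. t \<in> I \<Longrightarrow> w t \<in> weighted_L2 r"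
    "\<And>t e j. \<lbrakk>t \<in> I; e > 0; r > real j + 1/2\<rbrakk> \<Longrightarrow> \<forall>\<^sub>F t' in at t within I. \<forall>x.
       \<bar>fourier_deriv j (u t') x - fourier_deriv j (u t) x
          - (t' - t) * inv_ft_deriv j (w t) x\<bar> \<le> e * \<bar>t' - t\<bar>"
proof -
  obtain v where v: "sobolev_C0 r I v"
      "\<forall>t\<in>I. ((\<lambda>t'. sobolev_norm r (\<lambda>x. (u t' x - u t x) / (t' - t) - v t x)) \<longlongrightarrow> 0) (at t within I)"
    using u unfolding sobolev_C1_def by blast
  have I: "\<And>t'. t' \<in> I \<Longrightarrow> in_sobolev r (u t')" "\<And>t'. t' \<in> I \<Longrightarrow> in_sobolev r (v t')"
    and lim: "\<And>t. t \<in> I \<Longrightarrow> ((\<lambda>t'. sobolev_norm r (\<lambda>x. (u t' x - u t x) / (t' - t) - v t x)) \<longlongrightarrow> 0) (at t within I)"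
    using u v by (auto simp: sobolev_C1_def sobolev_C0_def)
  note F = in_sobolev_fourier[OF I(1)] and G = in_sobolev_fourier[OF I(2)]
  show thesis
  proof (rule that[of "\<lambda>t. fourier (v t)"])
    show "fourier (v t) \<in> weighted_L2 r" if "t \<in> I" for t using G that by blast
    fix t e j assume t: "t \<in> I" and e: "(0::real) < e" and r: "r > real j + 1/2"
    have "((\<lambda>t'. embedding_const r j * sobolev_norm r (\<lambda>x. (u t' x - u t x) / (t' - t) - v t x))
        \<longlongrightarrow> embedding_const r j * 0) (at t within I)"
      by (intro tendsto_mult tendsto_const lim t)
    then have "\<forall>\<^sub>F t' in at t within I. embedding_const r j * sobolev_norm r (\<lambda>x. (u t' x - u t x) / (t' - t) - v t x) < e"
      using e by (auto dest: order_tendstoD(2))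
    moreover have "\<forall>\<^sub>F t' in at t within I. t' \<in> I \<and> t' \<noteq> t" by (simp add: eventually_at_filter)
    ultimately show "\<forall>\<^sub>F t' in at t within I. \<forall>x.
       \<bar>fourier_deriv j (u t') x - fourier_deriv j (u t) x
          - (t' - t) * fourier_deriv j (v t) x\<bar> \<le> e * \<bar>t' - t\<bar>"
    proof eventually_elim
      case (elim t')
      then have t': "t' \<in> I" "t' \<noteq> t" by auto
      let ?c = "1 / (t' - t)"
      \<comment> \<open>The difference quotient minus v(t) is built in two stages, \<open>?g\<close>
        for the quotient and \<open>?h\<close> for the whole, since linearity is stated for two
        terms.\<close>
      let ?f = "\<lambda>x. ?c * u t' x + (- ?c) * u t x"
      let ?g = "\<lambda>k. complex_of_real ?c * fourier (u t') k + complex_of_real (- ?c) * fourier (u t) k"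
      let ?h = "\<lambda>k. complex_of_real 1 * ?g k + complex_of_real (- 1) * fourier (v t) k"
      have "L2_fourier ?f ?g"
        by (rule L2_fourier_linear[OF F(1)[OF t'(1)] F(1)[OF t]])
      from L2_fourier_linear[OF this G(1)[OF t], of 1 "-1"]
      have "L2_fourier (\<lambda>x. (u t' x - u t x) / (t' - t) - v t x) ?h"
        by (simp add: diff_divide_distrib)
      then have n: "sobolev_norm r (\<lambda>x. (u t' x - u t x) / (t' - t) - v t x) = weighted_norm r ?h"
        by (rule sobolev_norm_eq)
      have Wg: "?g \<in> weighted_L2 r" by (intro weighted_L2_linear F t' t)
      then have W: "?h \<in> weighted_L2 r" by (rule weighted_L2_linear[OF _ G(2)[OF t]])
      show ?case
      proof
        fix x
        have alg: "d \<noteq> 0 \<Longrightarrow> (1 / d * U + - (1 / d) * V - W) * d = U - V - d * W" for d U V W :: real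
          by (simp add: field_simps)
        let ?U = "fourier_deriv j (u t') x" and ?V = "fourier_deriv j (u t) x"
          and ?W = "fourier_deriv j (v t) x"
        have "inv_ft_deriv j ?h x = ?c * ?U + (- ?c) * ?V - ?W"
          using inv_ft_deriv_linear[OF Wg G(2)[OF t] r, of 1 "-1" x]
            inv_ft_deriv_linear[OF F(2)[OF t'(1)] F(2)[OF t] r, of ?c "- ?c" x] by simp
        moreover have "\<bar>inv_ft_deriv j ?h x\<bar> \<le> e"
          using abs_inv_ft_deriv_le[OF W r, of x] elim(1) n by simp
        ultimately have "\<bar>?c * ?U + (- ?c) * ?V - ?W\<bar> * \<bar>t' - t\<bar> \<le> e * \<bar>t' - t\<bar>"
          by (intro mult_right_mono) auto
        also have "\<bar>?c * ?U + (- ?c) * ?V - ?W\<bar> * \<bar>t' - t\<bar> = \<bar>?U - ?V - (t' - t) * ?W\<bar>"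
          using alg[of "t' - t" ?U ?V ?W] t'(2) by (simp only: abs_mult[symmetric])
        finally show "\<bar>?U - ?V - (t' - t) * ?W\<bar> \<le> e * \<bar>t' - t\<bar>" .
      qed
    qed
  qed
qed

section \<open>Test functions\<close>

text \<open>A polynomial in y = 1/x times exp (-y). The class is closed under differentiation in x:
  the derivative is y^2 (p(y) - p'(y)) exp (-y).\<close>

definition flat :: "real poly \<Rightarrow> real \<Rightarrow> real" where
  "flat p x = (if x > 0 then poly p (1 / x) * exp (- (1 / x)) else 0)"

lemma tendsto_poly_mult_exp_neg: "((\<lambda>y. poly p y * exp (- y)) \<longlongrightarrow> (0::real)) at_top"
proof -
  have "((\<lambda>y. \<Sum>i\<le>degree p. coeff p i * (y ^ i / exp y)) \<longlongrightarrow> (\<Sum>i\<le>degree p. coeff p i * 0)) at_top"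
    by (intro tendsto_intros tendsto_power_div_exp_0)
  moreover have "(\<lambda>y. \<Sum>i\<le>degree p. coeff p i * (y ^ i / exp y)) = (\<lambda>y. poly p y * exp (- y))"
    by (simp add: poly_altdef sum_distrib_right exp_minus field_simps sum_divide_distrib)
  ultimately show ?thesis by simp
qed

lemma flat_has_derivative:
  "(flat p has_real_derivative flat (monom 1 2 * (p - pderiv p)) x) (at x)"
proof -
  consider "x > 0" | "x < 0" | "x = 0" by linarith
  then show ?thesis
  proof cases
    case 1
    have "((\<lambda>x. poly p (1 / x) * exp (- (1 / x))) has_real_derivative
        flat (monom 1 2 * (p - pderiv p)) x) (at x)"
      using 1
      by (auto intro!: derivative_eq_intros DERIV_chain2[OF poly_DERIV]
          simp: flat_def poly_monom power2_eq_square field_simps)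
    then show ?thesis
      by (rule has_field_derivative_transform_within_open[where S = "{0<..}"])
         (use 1 in \<open>auto simp: flat_def\<close>)
  next
    case 2
    have "((\<lambda>x. 0) has_real_derivative flat (monom 1 2 * (p - pderiv p)) x) (at x)"
      using 2 by (simp add: flat_def)
    then show ?thesis
      by (rule has_field_derivative_transform_within_open[where S = "{..<0}"])
         (use 2 in \<open>auto simp: flat_def\<close>)
  next
    case 3
    have lim: "((\<lambda>h. flat p h / h) \<longlongrightarrow> 0) (at 0)"
      unfolding filterlim_at_split
    proof
      have "((\<lambda>h. 0::real) \<longlongrightarrow> 0) (at_left (0::real))" by simp
      then show "((\<lambda>h. flat p h / h) \<longlongrightarrow> 0) (at_left 0)"
        by (rule Lim_transform_eventually) (auto simp: flat_def eventually_at_filter intro!: always_eventually)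
      have "((\<lambda>h. poly (monom 1 1 * p) (inverse h) * exp (- inverse h)) \<longlongrightarrow> (0::real)) (at_right 0)"
        by (rule filterlim_compose[OF tendsto_poly_mult_exp_neg filterlim_inverse_at_top_right])
      then show "((\<lambda>h. flat p h / h) \<longlongrightarrow> 0) (at_right 0)"
        by (rule Lim_transform_eventually)
           (auto simp: flat_def eventually_at_filter poly_monom inverse_eq_divide intro!: always_eventually)
    qed
    then show ?thesis
      using 3 by (simp add: has_field_derivative_iff flat_def)
  qed
qed

text \<open>A class closed under differentiation that contains the affine rescalings of
  \<open>flat\<close>. Iterated derivatives stay inside it, which settles smoothness without
  formulas for them.\<close>

inductive_set smooth_family :: "(real \<Rightarrow> real) set" where
  flat: "(\<lambda>x. flat p (a * x + b)) \<in> smooth_family"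
| const: "(\<lambda>x. c) \<in> smooth_family"
| add: "f \<in> smooth_family \<Longrightarrow> g \<in> smooth_family \<Longrightarrow> (\<lambda>x. f x + g x) \<in> smooth_family"
| mult: "f \<in> smooth_family \<Longrightarrow> g \<in> smooth_family \<Longrightarrow> (\<lambda>x. f x * g x) \<in> smooth_family"

lemma smooth_family_derivative:
  "f \<in> smooth_family \<Longrightarrow> \<exists>f'\<in>smooth_family. \<forall>x. (f has_real_derivative f' x) (at x)"
proof (induction rule: smooth_family.induct)
  case (flat p a b)
  let ?q = "monom 1 2 * (p - pderiv p)"
  have "((\<lambda>x. flat p (a * x + b)) has_real_derivative flat ?q (a * x + b) * a) (at x)" for x
    by (rule DERIV_chain2[OF flat_has_derivative]) (auto intro!: derivative_eq_intros)
  then show ?case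
    by (intro bexI[of _ "\<lambda>x. flat ?q (a * x + b) * a"] smooth_family.intros) auto
next
  case (const c)
  show ?case by (intro bexI[of _ "\<lambda>x. 0"] smooth_family.intros) auto
next
  case (add f g)
  then obtain f' g' where *: "f' \<in> smooth_family" "g' \<in> smooth_family"
    "\<And>x. (f has_real_derivative f' x) (at x)" "\<And>x. (g has_real_derivative g' x) (at x)" by blast
  then have "((\<lambda>x. f x + g x) has_real_derivative f' x + g' x) (at x)" for x
    by (intro DERIV_add)
  then show ?case using * by (intro bexI[of _ "\<lambda>x. f' x + g' x"] smooth_family.intros) auto
next
  case (mult f g)
  then obtain f' g' where *: "f' \<in> smooth_family" "g' \<in> smooth_family"
    "\<And>x. (f has_real_derivative f' x) (at x)" "\<And>x. (g has_real_derivative g' x) (at x)" by blast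
  then have "((\<lambda>x. f x * g x) has_real_derivative f' x * g x + g' x * f x) (at x)" for x
    by (intro DERIV_mult)
  then show ?case
    using * mult by (intro bexI[of _ "\<lambda>x. f' x * g x + g' x * f x"] smooth_family.intros) auto
qed

lemma smooth_family_differentiable:
  assumes "f \<in> smooth_family"
  shows "((deriv ^^ k) f) differentiable (at x)"
proof -
  have "(deriv ^^ k) f \<in> smooth_family"
  proof (induction k)
    case (Suc k)
    obtain f' where f': "f' \<in> smooth_family" "\<And>x. (((deriv ^^ k) f) has_real_derivative f' x) (at x)"
      using smooth_family_derivative[OF Suc] by blast
    then have "(deriv ^^ Suc k) f = f'" by (auto intro: DERIV_imp_deriv)
    with f' show ?case by simp
  qed (use assms in simp)
  then show ?thesis
    using smooth_family_derivative real_differentiable_def by blast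
qed

definition bump :: "real \<Rightarrow> real" where
  "bump x = flat 1 x * flat 1 (1 - x)"

lemma bump_nonneg: "0 \<le> bump x" and bump_outside: "x \<notin> {0<..<1} \<Longrightarrow> bump x = 0"
  by (auto simp: bump_def flat_def)

lemma bump_affine_smooth: "(\<lambda>x. bump ((x - a) / e)) \<in> smooth_family"
proof -
  have "(\<lambda>x. flat 1 (1 / e * x + (- a / e)) * flat 1 (- 1 / e * x + (1 + a / e))) \<in> smooth_family"
    by (intro smooth_family.intros)
  then show ?thesis by (simp add: bump_def diff_divide_distrib algebra_simps)
qed

lemma isCont_bump: "isCont bump x"
proof -
  have "(\<lambda>x. bump ((x - 0) / 1)) \<in> smooth_family" by (rule bump_affine_smooth)
  then show ?thesis using smooth_family_derivative DERIV_isCont by force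
qed

lemma integrable_mult_bump:
  assumes "continuous_on UNIV G"
  shows "integrable lborel (\<lambda>z. G z * bump z)"
proof -
  have "integrable lborel (\<lambda>z. indicator {0..1} z *\<^sub>R (G z * bump z))"
    using assms isCont_bump
    by (intro borel_integrable_compact continuous_intros)
       (auto intro: continuous_on_subset continuous_at_imp_continuous_on)
  moreover have "(\<lambda>z. indicator {0..1} z *\<^sub>R (G z * bump z)) = (\<lambda>z. G z * bump z)"
  proof
    fix z
    show "indicator {0..1} z *\<^sub>R (G z * bump z) = G z * bump z"
      by (cases "z \<in> {0<..<1}") (auto simp: bump_outside)
  qed
  ultimately show ?thesis by simp
qed

lemma integral_bump_pos: "0 < (LBINT z. bump z)"
proof -
  \<comment> \<open>On [1/4, 3/4], an interval of length 1/2, both 1 / z and 1 / (1 - z) are at most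
    4. Positivity is enough, since the mass of the bump cancels in the end.\<close>
  have "0 < exp (- 8) * (1 / 2 :: real)" by simp
  also have "\<dots> = (LBINT z. exp (- 8) * indicat_real {1/4..3/4::real} z)" by simp
  also have "\<dots> \<le> (LBINT z. bump z)"
  proof (rule integral_mono)
    show "integrable lborel (\<lambda>z. exp (- 8) * indicat_real {1/4..3/4::real} z)"
      by (intro integrable_mult_right integrable_real_indicator) (simp_all add: emeasure_bounded_finite[OF bounded_closed_interval, simplified] del: emeasure_lborel_Icc)
    show "integrable lborel bump" using integrable_mult_bump[of "\<lambda>_. 1"] by simp
    show "exp (- 8) * indicat_real {1/4..3/4::real} z \<le> bump z" for z
    proof (cases "z \<in> {1/4..3/4::real}")
      case True
      then have "1 / z \<le> 4" "1 / (1 - z) \<le> 4" by (auto simp: field_simps)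
      then have "exp (- 8) \<le> exp (- (1 / z) + - (1 / (1 - z)))"
        by (subst exp_le_cancel_iff) linarith
      also have "\<dots> = bump z" using True by (simp add: bump_def flat_def exp_add[symmetric])
      finally show ?thesis using True by simp
    qed (simp add: bump_nonneg)
  qed
  finally show ?thesis .
qed

text \<open>Two translates of one bump have equal mass, so the primitive of their difference has
  compact support and is a legitimate test function.\<close>

lemma test_function_bump_difference:
  assumes "a \<le> b" "e > 0"
  obtains \<phi> where "test_function \<phi>" "\<And>x. deriv \<phi> x = bump ((x - a) / e) - bump ((x - b) / e)"
proof -
  have "\<exists>R. \<forall>x. - \<infinity> < ereal x \<longrightarrow> ereal x < \<infinity> \<longrightarrow> (R has_vector_derivative bump x) (at x)"
    by (rule einterval_antiderivative) (use isCont_bump in auto)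
  then obtain R where R: "\<And>x. (R has_real_derivative bump x) (at x)"
    by (auto simp: has_real_derivative_iff_has_vector_derivative)
  have R0: "R x = R 0" if "x \<le> 0" for x
  proof (cases "x < 0")
    case True
    have "continuous_on {x..0} R"
      using R DERIV_isCont by (intro continuous_at_imp_continuous_on) blast
    then have "R 0 = R x"
      by (intro DERIV_isconst_end[OF True]) (use R bump_outside in \<open>metis greaterThanLessThan_iff less_asym\<close>)+
    then show ?thesis by simp
  qed (use that in simp)
  have R1: "R x = R 1" if "x \<ge> 1" for x
  proof (cases "1 < x")
    case True
    have "continuous_on {1..x} R"
      using R DERIV_isCont by (intro continuous_at_imp_continuous_on) blast
    then show ?thesis
      by (intro DERIV_isconst_end[OF True]) (use R bump_outside in \<open>metis greaterThanLessThan_iff less_asym\<close>)+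
  qed (use that in simp)
  \<comment> \<open>R is constant on the left of 0 and on the right of 1, so the two terms cancel
    outside [a, b + e]. The test function will be e times \<phi>, the factor e undoing the chain
    rule.\<close>
  define \<phi> where "\<phi> x = R ((x - a) / e) - R ((x - b) / e)" for x
  have d: "((\<lambda>x. e * \<phi> x) has_real_derivative bump ((x - a) / e) - bump ((x - b) / e)) (at x)" for x
  proof -
    have "((\<lambda>x. R ((x - c) / e)) has_real_derivative bump ((x - c) / e) * (1 / e)) (at x)" for c
      by (rule DERIV_chain2[OF R]) (use assms in \<open>auto intro!: derivative_eq_intros\<close>)
    from DERIV_cmult[OF DERIV_diff[OF this[of a] this[of b]], of e]
    have "((\<lambda>x. e * \<phi> x) has_real_derivative
        e * (bump ((x - a) / e) * (1 / e) - bump ((x - b) / e) * (1 / e))) (at x)"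
      by (simp only: \<phi>_def)
    then show ?thesis
      by (rule DERIV_cong) (use assms in \<open>simp add: field_simps\<close>)
  qed
  have deriv: "deriv (\<lambda>x. e * \<phi> x) = (\<lambda>x. bump ((x - a) / e) - bump ((x - b) / e))"
    using d by (auto intro: DERIV_imp_deriv)
  have smooth: "(\<lambda>x. bump ((x - a) / e) - bump ((x - b) / e)) \<in> smooth_family"
  proof -
    have "(\<lambda>x. bump ((x - a) / e) + (-1) * bump ((x - b) / e)) \<in> smooth_family"
      by (intro smooth_family.intros bump_affine_smooth)
    then show ?thesis by simp
  qed
  have "test_function (\<lambda>x. e * \<phi> x)"
    unfolding test_function_def
  proof (intro conjI allI)
    show "((deriv ^^ k) (\<lambda>x. e * \<phi> x)) differentiable (at x)" for k x
    proof (cases k)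
      case 0
      then show ?thesis using d real_differentiable_def by auto
    next
      case (Suc n)
      then have "(deriv ^^ k) (\<lambda>x. e * \<phi> x) = (deriv ^^ n) (deriv (\<lambda>x. e * \<phi> x))"
        by (simp only: funpow_Suc_right o_apply)
      then show ?thesis using smooth_family_differentiable[OF smooth] deriv by simp
    qed
    have "{x. e * \<phi> x \<noteq> 0} \<subseteq> {a..b + e}"
    proof -
      have "\<phi> x = 0" if "x < a" for x
        using R0[of "(x - a) / e"] R0[of "(x - b) / e"] that assms by (simp add: \<phi>_def field_simps)
      moreover have "\<phi> x = 0" if "x > b + e" for x
        using R1[of "(x - a) / e"] R1[of "(x - b) / e"] that assms by (simp add: \<phi>_def field_simps)
      ultimately show ?thesis by force
    qed
    then show "compact (closure {x. e * \<phi> x \<noteq> 0})"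
      using bounded_subset[OF bounded_closed_interval] compact_closure by blast
  qed
  then show thesis using that deriv by simp
qed

text \<open>Tested with primitives of bump differences, the hypothesis says that averages of G over
  equal bumps at a and at b coincide. As the bumps shrink, these averages tend to the same positive
  multiple of G a and of G b.\<close>

lemma du_Bois_Reymond:
  assumes G: "continuous_on UNIV G"
    and test: "\<And>\<phi>. test_function \<phi> \<Longrightarrow> (LBINT x. G x * deriv \<phi> x) = 0"
  shows "G a = G b"
proof (induction a b rule: linorder_wlog)
  case (le a b)
  let ?J = "\<lambda>c n. LBINT z. G (c + z / real (Suc n)) * bump z"
  have Gc: "continuous_on UNIV (\<lambda>z. G (c + z / real (Suc n)))" for c n
    by (rule continuous_on_compose2[OF G]) (auto intro!: continuous_intros)
  have lim: "?J c \<longlonglongrightarrow> G c * (LBINT z. bump z)" for c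
  proof -
    have "compact (G ` {c..c + 1})"
      using G by (intro compact_continuous_image) (auto intro: continuous_on_subset)
    then obtain B where B: "\<And>y. y \<in> {c..c + 1} \<Longrightarrow> \<bar>G y\<bar> \<le> B"
      by (metis bounded_iff compact_imp_bounded imageI real_norm_def)
    have "?J c \<longlonglongrightarrow> (LBINT z. G c * bump z)"
    proof (rule integral_dominated_convergence)
      show "integrable lborel (\<lambda>z. B * bump z)" using integrable_mult_bump[of "\<lambda>_. B"] by simp
      show "AE z in lborel. norm (G (c + z / real (Suc n)) * bump z) \<le> B * bump z" for n
      proof (rule AE_I2)
        fix z
        show "norm (G (c + z / real (Suc n)) * bump z) \<le> B * bump z"
        proof (cases "z \<in> {0<..<1}")
          case True
          then have "c + z / real (Suc n) \<in> {c..c + 1}" by (simp add: field_simps)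
          then show ?thesis using B bump_nonneg[of z] by (simp add: abs_mult mult_right_mono)
        qed (simp add: bump_outside)
      qed
      show "AE z in lborel. (\<lambda>n. G (c + z / real (Suc n)) * bump z) \<longlonglongrightarrow> G c * bump z"
      proof (rule AE_I2)
        fix z
        have "isCont G c" using G continuous_on_eq_continuous_at[of UNIV] by auto
        from isCont_tendsto_compose[OF this add_divide_Suc_tendsto]
        show "(\<lambda>n. G (c + z / real (Suc n)) * bump z) \<longlonglongrightarrow> G c * bump z"
          by (intro tendsto_mult tendsto_const)
      qed
      show "(\<lambda>z. G c * bump z) \<in> borel_measurable lborel"
        using borel_measurable_integrable[OF integrable_mult_bump[of "\<lambda>_. G c"]] by simp
      show "(\<lambda>z. G (c + z / real (Suc n)) * bump z) \<in> borel_measurable lborel" for n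
        by (rule borel_measurable_integrable[OF integrable_mult_bump[OF Gc]])
    qed
    then show ?thesis by simp
  qed
  have "?J a n = ?J b n" for n
  proof -
    define e where "e = 1 / real (Suc n)"
    have e: "e > 0" by (simp add: e_def)
    have int: "integrable lborel (\<lambda>y. G y * bump ((y - c) / e))" for c
      using lborel_integrable_real_affine_iff[of e "\<lambda>y. G y * bump ((y - c) / e)" c]
        integrable_mult_bump[OF Gc[of c n]] e by (simp add: e_def)
    have val: "(LBINT y. G y * bump ((y - c) / e)) = e * ?J c n" for c
      using lborel_integral_real_affine[of e "\<lambda>y. G y * bump ((y - c) / e)" c] e
      by (simp add: e_def)
    obtain \<phi> where \<phi>: "test_function \<phi>" "\<And>x. deriv \<phi> x = bump ((x - a) / e) - bump ((x - b) / e)"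
      using test_function_bump_difference[OF le e] by blast
    have "0 = (LBINT x. G x * bump ((x - a) / e) - G x * bump ((x - b) / e))"
      using test[OF \<phi>(1)] by (simp add: \<phi>(2) right_diff_distrib)
    also have "\<dots> = e * ?J a n - e * ?J b n"
      unfolding val[symmetric] by (intro Bochner_Integration.integral_diff int)
    finally show ?thesis using e by simp
  qed
  then have "G a * (LBINT z. bump z) = G b * (LBINT z. bump z)"
    using LIMSEQ_unique[OF lim[of a]] lim[of b] by (simp only:)
  then show ?case using integral_bump_pos by simp
qed simp

section \<open>Differentiation uniformly in space\<close>

lemma test_function_support:
  assumes "test_function \<phi>"
  obtains R where "R > 0" "\<And>x. R \<le> \<bar>x\<bar> \<Longrightarrow> \<phi> x = 0"
proof -
  have "bounded {x. \<phi> x \<noteq> 0}"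
    using assms compact_imp_bounded bounded_closure_image bounded_subset closure_subset
    unfolding test_function_def by metis
  then obtain B where B: "\<And>x. \<phi> x \<noteq> 0 \<Longrightarrow> \<bar>x\<bar> \<le> B"
    unfolding bounded_iff by auto
  show thesis
    by (rule that[of "\<bar>B\<bar> + 1"]) (use B in force)+
qed

lemma test_function_derivative:
  assumes "test_function \<phi>"
  shows "(\<phi> has_real_derivative deriv \<phi> x) (at x)" "isCont (deriv \<phi>) x"
proof -
  have "((deriv ^^ 0) \<phi>) differentiable (at x)" "((deriv ^^ 1) \<phi>) differentiable (at x)"
    using assms unfolding test_function_def by blast+
  then show "(\<phi> has_real_derivative deriv \<phi> x) (at x)" "isCont (deriv \<phi>) x"
    using DERIV_deriv_iff_real_differentiable differentiable_imp_continuous_within by auto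
qed

lemma test_function_deriv_support:
  assumes "\<And>x. R \<le> \<bar>x\<bar> \<Longrightarrow> \<phi> x = (0::real)" "R < \<bar>x\<bar>"
  shows "deriv \<phi> x = 0"
proof -
  have "((\<lambda>x. 0) has_real_derivative 0) (at x)" by simp
  then have "(\<phi> has_real_derivative 0) (at x)"
    by (rule has_field_derivative_transform_within_open[where S = "{x. R < \<bar>x\<bar>}"])
       (use assms in \<open>auto intro!: open_Collect_less continuous_intros\<close>)
  then show ?thesis by (rule DERIV_imp_deriv)
qed

lemma integrable_mult_compact_support:
  fixes f \<psi> :: "real \<Rightarrow> real"
  assumes "continuous_on UNIV f" "continuous_on UNIV \<psi>" "\<And>x. R < \<bar>x\<bar> \<Longrightarrow> \<psi> x = 0"
  shows "integrable lborel (\<lambda>x. f x * \<psi> x)"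
proof -
  have "integrable lborel (\<lambda>x. indicator {- R..R} x *\<^sub>R (f x * \<psi> x))"
    using assms by (intro borel_integrable_compact continuous_intros) (auto intro: continuous_on_subset)
  moreover have "(\<lambda>x. indicator {- R..R} x *\<^sub>R (f x * \<psi> x)) = (\<lambda>x. f x * \<psi> x)"
  proof
    fix x
    show "indicator {- R..R} x *\<^sub>R (f x * \<psi> x) = f x * \<psi> x"
      using assms(3)[of x] by (cases "\<bar>x\<bar> \<le> R") (auto simp: indicator_def)
  qed
  ultimately show ?thesis by simp
qed

lemma test_function_integrable:
  fixes f :: "real \<Rightarrow> real"
  assumes \<phi>: "test_function \<phi>" and f: "continuous_on UNIV f"
  shows "integrable lborel (\<lambda>x. f x * \<phi> x)" "integrable lborel (\<lambda>x. f x * deriv \<phi> x)"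
proof -
  obtain R where R: "\<And>x. R \<le> \<bar>x\<bar> \<Longrightarrow> \<phi> x = 0" using test_function_support[OF \<phi>] by blast
  have c: "continuous_on UNIV \<phi>" "continuous_on UNIV (deriv \<phi>)"
    using test_function_derivative[OF \<phi>] DERIV_isCont by (blast intro: continuous_at_imp_continuous_on)+
  show "integrable lborel (\<lambda>x. f x * \<phi> x)"
    by (rule integrable_mult_compact_support[OF f c(1), of R]) (use R in auto)
  show "integrable lborel (\<lambda>x. f x * deriv \<phi> x)"
    by (rule integrable_mult_compact_support[OF f c(2)]) (rule test_function_deriv_support[OF R])
qed

lemma test_function_by_parts:
  assumes \<phi>: "test_function \<phi>" and f: "\<And>x. (f has_real_derivative f' x) (at x)"
    and f': "continuous_on UNIV f'"
  shows "(LBINT x. f' x * \<phi> x) = - (LBINT x. f x * deriv \<phi> x)"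
proof -
  obtain R where R: "R > 0" "\<And>x. R \<le> \<bar>x\<bar> \<Longrightarrow> \<phi> x = 0" using test_function_support[OF \<phi>] by blast
  have cf: "continuous_on UNIV f" using f DERIV_isCont by (blast intro: continuous_at_imp_continuous_on)
  let ?h = "\<lambda>x. f' x * \<phi> x + f x * deriv \<phi> x"
  have ch: "isCont ?h x" for x
    using f' cf test_function_derivative[OF \<phi>, of x] DERIV_isCont
    by (intro continuous_intros) (auto simp: continuous_on_eq_continuous_at)
  have d0: "deriv \<phi> x = 0" if "R < \<bar>x\<bar>" for x
    using R(2) that by (rule test_function_deriv_support)
  have "(LBINT x. ?h x) = (LBINT x. ?h x * indicator {- R..R} x)"
  proof (intro Bochner_Integration.integral_cong refl)
    fix x
    show "?h x = ?h x * indicator {- R..R} x"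
      using R(2)[of x] d0[of x] by (cases "\<bar>x\<bar> \<le> R") (auto simp: indicator_def)
  qed
  also have "\<dots> = f R * \<phi> R - f (- R) * \<phi> (- R)"
  proof (rule integral_FTC_Icc_real)
    show "((\<lambda>x. f x * \<phi> x) has_real_derivative ?h x) (at x)" for x
      using DERIV_mult[OF f[of x] test_function_derivative(1)[OF \<phi>, of x]] by (simp add: mult.commute)
  qed (use R ch in auto)
  also have "\<dots> = 0" using R by simp
  finally show ?thesis
    using test_function_integrable[OF \<phi> f'] test_function_integrable[OF \<phi> cf] by simp
qed

text \<open>The functions $e^x (w - w')$ and $e^{-x} (w + w')$ are monotone with derivatives $\pm e^{\pm x} (w - w'')$,
  and they vanish at $-\infty$ and $+\infty$.\<close>
lemma abs_deriv_le_of_supersolution: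
  fixes w w' w'' :: "real \<Rightarrow> real"
  assumes w: "\<And>x. (w has_real_derivative w' x) (at x)" "\<And>x. (w' has_real_derivative w'' x) (at x)"
    and pos: "\<And>x. 0 \<le> w x - w'' x" and bd: "\<And>x. \<bar>w x\<bar> \<le> B" "\<And>x. \<bar>w' x\<bar> \<le> B"
  shows "\<bar>w' x\<bar> \<le> w x"
proof -
  have up: "0 \<le> a x - a' x"
    if a: "\<And>x. (a has_real_derivative a' x) (at x)" "\<And>x. (a' has_real_derivative a'' x) (at x)"
    and p: "\<And>x. 0 \<le> a x - a'' x" and b: "\<And>x. \<bar>a x\<bar> \<le> B" "\<And>x. \<bar>a' x\<bar> \<le> B" for a a' a'' :: "real \<Rightarrow> real" and x
  proof (rule ccontr)
    assume neg: "\<not> 0 \<le> a x - a' x"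
    let ?h = "\<lambda>y. exp y * (a y - a' y)"
    have d: "(?h has_real_derivative exp y * (a y - a'' y)) (at y)" for y
      by (auto intro!: derivative_eq_intros a simp: algebra_simps)
    have mono: "?h y \<le> ?h x" if "y \<le> x" for y
      by (rule DERIV_nonneg_imp_nondecreasing[OF that]) (use d p in \<open>auto intro!: exI mult_nonneg_nonneg\<close>)
    have "((\<lambda>y. - (2 * B) * exp y) \<longlongrightarrow> - (2 * B) * 0) at_bot"
      by (intro tendsto_mult tendsto_const exp_at_bot)
    then have "((\<lambda>y. - (2 * B) * exp y) \<longlongrightarrow> 0) at_bot" by simp
    then have "0 \<le> ?h x"
    proof (rule tendsto_upperbound)
      show "\<forall>\<^sub>F y in at_bot. - (2 * B) * exp y \<le> ?h x"
        using eventually_le_at_bot[of x]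
      proof eventually_elim
        case (elim y)
        have "- (2 * B) * exp y \<le> exp y * (a y - a' y)"
          using b[of y] mult_left_mono[of "- (2 * B)" "a y - a' y" "exp y"] by (simp add: mult.commute)
        with mono[OF elim] show ?case by linarith
      qed
    qed simp_all
    with neg show False by (simp add: zero_le_mult_iff)
  qed
  have 1: "0 \<le> w x - w' x" by (rule up[OF w pos bd])
  have "0 \<le> w (- y) - - w' (- y)" for y
  proof (rule up[where a = "\<lambda>y. w (- y)" and a' = "\<lambda>y. - w' (- y)" and a'' = "\<lambda>y. w'' (- y)"])
    show "((\<lambda>y. w (- y)) has_real_derivative - w' (- y)) (at y)" for y
      using DERIV_chain2[OF w(1) DERIV_minus[OF DERIV_ident], of y] by simp
    show "((\<lambda>y. - w' (- y)) has_real_derivative w'' (- y)) (at y)" for y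
      using DERIV_minus[OF DERIV_chain2[OF w(2) DERIV_minus[OF DERIV_ident]], of y] by simp
  qed (use pos bd in auto)
  from this[of "- x"] 1 show ?thesis by simp
qed

section \<open>Time derivatives uniform in space\<close>

definition unif_deriv ::
    "real set \<Rightarrow> real set \<Rightarrow> real \<Rightarrow> (real \<Rightarrow> real \<Rightarrow> real) \<Rightarrow> (real \<Rightarrow> real) \<Rightarrow> bool" where
  "unif_deriv I X t f g \<longleftrightarrow> (\<forall>e>0. \<forall>\<^sub>F t' in at t within I. \<forall>x\<in>X.
     \<bar>f t' x - f t x - (t' - t) * g x\<bar> \<le> e * \<bar>t' - t\<bar>)"

lemma unif_deriv_mono: "unif_deriv I X t f g \<Longrightarrow> Y \<subseteq> X \<Longrightarrow> unif_deriv I Y t f g"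
  unfolding unif_deriv_def by (fast elim: eventually_mono)

lemma unif_deriv_quotient:
  assumes unif: "unif_deriv I X t f g" and X: "\<And>t'. t' \<in> I \<Longrightarrow> q t' \<in> X"
  shows "((\<lambda>t'. (f t' (q t') - f t (q t') - (t' - t) * g (q t')) / (t' - t)) \<longlongrightarrow> 0) (at t within I)"
proof (rule tendstoI)
  fix e :: real assume e: "0 < e"
  have I: "\<forall>\<^sub>F t' in at t within I. t' \<in> I \<and> t' \<noteq> t" by (simp add: eventually_at_filter)
  have "\<forall>\<^sub>F t' in at t within I. \<forall>x\<in>X. \<bar>f t' x - f t x - (t' - t) * g x\<bar> \<le> e / 2 * \<bar>t' - t\<bar>"
    using unif half_gt_zero[OF e] unfolding unif_deriv_def by blast
  then show "\<forall>\<^sub>F t' in at t within I. dist ((f t' (q t') - f t (q t') - (t' - t) * g (q t')) / (t' - t)) 0 < e"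
    using I
  proof eventually_elim
    case (elim t')
    then have "\<bar>f t' (q t') - f t (q t') - (t' - t) * g (q t')\<bar> \<le> e / 2 * \<bar>t' - t\<bar>"
      using X by blast
    also have "\<dots> < e * \<bar>t' - t\<bar>" using elim(2) e by simp
    finally show ?case using elim by (simp add: pos_divide_less_eq)
  qed
qed

text \<open>The increment splits into a time increment at the moving point q(t') and a space
  increment at the fixed time t. Uniformity in x controls the first one, so the chain rule holds
  without joint differentiability being known.\<close>

lemma material_derivative:
  fixes f :: "real \<Rightarrow> real \<Rightarrow> real" and q g :: "real \<Rightarrow> real"
  assumes unif: "unif_deriv I X t f g"
    and q: "(q has_real_derivative q') (at t within I)" and X: "\<And>t'. t' \<in> I \<Longrightarrow> q t' \<in> X"
    and g: "isCont g (q t)" and f: "(f t has_real_derivative f') (at (q t))"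
  shows "((\<lambda>t'. f t' (q t')) has_real_derivative g (q t) + f' * q') (at t within I)"
proof -
  have I: "\<forall>\<^sub>F t' in at t within I. t' \<in> I \<and> t' \<noteq> t" by (simp add: eventually_at_filter)
  note 1 = unif_deriv_quotient[where q = q, OF unif X]
  have qc: "(q \<longlongrightarrow> q t) (at t within I)"
    using DERIV_continuous[OF q] by (simp add: continuous_within)
  have 2: "((\<lambda>t'. g (q t')) \<longlongrightarrow> g (q t)) (at t within I)"
    by (rule isCont_tendsto_compose[OF g qc])
  have 3: "((\<lambda>t'. (f t (q t') - f t (q t)) / (t' - t)) \<longlongrightarrow> f' * q') (at t within I)"
    using DERIV_chain2[OF f q] by (simp add: has_field_derivative_iff)
  have alg: "d \<noteq> 0 \<Longrightarrow> (A - B - d * G) / d + G + (B - C) / d = (A - C) / d" for d A B C G :: real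
    by (simp add: field_simps)
  have "((\<lambda>t'. (f t' (q t') - f t (q t') - (t' - t) * g (q t')) / (t' - t) + g (q t')
      + (f t (q t') - f t (q t)) / (t' - t)) \<longlongrightarrow> 0 + g (q t) + f' * q') (at t within I)"
    by (intro tendsto_add 1 2 3) auto
  then have "((\<lambda>t'. (f t' (q t') - f t (q t)) / (t' - t)) \<longlongrightarrow> 0 + g (q t) + f' * q') (at t within I)"
    by (rule Lim_transform_eventually)
       (use I in eventually_elim, use alg in simp)
  then show ?thesis by (simp add: has_field_derivative_iff)
qed

lemma unif_deriv_pointwise:
  assumes unif: "unif_deriv I X t f g" and x: "x \<in> X"
  shows "((\<lambda>t'. f t' x) has_real_derivative g x) (at t within I)"
proof -
  have I: "\<forall>\<^sub>F t' in at t within I. t' \<noteq> t" by (simp add: eventually_at_filter)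
  have "((\<lambda>t'. (f t' x - f t x - (t' - t) * g x) / (t' - t) + g x) \<longlongrightarrow> 0 + g x) (at t within I)"
    by (intro tendsto_add tendsto_const unif_deriv_quotient[OF unif]) (use x in auto)
  moreover have alg: "d \<noteq> 0 \<Longrightarrow> (A - B - d * G) / d + G = (A - B) / d" for d A B G :: real
    by (simp add: field_simps)
  ultimately have "((\<lambda>t'. (f t' x - f t x) / (t' - t)) \<longlongrightarrow> 0 + g x) (at t within I)"
    by (elim Lim_transform_eventually)
       (use I in eventually_elim, use alg in simp)
  then show ?thesis by (simp add: has_field_derivative_iff)
qed

text \<open>Constants accumulate in sums, squares and integrals; they are absorbed by passing from e
  to e / (|C| + 1), which is positive for every real C.\<close>

lemma unif_derivI:
  assumes "\<And>e. e > 0 \<Longrightarrow> \<forall>\<^sub>F t' in at t within I. \<forall>x\<in>X. \<bar>f t' x - f t x - (t' - t) * g x\<bar> \<le> C * (e * \<bar>t' - t\<bar>)"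
  shows "unif_deriv I X t f g"
  unfolding unif_deriv_def
proof (intro allI impI)
  fix e :: real assume e: "0 < e"
  then have e': "0 < e / (\<bar>C\<bar> + 1)" by simp
  show "\<forall>\<^sub>F t' in at t within I. \<forall>x\<in>X. \<bar>f t' x - f t x - (t' - t) * g x\<bar> \<le> e * \<bar>t' - t\<bar>"
    using assms[OF e']
  proof eventually_elim
    case (elim t')
    have "C * (e / (\<bar>C\<bar> + 1) * \<bar>t' - t\<bar>) \<le> (\<bar>C\<bar> + 1) * (e / (\<bar>C\<bar> + 1) * \<bar>t' - t\<bar>)"
      using e by (intro mult_right_mono) auto
    also have "\<dots> = e * \<bar>t' - t\<bar>" by (simp add: field_simps)
    finally show ?case using elim by force
  qed
qed

lemma unif_deriv_add_scaled:
  assumes "unif_deriv I X t f g" "unif_deriv I X t f' g'"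
  shows "unif_deriv I X t (\<lambda>t' x. f t' x + c * f' t' x) (\<lambda>x. g x + c * g' x)"
proof (rule unif_derivI[where C = "1 + \<bar>c\<bar>"])
  fix e :: real assume e: "0 < e"
  have "\<forall>\<^sub>F t' in at t within I. \<forall>x\<in>X. \<bar>f t' x - f t x - (t' - t) * g x\<bar> \<le> e * \<bar>t' - t\<bar>"
    "\<forall>\<^sub>F t' in at t within I. \<forall>x\<in>X. \<bar>f' t' x - f' t x - (t' - t) * g' x\<bar> \<le> e * \<bar>t' - t\<bar>"
    using assms e unfolding unif_deriv_def by blast+
  then show "\<forall>\<^sub>F t' in at t within I. \<forall>x\<in>X. \<bar>f t' x + c * f' t' x - (f t x + c * f' t x) - (t' - t) * (g x + c * g' x)\<bar>
     \<le> (1 + \<bar>c\<bar>) * (e * \<bar>t' - t\<bar>)"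
  proof eventually_elim
    case (elim t')
    show ?case
    proof
      fix x assume "x \<in> X"
      then have 1: "\<bar>f t' x - f t x - (t' - t) * g x\<bar> \<le> e * \<bar>t' - t\<bar>"
        and "\<bar>f' t' x - f' t x - (t' - t) * g' x\<bar> \<le> e * \<bar>t' - t\<bar>"
        using elim by auto
      then have 2: "\<bar>c * (f' t' x - f' t x - (t' - t) * g' x)\<bar> \<le> \<bar>c\<bar> * (e * \<bar>t' - t\<bar>)"
        by (simp add: abs_mult mult_left_mono)
      have "f t' x + c * f' t' x - (f t x + c * f' t x) - (t' - t) * (g x + c * g' x) =
        (f t' x - f t x - (t' - t) * g x) + c * (f' t' x - f' t x - (t' - t) * g' x)"
        by (simp add: algebra_simps)
      moreover have "(1 + \<bar>c\<bar>) * (e * \<bar>t' - t\<bar>) = e * \<bar>t' - t\<bar> + \<bar>c\<bar> * (e * \<bar>t' - t\<bar>)"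
        by (simp add: distrib_right)
      ultimately show "\<bar>f t' x + c * f' t' x - (f t x + c * f' t x) - (t' - t) * (g x + c * g' x)\<bar>
          \<le> (1 + \<bar>c\<bar>) * (e * \<bar>t' - t\<bar>)"
        using 1 2 by linarith
    qed
  qed
qed

lemma unif_deriv_add:
  "unif_deriv I X t f g \<Longrightarrow> unif_deriv I X t f' g' \<Longrightarrow> unif_deriv I X t (\<lambda>t' x. f t' x + f' t' x) (\<lambda>x. g x + g' x)"
  using unif_deriv_add_scaled[of I X t f g f' g' 1] by simp

lemma unif_deriv_diff:
  "unif_deriv I X t f g \<Longrightarrow> unif_deriv I X t f' g' \<Longrightarrow> unif_deriv I X t (\<lambda>t' x. f t' x - f' t' x) (\<lambda>x. g x - g' x)"
  using unif_deriv_add_scaled[of I X t f g f' g' "-1"] by simp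

lemma unif_deriv_square:
  assumes f: "unif_deriv I X t f g" and bd: "\<And>x. x \<in> X \<Longrightarrow> \<bar>f t x\<bar> \<le> B" "\<And>x. x \<in> X \<Longrightarrow> \<bar>g x\<bar> \<le> B"
  shows "unif_deriv I X t (\<lambda>t' x. (f t' x)\<^sup>2) (\<lambda>x. 2 * f t x * g x)"
proof (rule unif_derivI[where C = "2 * B + 1"])
  fix e :: real assume e: "0 < e"
  have "\<forall>\<^sub>F t' in at t within I. \<forall>x\<in>X. \<bar>f t' x - f t x - (t' - t) * g x\<bar> \<le> e * \<bar>t' - t\<bar>"
    using f e unfolding unif_deriv_def by blast
  \<comment> \<open>The increment D of f is at most (B + e + 1) |t' - t|, so this radius makes D^2
    at most e |t' - t|.\<close>
  moreover have "\<forall>\<^sub>F t' in at t within I. \<bar>t' - t\<bar> < e / (\<bar>B\<bar> + e + 1)\<^sup>2"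
    using e by (auto simp: eventually_at dist_real_def intro!: exI[of _ "e / (\<bar>B\<bar> + e + 1)\<^sup>2"])
  ultimately show "\<forall>\<^sub>F t' in at t within I. \<forall>x\<in>X. \<bar>(f t' x)\<^sup>2 - (f t x)\<^sup>2 - (t' - t) * (2 * f t x * g x)\<bar>
     \<le> (2 * B + 1) * (e * \<bar>t' - t\<bar>)"
  proof eventually_elim
    case (elim t')
    show ?case
    proof
      fix x assume x: "x \<in> X"
      let ?D = "f t' x - f t x" and ?d = "\<bar>t' - t\<bar>"
      have 1: "\<bar>?D - (t' - t) * g x\<bar> \<le> e * ?d" using elim(1) x by blast
      have 2: "\<bar>(t' - t) * g x\<bar> \<le> B * ?d"
        using bd(2)[OF x] by (simp add: abs_mult mult.commute[of "\<bar>t' - t\<bar>"] mult_right_mono)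
      have "0 \<le> B" using bd(1)[OF x] by simp
      have "\<bar>?D\<bar> \<le> (B + e + 1) * ?d"
        using 1 2 by (simp add: distrib_right)
      then have "?D\<^sup>2 \<le> ((B + e + 1) * ?d)\<^sup>2"
        using abs_le_square_iff[of ?D "(B + e + 1) * ?d"] \<open>0 \<le> B\<close> e by (simp add: abs_mult)
      also have "\<dots> = (B + e + 1)\<^sup>2 * ?d * ?d" by (simp add: power2_eq_square)
      also have "\<dots> \<le> e * ?d"
      proof (rule mult_right_mono)
        show "(B + e + 1)\<^sup>2 * ?d \<le> e"
          using elim(2) \<open>0 \<le> B\<close> e by (simp add: pos_less_divide_eq mult.commute)
      qed simp
      finally have 3: "?D\<^sup>2 \<le> e * ?d" .
      have 4: "\<bar>2 * f t x * (?D - (t' - t) * g x)\<bar> \<le> 2 * B * (e * ?d)"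
        unfolding abs_mult using bd(1)[OF x] 1 \<open>0 \<le> B\<close> by (intro mult_mono) auto
      have "(f t' x)\<^sup>2 - (f t x)\<^sup>2 - (t' - t) * (2 * f t x * g x) = ?D\<^sup>2 + 2 * f t x * (?D - (t' - t) * g x)"
        by (simp add: power2_eq_square algebra_simps)
      moreover have "(2 * B + 1) * (e * ?d) = 2 * B * (e * ?d) + e * ?d"
        by (simp add: distrib_right)
      ultimately show "\<bar>(f t' x)\<^sup>2 - (f t x)\<^sup>2 - (t' - t) * (2 * f t x * g x)\<bar> \<le> (2 * B + 1) * (e * ?d)"
        using 3 4 zero_le_power2[of ?D] by linarith
    qed
  qed
qed

text \<open>The error is uniform in the upper limit too, which may therefore move along a
  characteristic.\<close>

lemma unif_deriv_integral:
  fixes f :: "real \<Rightarrow> real \<Rightarrow> real"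
  assumes f: "unif_deriv I {a..b} t f g" and t: "t \<in> I"
    and cf: "\<And>t'. t' \<in> I \<Longrightarrow> continuous_on {a..b} (f t')" and cg: "continuous_on {a..b} g"
  shows "unif_deriv I {a..b} t (\<lambda>t' x. integral {a..x} (f t')) (\<lambda>x. integral {a..x} g)"
proof (rule unif_derivI[where C = "b - a"])
  fix e :: real assume e: "0 < e"
  have "\<forall>\<^sub>F t' in at t within I. \<forall>x\<in>{a..b}. \<bar>f t' x - f t x - (t' - t) * g x\<bar> \<le> e * \<bar>t' - t\<bar>"
    using f e unfolding unif_deriv_def by blast
  moreover have "\<forall>\<^sub>F t' in at t within I. t' \<in> I" by (simp add: eventually_at_filter)
  ultimately show "\<forall>\<^sub>F t' in at t within I. \<forall>x\<in>{a..b}.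
     \<bar>integral {a..x} (f t') - integral {a..x} (f t) - (t' - t) * integral {a..x} g\<bar> \<le> (b - a) * (e * \<bar>t' - t\<bar>)"
  proof eventually_elim
    case (elim t')
    show ?case
    proof
      fix x assume x: "x \<in> {a..b}"
      have i: "h integrable_on {a..x}" if "continuous_on {a..b} h" for h :: "real \<Rightarrow> real"
        using x that by (intro integrable_continuous_interval) (auto intro: continuous_on_subset)
      have "integral {a..x} (f t') - integral {a..x} (f t) - (t' - t) * integral {a..x} g =
        integral {a..x} (\<lambda>y. f t' y - f t y - (t' - t) * g y)"
        using i[OF cf[OF elim(2)]] i[OF cf[OF t]] i[OF cg]
        by (simp add: Henstock_Kurzweil_Integration.integral_diff integrable_diff integrable_on_mult_right)
      also have "\<bar>\<dots>\<bar> \<le> e * \<bar>t' - t\<bar> * (x - a)"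
        unfolding real_norm_def[symmetric]
        by (rule integral_bound)
           (use x elim(1) cf[OF elim(2)] cf[OF t] cg in \<open>auto intro!: continuous_intros intro: continuous_on_subset\<close>)
      also have "\<dots> \<le> e * \<bar>t' - t\<bar> * (b - a)"
        using x e by (intro mult_left_mono) auto
      finally show "\<bar>integral {a..x} (f t') - integral {a..x} (f t) - (t' - t) * integral {a..x} g\<bar> \<le> (b - a) * (e * \<bar>t' - t\<bar>)"
        by (simp add: mult.commute)
    qed
  qed
qed

lemma unif_deriv_lborel_integral:
  fixes f :: "real \<Rightarrow> real \<Rightarrow> real"
  assumes f: "unif_deriv I UNIV t f g" and t: "t \<in> I"
    and i: "\<And>t'. t' \<in> I \<Longrightarrow> integrable lborel (\<lambda>x. f t' x * \<psi> x)" "integrable lborel (\<lambda>x. g x * \<psi> x)" "integrable lborel \<psi>"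
  shows "((\<lambda>t'. LBINT x. f t' x * \<psi> x) has_real_derivative (LBINT x. g x * \<psi> x)) (at t within I)"
\<comment> \<open>The integral is treated as a function constant in a dummy space variable, so that
  the rules for \<open>unif_deriv\<close> apply to it.\<close>
proof (rule unif_deriv_pointwise[where f = "\<lambda>t' _. LBINT x. f t' x * \<psi> x" and g = "\<lambda>_. LBINT x. g x * \<psi> x" and X = UNIV])
  show "unif_deriv I UNIV t (\<lambda>t' _. LBINT x. f t' x * \<psi> x) (\<lambda>_. LBINT x. g x * \<psi> x)"
  proof (rule unif_derivI[where C = "LBINT x. \<bar>\<psi> x\<bar>"])
    fix e :: real assume e: "0 < e"
    have "\<forall>\<^sub>F t' in at t within I. \<forall>x\<in>UNIV. \<bar>f t' x - f t x - (t' - t) * g x\<bar> \<le> e * \<bar>t' - t\<bar>"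
      using f e unfolding unif_deriv_def by blast
    moreover have "\<forall>\<^sub>F t' in at t within I. t' \<in> I" by (simp add: eventually_at_filter)
    ultimately show "\<forall>\<^sub>F t' in at t within I. \<forall>x::real\<in>UNIV. \<bar>(LBINT x. f t' x * \<psi> x) - (LBINT x. f t x * \<psi> x)
         - (t' - t) * (LBINT x. g x * \<psi> x)\<bar> \<le> (LBINT x. \<bar>\<psi> x\<bar>) * (e * \<bar>t' - t\<bar>)"
    proof eventually_elim
      case (elim t')
      let ?h = "\<lambda>x. (f t' x - f t x - (t' - t) * g x) * \<psi> x"
      have eq: "?h = (\<lambda>x. f t' x * \<psi> x - f t x * \<psi> x - (t' - t) * (g x * \<psi> x))"
        by (simp add: fun_eq_iff algebra_simps)
      have ih: "integrable lborel ?h" unfolding eq using i(1)[OF elim(2)] i(1)[OF t] i(2) by simp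
      have "(LBINT x. f t' x * \<psi> x) - (LBINT x. f t x * \<psi> x) - (t' - t) * (LBINT x. g x * \<psi> x) = (LBINT x. ?h x)"
        unfolding eq using i(1)[OF elim(2)] i(1)[OF t] i(2) by simp
      also have "\<bar>\<dots>\<bar> \<le> (LBINT x. \<bar>?h x\<bar>)" by (rule integral_abs_bound)
      also have "\<dots> \<le> (LBINT x. (e * \<bar>t' - t\<bar>) * \<bar>\<psi> x\<bar>)"
      proof (rule integral_mono)
        show "integrable lborel (\<lambda>x. \<bar>?h x\<bar>)" using ih by simp
        show "integrable lborel (\<lambda>x. (e * \<bar>t' - t\<bar>) * \<bar>\<psi> x\<bar>)" using i(3) by simp
        show "\<bar>?h x\<bar> \<le> (e * \<bar>t' - t\<bar>) * \<bar>\<psi> x\<bar>" for x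
          using elim(1) by (auto simp: abs_mult intro!: mult_right_mono)
      qed
      finally show ?case by (simp add: mult.commute)
    qed
  qed
qed simp

section \<open>Characteristics and conservation of mass\<close>

lemma has_real_derivative_unique_Icc:
  fixes f :: "real \<Rightarrow> real"
  assumes "(f has_real_derivative D) (at t within {a..b})" "(f has_real_derivative D') (at t within {a..b})"
    and "a < b" "t \<in> {a..b}"
  shows "D = D'"
proof (rule tendsto_unique)
  show "at t within {a..b} \<noteq> bot"
    using assms(3,4) by (simp add: trivial_limit_within)
qed (use assms(1,2) in \<open>simp_all add: has_field_derivative_iff\<close>)

lemma DERIV_within_nonincreasing:
  fixes f :: "real \<Rightarrow> real"
  assumes "a \<le> b" and d: "\<And>x. x \<in> {a..b} \<Longrightarrow> (f has_real_derivative f' x) (at x within {a..b})"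
    and "\<And>x. x \<in> {a..b} \<Longrightarrow> f' x \<le> 0"
  shows "f b \<le> f a"
proof (cases "a < b")
  case True
  have c: "continuous_on {a..b} f"
    using d DERIV_continuous unfolding continuous_on_eq_continuous_within by blast
  have "(f has_derivative (\<lambda>h. f' x * h)) (at x)" if "a < x" "x < b" for x
    using d[of x] that at_within_Icc_at[of a x b] by (simp add: has_field_derivative_def)
  from mvt[OF True c this] obtain z where "a < z" "z < b" "f b - f a = f' z * (b - a)"
    by blast
  then show ?thesis using assms(3)[of z] mult_nonpos_nonneg[of "f' z" "b - a"] by simp
qed (use assms in simp)

lemma has_integral_DERIV:
  fixes f :: "real \<Rightarrow> real"
  assumes "\<And>x. (f has_real_derivative f' x) (at x)" "a \<le> b"
  shows "(f' has_integral f b - f a) {a..b}"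
  using assms
  by (intro fundamental_theorem_of_calculus)
     (auto simp: has_real_derivative_iff_has_vector_derivative[symmetric] intro: has_field_derivative_at_within)

text \<open>All that the analysis uses about a strong solution on [0, T], in pointwise form; v
  stands for u_t and vx for u_tx. Neither m_t nor m_x is available, and the evolution equation
  enters through \<open>weak\<close> alone.\<close>

locale wave_flow =
  fixes T :: real and u ux uxx v vx q :: "real \<Rightarrow> real \<Rightarrow> real"
  assumes T: "0 < T"
    and du: "t \<in> {0..T} \<Longrightarrow> (u t has_real_derivative ux t x) (at x)"
    and dux: "t \<in> {0..T} \<Longrightarrow> (ux t has_real_derivative uxx t x) (at x)"
    and dv: "t \<in> {0..T} \<Longrightarrow> (v t has_real_derivative vx t x) (at x)"
    and cuxx: "t \<in> {0..T} \<Longrightarrow> isCont (uxx t) x"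
    and cvx: "t \<in> {0..T} \<Longrightarrow> isCont (vx t) x"
    and bounded_u: "\<exists>B. \<forall>t\<in>{0..T}. \<forall>x. \<bar>u t x\<bar> \<le> B \<and> \<bar>ux t x\<bar> \<le> B \<and> \<bar>uxx t x\<bar> \<le> B"
    and bounded_v: "t \<in> {0..T} \<Longrightarrow> \<exists>B. \<forall>x. \<bar>v t x\<bar> \<le> B \<and> \<bar>vx t x\<bar> \<le> B"
    and u_t: "t \<in> {0..T} \<Longrightarrow> unif_deriv {0..T} UNIV t u (v t)"
    and ux_t: "t \<in> {0..T} \<Longrightarrow> unif_deriv {0..T} UNIV t ux (vx t)"
    and weak: "t \<in> {0..T} \<Longrightarrow> test_function \<phi> \<Longrightarrow>
      ((\<lambda>t'. LBINT x. (u t' x - uxx t' x) * \<phi> x) has_real_derivative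
         (LBINT x. sin ((u t x)\<^sup>2 - (ux t x)\<^sup>2) * (u t x - uxx t x) * deriv \<phi> x)) (at t within {0..T})"
    and m0_nonneg: "0 \<le> u 0 x - uxx 0 x"
    and u_L2: "t \<in> {0..T} \<Longrightarrow> integrable lborel (\<lambda>x. (u t x)\<^sup>2)"
    and q0: "q 0 x = x"
    and dq: "t \<in> {0..T} \<Longrightarrow>
      ((\<lambda>t'. q t' x) has_real_derivative sin ((u t (q t x))\<^sup>2 - (ux t (q t x))\<^sup>2)) (at t within {0..T})"
begin

definition m :: "real \<Rightarrow> real \<Rightarrow> real" where "m t x = u t x - uxx t x"
definition S :: "real \<Rightarrow> real \<Rightarrow> real" where "S t x = sin ((u t x)\<^sup>2 - (ux t x)\<^sup>2)"
definition N :: "real \<Rightarrow> real \<Rightarrow> real" where "N t x = cos ((u t x)\<^sup>2 - (ux t x)\<^sup>2) * ux t x"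
text \<open>The nonlocal part of u_tx. Once F_x = v is known, F - F_xx = -S m follows, and this
  makes F accessible to the comparison lemma.\<close>

definition F :: "real \<Rightarrow> real \<Rightarrow> real" where "F t x = vx t x - S t x * m t x"

lemma dq': "t \<in> {0..T} \<Longrightarrow> ((\<lambda>t'. q t' x) has_real_derivative S t (q t x)) (at t within {0..T})"
  unfolding S_def by (rule dq)

lemma isCont_fields:
  assumes "t \<in> {0..T}"
  shows "isCont (u t) x" "isCont (ux t) x" "isCont (uxx t) x" "isCont (v t) x" "isCont (vx t) x"
    "isCont (m t) x" "isCont (S t) x" "isCont (N t) x" "isCont (F t) x"
proof -
  show c: "isCont (u t) x" "isCont (ux t) x" "isCont (uxx t) x" "isCont (v t) x" "isCont (vx t) x"
    using assms DERIV_isCont[OF du] DERIV_isCont[OF dux] DERIV_isCont[OF dv] cuxx cvx by blast+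
  show m: "isCont (m t) x" and S: "isCont (S t) x" and "isCont (N t) x"
    unfolding m_def[abs_def] S_def[abs_def] N_def[abs_def] by (intro continuous_intros c)+
  show "isCont (F t) x" unfolding F_def[abs_def] by (intro continuous_intros c m S)
qed

lemma continuous_fields:
  assumes "t \<in> {0..T}"
  shows "continuous_on X (u t)" "continuous_on X (ux t)" "continuous_on X (uxx t)" "continuous_on X (v t)"
    "continuous_on X (vx t)" "continuous_on X (m t)" "continuous_on X (S t)" "continuous_on X (N t)"
    "continuous_on X (F t)"
  using isCont_fields[OF assms] by (blast intro: continuous_at_imp_continuous_on)+

lemmas continuous_rules = integrable_continuous_interval continuous_intros continuous_fields

text \<open>Differentiating u^2 - u_x^2 gives 2 u_x (u - u_xx), so the second derivative enters only
  through m. Hence the rate at which the flow stretches is 2 N m.\<close>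

lemma dS: assumes "t \<in> {0..T}" shows "(S t has_real_derivative 2 * N t x * m t x) (at x)"
  unfolding S_def[abs_def] N_def m_def
  by (rule derivative_eq_intros du dux assms refl | simp add: power2_eq_square algebra_simps)+

text \<open>The time derivative of the integral of m \<phi> is computed in two ways, from the weak
  equation and from u_t and u_tx. Comparison shows that a primitive V of v differs from F by a
  function with vanishing weak derivative, hence by a constant.\<close>

lemma flux_derivative:
  assumes t: "t \<in> {0..T}" shows "(F t has_real_derivative v t x) (at x)"
proof -
  have "\<exists>V. \<forall>x. - \<infinity> < ereal x \<longrightarrow> ereal x < \<infinity> \<longrightarrow> (V has_vector_derivative v t x) (at x)"
    by (rule einterval_antiderivative) (use isCont_fields[OF t] in auto)
  then obtain V where V: "\<And>x. (V has_real_derivative v t x) (at x)"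
    by (auto simp: has_real_derivative_iff_has_vector_derivative)
  have cV: "continuous_on UNIV V" using V DERIV_isCont by (blast intro: continuous_at_imp_continuous_on)
  let ?G = "\<lambda>x. V x - F t x"
  have "?G a = ?G b" for a b
  proof (rule du_Bois_Reymond[where G = ?G])
    show "continuous_on UNIV ?G" by (intro continuous_intros cV continuous_fields t)
    fix \<phi> assume \<phi>: "test_function \<phi>"
    note i = test_function_integrable[OF \<phi>]
    have i\<phi>: "integrable lborel \<phi>" "integrable lborel (deriv \<phi>)"
      using i[of "\<lambda>_. 1"] by auto
    \<comment> \<open>Only one derivative is moved onto \<phi>: uniform time derivatives are known
      for u and u_x, and with them the integral can be differentiated in time.\<close>
    have eq: "(LBINT x. (u t' x - uxx t' x) * \<phi> x) =
        (LBINT x. u t' x * \<phi> x) + (LBINT x. ux t' x * deriv \<phi> x)" if t': "t' \<in> {0..T}" for t'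
    proof -
      have "(LBINT x. (u t' x - uxx t' x) * \<phi> x) = (LBINT x. u t' x * \<phi> x - uxx t' x * \<phi> x)"
        by (simp add: left_diff_distrib)
      also have "\<dots> = (LBINT x. u t' x * \<phi> x) - (LBINT x. uxx t' x * \<phi> x)"
        by (intro Bochner_Integration.integral_diff i continuous_fields t')
      also have "(LBINT x. uxx t' x * \<phi> x) = - (LBINT x. ux t' x * deriv \<phi> x)"
        by (intro test_function_by_parts \<phi> dux t' continuous_fields)
      finally show ?thesis by simp
    qed
    have "((\<lambda>t'. (LBINT x. u t' x * \<phi> x) + (LBINT x. ux t' x * deriv \<phi> x)) has_real_derivative
        (LBINT x. v t x * \<phi> x) + (LBINT x. vx t x * deriv \<phi> x)) (at t within {0..T})"
      by (intro DERIV_add unif_deriv_lborel_integral u_t ux_t t i i\<phi> continuous_fields)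
    then have "((\<lambda>t'. LBINT x. (u t' x - uxx t' x) * \<phi> x) has_real_derivative
        (LBINT x. v t x * \<phi> x) + (LBINT x. vx t x * deriv \<phi> x)) (at t within {0..T})"
      by (rule has_field_derivative_transform_within[OF _ zero_less_one t]) (use eq in simp)
    from has_real_derivative_unique_Icc[OF this weak[OF t \<phi>] T t]
    have "(LBINT x. v t x * \<phi> x) + (LBINT x. vx t x * deriv \<phi> x) =
        (LBINT x. S t x * m t x * deriv \<phi> x)" by (simp add: S_def m_def)
    moreover have "(LBINT x. v t x * \<phi> x) = - (LBINT x. V x * deriv \<phi> x)"
      by (intro test_function_by_parts \<phi> V continuous_fields t)
    moreover have "(LBINT x. ?G x * deriv \<phi> x) =
       (LBINT x. V x * deriv \<phi> x - vx t x * deriv \<phi> x + S t x * m t x * deriv \<phi> x)"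
      by (simp add: F_def algebra_simps)
    moreover have "\<dots> = (LBINT x. V x * deriv \<phi> x) - (LBINT x. vx t x * deriv \<phi> x)
       + (LBINT x. S t x * m t x * deriv \<phi> x)"
    proof -
      have "integrable lborel (\<lambda>x. V x * deriv \<phi> x)" "integrable lborel (\<lambda>x. vx t x * deriv \<phi> x)"
        "integrable lborel (\<lambda>x. S t x * m t x * deriv \<phi> x)"
        by (intro i cV continuous_intros continuous_fields t)+
      then show ?thesis by simp
    qed
    ultimately show "(LBINT x. ?G x * deriv \<phi> x) = 0" by simp
  qed
  then have "F t = (\<lambda>x. V x - (V 0 - F t 0))" by (metis diff_diff_eq2 add_diff_cancel_left' add.commute)
  then show ?thesis using DERIV_diff[OF V[of x] DERIV_const[of "V 0 - F t 0"]] by simp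
qed

section \<open>Order and range of the characteristics\<close>

lemma speed_bound: "\<bar>S t x\<bar> \<le> 1"
  by (simp add: S_def)

lemma Lipschitz_speed:
  obtains K where "K \<ge> 0" "\<And>t x y. t \<in> {0..T} \<Longrightarrow> \<bar>S t x - S t y\<bar> \<le> K * \<bar>x - y\<bar>"
proof -
  obtain B where B: "\<And>t x. t \<in> {0..T} \<Longrightarrow> \<bar>u t x\<bar> \<le> B" "\<And>t x. t \<in> {0..T} \<Longrightarrow> \<bar>ux t x\<bar> \<le> B"
    "\<And>t x. t \<in> {0..T} \<Longrightarrow> \<bar>uxx t x\<bar> \<le> B"
    using bounded_u by blast
  have "0 \<le> B" using B(1)[of 0 0] T by auto
  have bd: "norm (2 * N t x * m t x) \<le> 2 * B * (2 * B)" if t: "t \<in> {0..T}" for t x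
  proof -
    have "\<bar>N t x\<bar> \<le> 1 * B" unfolding N_def abs_mult using B(2)[OF t, of x] by (intro mult_mono) auto
    moreover have "\<bar>m t x\<bar> \<le> 2 * B" unfolding m_def using B(1,3)[OF t, of x] by linarith
    ultimately show ?thesis unfolding real_norm_def abs_mult using \<open>0 \<le> B\<close> by (intro mult_mono) auto
  qed
  show thesis
  proof (rule that[of "2 * B * (2 * B)"])
    fix t x y assume t: "t \<in> {0..T}"
    have "norm (S t x - S t y) \<le> 2 * B * (2 * B) * norm (x - y)"
      by (rule field_differentiable_bound[of UNIV "S t" "\<lambda>x. 2 * N t x * m t x"])
         (use dS[OF t] bd[OF t] in auto)
    then show "\<bar>S t x - S t y\<bar> \<le> 2 * B * (2 * B) * \<bar>x - y\<bar>" by simp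
  qed (use \<open>0 \<le> B\<close> in simp)
qed

lemma abs_characteristic_le:
  assumes t: "t \<in> {0..T}" shows "\<bar>q t x - x\<bar> \<le> t"
proof -
  have d: "((\<lambda>t'. q t' x) has_real_derivative S t' (q t' x)) (at t' within {0..t})" if "t' \<in> {0..t}" for t'
    using dq'[of t' x] that t by (auto intro: has_field_derivative_subset)
  have "norm (q t x - q 0 x) \<le> 1 * norm (t - 0)"
    by (rule field_differentiable_bound[of "{0..t}"]) (use t d speed_bound in auto)
  then show ?thesis using t by (simp add: q0)
qed

text \<open>Gronwall in both directions; the squared distance is differentiable where the distance
  itself might not be. The lower bound keeps characteristics apart, the upper one gives continuity
  in the starting point.\<close>

lemma characteristic_distance:
  assumes K: "K \<ge> 0" "\<And>t x y. t \<in> {0..T} \<Longrightarrow> \<bar>S t x - S t y\<bar> \<le> K * \<bar>x - y\<bar>" and t: "t \<in> {0..T}"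
  shows "(a - b)\<^sup>2 * exp (- (2 * K) * t) \<le> (q t a - q t b)\<^sup>2" "(q t a - q t b)\<^sup>2 \<le> (a - b)\<^sup>2 * exp (2 * K * t)"
proof -
  let ?\<delta> = "\<lambda>t'. q t' a - q t' b" and ?d = "\<lambda>t'. S t' (q t' a) - S t' (q t' b)"
  have d\<delta>: "(?\<delta> has_real_derivative ?d t') (at t' within {0..t})" if "t' \<in> {0..t}" for t'
    using DERIV_diff[OF dq'[of t' a] dq'[of t' b]] that t by (auto intro: has_field_derivative_subset)
  have d: "((\<lambda>t'. (?\<delta> t')\<^sup>2 * exp (c * t')) has_real_derivative
     exp (c * t') * (2 * (?\<delta> t' * ?d t') + c * (?\<delta> t')\<^sup>2)) (at t' within {0..t})"
    if "t' \<in> {0..t}" for t' c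
    by (rule derivative_eq_intros d\<delta> that refl | simp add: power2_eq_square algebra_simps)+
  have prod: "\<bar>?\<delta> t' * ?d t'\<bar> \<le> K * (?\<delta> t')\<^sup>2" if "t' \<in> {0..t}" for t'
  proof -
    have "\<bar>?\<delta> t'\<bar> * \<bar>?d t'\<bar> \<le> \<bar>?\<delta> t'\<bar> * (K * \<bar>?\<delta> t'\<bar>)"
      using K(2)[of t' "q t' a" "q t' b"] that t by (intro mult_left_mono) auto
    also have "\<dots> = K * (?\<delta> t')\<^sup>2" by (simp add: power2_eq_square)
    finally show ?thesis by (simp add: abs_mult)
  qed
  have "(?\<delta> t)\<^sup>2 * exp (- (2 * K) * t) \<le> (?\<delta> 0)\<^sup>2 * exp (- (2 * K) * 0)"
  proof (rule DERIV_within_nonincreasing[OF _ d])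
    show "exp (- (2 * K) * t') * (2 * (?\<delta> t' * ?d t') + - (2 * K) * (?\<delta> t')\<^sup>2) \<le> 0" if "t' \<in> {0..t}" for t'
      using prod[OF that] by (intro mult_nonneg_nonpos) auto
  qed (use t in auto)
  then have "(?\<delta> t)\<^sup>2 * exp (- (2 * K) * t) * exp (2 * K * t) \<le> (a - b)\<^sup>2 * exp (2 * K * t)"
    by (intro mult_right_mono) (auto simp: q0)
  then show "(?\<delta> t)\<^sup>2 \<le> (a - b)\<^sup>2 * exp (2 * K * t)"
    by (simp add: mult.assoc exp_add[symmetric])
  have "- ((?\<delta> t)\<^sup>2 * exp (2 * K * t)) \<le> - ((?\<delta> 0)\<^sup>2 * exp (2 * K * 0))"
  proof (rule DERIV_within_nonincreasing[OF _ DERIV_minus[OF d]])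
    show "- (exp (2 * K * t') * (2 * (?\<delta> t' * ?d t') + 2 * K * (?\<delta> t')\<^sup>2)) \<le> 0" if "t' \<in> {0..t}" for t'
      using prod[OF that] by simp
  qed (use t in auto)
  then have "(a - b)\<^sup>2 * exp (- (2 * K) * t) \<le> (?\<delta> t)\<^sup>2 * exp (2 * K * t) * exp (- (2 * K) * t)"
    by (intro mult_right_mono) (auto simp: q0)
  then show "(a - b)\<^sup>2 * exp (- (2 * K) * t) \<le> (?\<delta> t)\<^sup>2"
    by (simp add: mult.assoc exp_add[symmetric])
qed

text \<open>If the order were lost, the two characteristics would meet at some time by the
  intermediate value theorem, against the lower bound on their distance.\<close>

lemma characteristic_strict_mono:
  assumes t: "t \<in> {0..T}" and ab: "a < b" shows "q t a < q t b"
proof (rule ccontr)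
  obtain K where K: "K \<ge> 0" "\<And>t x y. t \<in> {0..T} \<Longrightarrow> \<bar>S t x - S t y\<bar> \<le> K * \<bar>x - y\<bar>"
    using Lipschitz_speed by blast
  assume "\<not> q t a < q t b"
  moreover have "continuous_on {0..t} (\<lambda>t'. q t' b - q t' a)"
  proof -
    have "continuous (at t' within {0..t}) (\<lambda>t'. q t' b - q t' a)" if "t' \<in> {0..t}" for t'
      using DERIV_continuous[OF DERIV_diff[OF dq'[of t' b] dq'[of t' a]]] that t
      by (auto intro: continuous_within_subset)
    then show ?thesis by (simp add: continuous_on_eq_continuous_within)
  qed
  ultimately obtain s where s: "0 \<le> s" "s \<le> t" "q s b - q s a = 0"
    using IVT2'[of "\<lambda>t'. q t' b - q t' a" t 0 0] t ab by (auto simp: q0)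
  then have "(a - b)\<^sup>2 * exp (- (2 * K) * s) \<le> 0"
    using characteristic_distance(1)[OF K, of s a b] t by simp
  then show False using ab by (simp add: mult_le_0_iff)
qed

lemma characteristic_mono: "t \<in> {0..T} \<Longrightarrow> a \<le> b \<Longrightarrow> q t a \<le> q t b"
  using characteristic_strict_mono[of t a b] by (cases "a = b") auto

text \<open>No point is displaced by more than T, so the image of [y - T, y + T] under the
  continuous map q(t) encloses y.\<close>

lemma characteristic_surj:
  assumes t: "t \<in> {0..T}" obtains x where "q t x = y"
proof -
  obtain K where K: "K \<ge> 0" "\<And>t x y. t \<in> {0..T} \<Longrightarrow> \<bar>S t x - S t y\<bar> \<le> K * \<bar>x - y\<bar>"
    using Lipschitz_speed by blast
  have lip: "\<bar>q t a - q t b\<bar> \<le> exp (K * t) * \<bar>a - b\<bar>" for a b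
  proof (rule power2_le_imp_le)
    have "(q t a - q t b)\<^sup>2 \<le> (a - b)\<^sup>2 * exp (2 * K * t)" by (rule characteristic_distance(2)[OF K t])
    also have "\<dots> = (exp (K * t) * \<bar>a - b\<bar>)\<^sup>2"
      by (simp add: power_mult_distrib power2_eq_square[of "exp _"] exp_add[symmetric])
    finally show "\<bar>q t a - q t b\<bar>\<^sup>2 \<le> (exp (K * t) * \<bar>a - b\<bar>)\<^sup>2" by simp
  qed simp
  have "(exp (K * t))-lipschitz_on UNIV (q t)"
    by (rule lipschitz_onI) (use lip in \<open>auto simp: dist_real_def\<close>)
  then have "continuous_on {y - T..y + T} (q t)"
    using lipschitz_on_continuous_on continuous_on_subset by blast
  moreover have "q t (y - T) \<le> y" "y \<le> q t (y + T)"
    using abs_characteristic_le[OF t, of "y - T"] abs_characteristic_le[OF t, of "y + T"] t by (auto simp: abs_le_iff)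
  ultimately show thesis
    using IVT'[of "q t" "y - T" y "y + T"] T that by auto
qed

section \<open>Mass between characteristics\<close>

lemma momentum_has_integral:
  assumes t: "t \<in> {0..T}" and ab: "a \<le> b"
  shows "integral {a..b} (m t) = integral {a..b} (u t) - (ux t b - ux t a)"
proof -
  have "(uxx t has_integral ux t b - ux t a) {a..b}"
    by (rule has_integral_DERIV[OF dux[OF t] ab])
  then have "integral {a..b} (uxx t) = ux t b - ux t a" by (rule integral_unique)
  then show ?thesis
    unfolding m_def[abs_def]
    by (subst Henstock_Kurzweil_Integration.integral_diff)
       (auto intro!: continuous_rules t)
qed

text \<open>The mass from a far left point -L up to a characteristic changes, apart from a term
  depending on time only, at the rate -F(t, -L): the transport term S m cancels the one inside F.
  This rate is the same for both characteristics, so the difference is constant.\<close>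

lemma mass_conserved:
  assumes t: "t \<in> {0..T}" and ab: "a \<le> b"
  shows "integral {q t a..q t b} (m t) = integral {a..b} (m 0)"
proof -
  \<comment> \<open>No characteristic moves by more than T, so those from a and b stay strictly
    inside (-L, L).\<close>
  define L where "L = \<bar>a\<bar> + \<bar>b\<bar> + T + 1"
  have 0: "0 \<in> {0..T}" using T by simp
  have L: "q t' c \<in> {- L<..<L}" if "t' \<in> {0..T}" "c \<in> {a, b}" for t' c
    using abs_characteristic_le[OF that(1), of c] that by (auto simp: L_def)
  \<comment> \<open>The mass on [-L, x] up to a term depending on time only. It is written with u_x
    instead of an integral of u_xx because u_x has a known time derivative.\<close>
  define W where "W t' x = integral {- L..x} (u t') - ux t' x" for t' x
  have W: "integral {x..y} (m t') = W t' y - W t' x" if "t' \<in> {0..T}" "x \<le> y" "- L \<le> x" for t' x y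
  proof -
    have "integral {- L..x} (u t') + integral {x..y} (u t') = integral {- L..y} (u t')"
      using that by (intro Henstock_Kurzweil_Integration.integral_combine)
        (auto intro!: continuous_rules)
    then show ?thesis unfolding W_def momentum_has_integral[OF that(1,2)] by simp
  qed
  have dW: "((\<lambda>t'. W t' (q t' c)) has_real_derivative - F t' (- L)) (at t' within {0..T})"
    if t': "t' \<in> {0..T}" and c: "c \<in> {a, b}" for t' c
  proof -
    let ?g = "\<lambda>x. integral {- L..x} (v t') - vx t' x"
    have int: "unif_deriv {0..T} {- L..L} t' W ?g"
      unfolding W_def
      by (intro unif_deriv_diff unif_deriv_integral unif_deriv_mono[OF u_t] unif_deriv_mono[OF ux_t] t'
          continuous_fields) auto
    have g: "?g x = - S t' x * m t' x - F t' (- L)" if "- L \<le> x" for x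
    proof -
      have "(v t' has_integral F t' x - F t' (- L)) {- L..x}"
      by (rule has_integral_DERIV[OF flux_derivative[OF t'] that])
      then have "integral {- L..x} (v t') = F t' x - F t' (- L)" by (rule integral_unique)
      then show ?thesis by (simp add: F_def)
    qed
    have at: "at (q t' c) within {- L..L} = at (q t' c)"
      using L[OF t' c] by (intro at_within_Icc_at) auto
    have prim: "((\<lambda>x. integral {- L..x} f) has_real_derivative f (q t' c)) (at (q t' c))"
      if "continuous_on {- L..L} f" for f :: "real \<Rightarrow> real"
      using integral_has_real_derivative[OF that, of "q t' c"] L[OF t' c] at by auto
    have "((\<lambda>t'. W t' (q t' c)) has_real_derivative ?g (q t' c) + (u t' (q t' c) - uxx t' (q t' c)) * S t' (q t' c))
        (at t' within {0..T})"
    proof (rule material_derivative[OF int dq'[OF t']])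
      show "q s c \<in> {- L..L}" if "s \<in> {0..T}" for s using L[OF that c] by auto
      show "isCont ?g (q t' c)"
        using isCont_fields[OF t'] DERIV_isCont[OF prim[OF continuous_fields(4)[OF t']]] by (intro continuous_intros) auto
      show "(W t' has_real_derivative u t' (q t' c) - uxx t' (q t' c)) (at (q t' c))"
        unfolding W_def[abs_def] by (intro DERIV_diff prim continuous_fields dux t')
    qed
    moreover have "?g (q t' c) + (u t' (q t' c) - uxx t' (q t' c)) * S t' (q t' c) = - F t' (- L)"
      using L[OF t' c] by (subst g) (auto simp: m_def algebra_simps)
    ultimately show ?thesis by simp
  qed
  have "((\<lambda>t'. W t' (q t' b) - W t' (q t' a)) has_real_derivative 0) (at t' within {0..T})" if "t' \<in> {0..T}" for t'
    using DERIV_diff[OF dW[OF that, of b] dW[OF that, of a]] by simp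
  then obtain k where k: "\<And>t'. t' \<in> {0..T} \<Longrightarrow> W t' (q t' b) - W t' (q t' a) = k"
    using has_field_derivative_zero_constant[of "{0..T}" "\<lambda>t'. W t' (q t' b) - W t' (q t' a)"] by auto
  have "integral {q t a..q t b} (m t) = W t (q t b) - W t (q t a)"
    by (rule W[OF t characteristic_mono[OF t ab]]) (use L[OF t, of a] in auto)
  also have "\<dots> = W 0 (q 0 b) - W 0 (q 0 a)" using k t 0 by simp
  also have "\<dots> = integral {a..b} (m 0)"
    using W[OF 0 ab] L[OF 0, of a] by (simp add: q0)
  finally show ?thesis .
qed

text \<open>A negative value would persist, by continuity, on a short interval to the right of y.
  The mass of this interval equals the initial mass between the starting points of the
  characteristics through its ends, which is nonnegative.\<close>

lemma m_nonneg:
  assumes t: "t \<in> {0..T}" shows "0 \<le> m t y"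
proof (rule ccontr)
  assume "\<not> 0 \<le> m t y"
  then have neg: "m t y < 0" by simp
  have "isCont (m t) y" by (rule isCont_fields[OF t])
  then have "(m t \<longlongrightarrow> m t y) (at_right y)"
    by (simp add: isCont_def filterlim_at_split)
  then have "\<forall>\<^sub>F x in at_right y. m t x < m t y / 2"
    using neg by (intro order_tendstoD(2)) auto
  then obtain d where d: "d > y" "\<And>x. y < x \<Longrightarrow> x < d \<Longrightarrow> m t x < m t y / 2"
    unfolding eventually_at_right_field by blast
  define z where "z = (y + d) / 2"
  have z: "y < z" "\<And>x. x \<in> {y..z} \<Longrightarrow> m t x \<le> m t y / 2"
  proof -
    show "y < z" using d by (simp add: z_def)
    show "m t x \<le> m t y / 2" if "x \<in> {y..z}" for x
      using that d neg by (cases "x = y") (auto simp: z_def intro!: less_imp_le)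
  qed
  obtain a b where ab: "q t a = y" "q t b = z" using characteristic_surj[OF t] by metis
  then have "a \<le> b" using characteristic_mono[OF t, of b a] z by linarith
  have "integral {y..z} (m t) \<le> integral {y..z} (\<lambda>_. m t y / 2)"
    using z by (intro integral_le) (auto intro!: continuous_rules t)
  also have "\<dots> < 0" using z neg by (simp add: mult_pos_neg)
  finally have "integral {a..b} (m 0) < 0"
    using mass_conserved[OF t \<open>a \<le> b\<close>] ab by simp
  moreover have "0 \<le> integral {a..b} (m 0)"
    using T m0_nonneg
    by (intro Henstock_Kurzweil_Integration.integral_nonneg continuous_rules) (auto simp: m_def)
  ultimately show False by simp
qed

end

section \<open>Energy and the growth of $M/m$\<close>

lemma one_minus_cos_le: "\<bar>1 - cos x\<bar> \<le> \<bar>x\<bar>" for x :: real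
proof -
  have "1 - cos x = 2 * (sin (x / 2))\<^sup>2"
    using cos_double_sin[of "x / 2"] by simp
  also have "\<dots> = 2 * (\<bar>sin (x / 2)\<bar> * \<bar>sin (x / 2)\<bar>)"
    by (simp add: power2_eq_square)
  also have "\<dots> \<le> 2 * (\<bar>x / 2\<bar> * 1)"
    by (intro mult_left_mono mult_mono abs_sin_x_le_abs_x) auto
  finally show ?thesis by simp
qed

lemma integral_unit_interval_tendsto_0:
  fixes f :: "real \<Rightarrow> real"
  assumes f: "integrable lborel f" and X: "filterlim (\<lambda>n. \<bar>X n\<bar>) at_top sequentially"
  shows "(\<lambda>n. integral {X n..X n + 1} f) \<longlonglongrightarrow> 0"
proof -
  have [measurable]: "f \<in> borel_measurable lborel" using f by (rule borel_measurable_integrable)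
  have "(\<lambda>n. LBINT y. indicator {X n..X n + 1} y *\<^sub>R f y) \<longlonglongrightarrow> integral\<^sup>L lborel (\<lambda>y::real. 0 :: real)"
  proof (rule integral_dominated_convergence)
    show "integrable lborel (\<lambda>y. norm (f y))" using f by simp
    show "AE y in lborel. norm (indicator {X n..X n + 1} y *\<^sub>R f y) \<le> norm (f y)" for n
      by (intro AE_I2) (simp add: indicator_def)
    show "AE y in lborel. (\<lambda>n. indicator {X n..X n + 1} y *\<^sub>R f y) \<longlonglongrightarrow> 0"
    proof (rule AE_I2)
      fix y
      have "\<forall>\<^sub>F n in sequentially. \<bar>y\<bar> + 2 \<le> \<bar>X n\<bar>"
        using X by (simp add: filterlim_at_top)
      then have "\<forall>\<^sub>F n in sequentially. indicator {X n..X n + 1} y *\<^sub>R f y = 0"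
        by eventually_elim (auto simp: indicator_def)
      then show "(\<lambda>n. indicator {X n..X n + 1} y *\<^sub>R f y) \<longlonglongrightarrow> 0"
        by (rule tendsto_eventually)
    qed
  qed auto
  moreover have "(LBINT y. indicator {X n..X n + 1} y *\<^sub>R f y) = integral {X n..X n + 1} f" for n
  proof -
    have "set_integrable lborel {X n..X n + 1} f"
      unfolding set_integrable_def by (rule integrable_mult_indicator) (use f in auto)
    then show ?thesis
      using set_borel_integral_eq_integral(2)[of "{X n..X n + 1}" f] by (simp add: set_lebesgue_integral_def)
  qed
  ultimately show ?thesis by simp
qed

lemma integral_interval_le_lborel:
  fixes f :: "real \<Rightarrow> real"
  assumes f: "integrable lborel f" and "\<And>x. 0 \<le> f x"
  shows "integral {a..b} f \<le> (LBINT x. f x)"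
proof -
  have si: "set_integrable lborel {a..b} f"
    unfolding set_integrable_def by (rule integrable_mult_indicator) (use f in auto)
  have "integral {a..b} f = (LBINT y. indicator {a..b} y *\<^sub>R f y)"
    using set_borel_integral_eq_integral(2)[OF si] by (simp add: set_lebesgue_integral_def)
  also have "\<dots> \<le> (LBINT x. f x)"
    by (rule integral_mono) (use si f assms(2) in \<open>auto simp: set_integrable_def indicator_def\<close>)
  finally show ?thesis .
qed

section \<open>Consequences of the sign of the momentum\<close>

context wave_flow
begin

text \<open>In terms of the kernel this is |p'| \<le> p applied to u = p * m with m \<ge> 0; the
  comparison lemma replaces the convolution.\<close>

lemma abs_ux_le: assumes t: "t \<in> {0..T}" shows "\<bar>ux t x\<bar> \<le> u t x"
proof -
  obtain B where "\<And>t x. t \<in> {0..T} \<Longrightarrow> \<bar>u t x\<bar> \<le> B" "\<And>t x. t \<in> {0..T} \<Longrightarrow> \<bar>ux t x\<bar> \<le> B"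
    using bounded_u by blast
  with t show ?thesis
    by (intro abs_deriv_le_of_supersolution[OF du[OF t] dux[OF t], where B = B])
       (use m_nonneg[OF t] in \<open>auto simp: m_def\<close>)
qed

lemma u_nonneg: "t \<in> {0..T} \<Longrightarrow> 0 \<le> u t x"
  using abs_ux_le[of t x] by linarith

text \<open>The comparison lemma is applied to w = k u + F and w = k u - F. Both satisfy w - w'' = k
  m - S m or k m + S m, which is nonnegative, and their derivatives are k u_x + v and k u_x - v. The
  bound w \<ge> 0 controls F, and adding the two estimates for w' controls v.\<close>

lemma flux_bounds:
  assumes t: "t \<in> {0..T}" and S: "\<And>x. \<bar>S t x\<bar> \<le> k"
  shows "\<bar>F t x\<bar> \<le> k * u t x" "\<bar>v t x\<bar> \<le> k * u t x"
proof -
  obtain B where "\<And>t x. t \<in> {0..T} \<Longrightarrow> \<bar>u t x\<bar> \<le> B" "\<And>t x. t \<in> {0..T} \<Longrightarrow> \<bar>ux t x\<bar> \<le> B"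
    "\<And>t x. t \<in> {0..T} \<Longrightarrow> \<bar>uxx t x\<bar> \<le> B"
    using bounded_u by blast
  note B = this[OF t]
  obtain B' where B': "\<And>x. \<bar>v t x\<bar> \<le> B' \<and> \<bar>vx t x\<bar> \<le> B'"
    using bounded_v[OF t] by blast
  have kpos: "0 \<le> k" using S[of 0] by linarith
  have B0: "0 \<le> B" using B(1)[of 0] by linarith
  have Fb: "\<bar>F t x\<bar> \<le> B' + 2 * B" for x
  proof -
    have "\<bar>S t x * m t x\<bar> \<le> 1 * \<bar>m t x\<bar>"
      unfolding abs_mult using speed_bound by (intro mult_right_mono) auto
    moreover have "\<bar>m t x\<bar> \<le> 2 * B" unfolding m_def using B(1,3)[of x] by linarith
    ultimately show ?thesis using B'[of x] by (auto simp: F_def)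
  qed
  have ku: "\<bar>k * u t x\<bar> \<le> k * B" "\<bar>k * ux t x\<bar> \<le> k * B" for x
    using B kpos by (auto simp: abs_mult intro!: mult_left_mono)
  have Sm: "\<bar>S t x * m t x\<bar> \<le> k * m t x" for x
    unfolding abs_mult using S[of x] m_nonneg[OF t, of x] by (intro mult_mono) auto
  have main: "\<bar>k * ux t x + c * v t x\<bar> \<le> k * u t x + c * F t x" if c: "c = 1 \<or> c = -1" for c x
  proof (rule abs_deriv_le_of_supersolution[where w = "\<lambda>x. k * u t x + c * F t x"
        and w' = "\<lambda>x. k * ux t x + c * v t x" and w'' = "\<lambda>x. k * uxx t x + c * vx t x"])
    show "((\<lambda>x. k * u t x + c * F t x) has_real_derivative k * ux t x + c * v t x) (at x)"
      "((\<lambda>x. k * ux t x + c * v t x) has_real_derivative k * uxx t x + c * vx t x) (at x)" for x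
      by (intro DERIV_add DERIV_cmult du dux dv flux_derivative t)+
    show "0 \<le> k * u t x + c * F t x - (k * uxx t x + c * vx t x)" for x
      using Sm[of x] c by (auto simp: F_def m_def algebra_simps)
    show "\<bar>k * u t x + c * F t x\<bar> \<le> k * B + B' + 2 * B" for x
      using ku(1)[of x] Fb[of x] c by auto
    show "\<bar>k * ux t x + c * v t x\<bar> \<le> k * B + B' + 2 * B" for x
      using ku(2)[of x] B'[of x] B0 c by auto
  qed
  show "\<bar>F t x\<bar> \<le> k * u t x" "\<bar>v t x\<bar> \<le> k * u t x"
    using main[of 1 x] main[of "-1" x] by auto
qed

text \<open>By |u_x| \<le> u the function u^2 exp (2 y) is nondecreasing, so over a unit interval
  u^2 drops by a factor of at most exp 2 \<le> 9.\<close>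

lemma square_le_local_integral:
  assumes t: "t \<in> {0..T}" shows "(u t x)\<^sup>2 \<le> 9 * integral {x..x + 1} (\<lambda>y. (u t y)\<^sup>2)"
proof -
  have "(u t x)\<^sup>2 / 9 \<le> (u t y)\<^sup>2" if y: "y \<in> {x..x + 1}" for y
  proof -
    have "(u t x)\<^sup>2 * exp (2 * x) \<le> (u t y)\<^sup>2 * exp (2 * y)"
    proof (rule DERIV_nonneg_imp_nondecreasing[where f = "\<lambda>y. (u t y)\<^sup>2 * exp (2 * y)"])
      show "x \<le> y" using y by simp
      fix z
      have "((\<lambda>y. (u t y)\<^sup>2 * exp (2 * y)) has_real_derivative 2 * exp (2 * z) * (u t z * (u t z + ux t z))) (at z)"
        by (rule derivative_eq_intros du t refl | simp add: power2_eq_square algebra_simps)+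
      moreover have "0 \<le> 2 * exp (2 * z) * (u t z * (u t z + ux t z))"
        using abs_ux_le[OF t, of z] u_nonneg[OF t, of z] by (intro mult_nonneg_nonneg) auto
      ultimately show "\<exists>y. ((\<lambda>y. (u t y)\<^sup>2 * exp (2 * y)) has_real_derivative y) (at z) \<and> 0 \<le> y" by blast
    qed
    also have "\<dots> \<le> (u t y)\<^sup>2 * (9 * exp (2 * x))"
    proof (rule mult_left_mono)
      have "exp (2 * y) = exp (2 * (y - x)) * exp (2 * x)" by (simp add: exp_add[symmetric])
      also have "exp (2 * (y - x)) \<le> exp (1 + 1)" using y by simp
      also have "exp (1 + 1) \<le> (3 * 3 :: real)" unfolding exp_add using exp_le by (intro mult_mono) auto
      finally show "exp (2 * y) \<le> 9 * exp (2 * x)" by simp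
    qed simp
    finally show ?thesis by simp
  qed
  then have "integral {x..x + 1} (\<lambda>_. (u t x)\<^sup>2 / 9) \<le> integral {x..x + 1} (\<lambda>y. (u t y)\<^sup>2)"
    by (intro integral_le) (auto intro!: continuous_rules t)
  then show ?thesis by simp
qed

text \<open>The energy flux: its x-derivative is 2 u u_t + 2 u_x u_tx. The constant of integration 1
  is chosen so that J is dominated by u^2 and fades at infinity.\<close>

definition J :: "real \<Rightarrow> real \<Rightarrow> real" where
  "J t x = 2 * u t x * F t x + (1 - cos ((u t x)\<^sup>2 - (ux t x)\<^sup>2))"

text \<open>The flux bound with k = 1 gives 2 u^2 for the first term; the second is at most |u^2 -
  u_x^2|, hence at most u^2.\<close>

lemma energy_flux_bound:
  assumes t: "t \<in> {0..T}" shows "\<bar>J t x\<bar> \<le> 3 * (u t x)\<^sup>2"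
proof -
  have "\<bar>2 * u t x * F t x\<bar> \<le> 2 * u t x * u t x"
    unfolding abs_mult using flux_bounds(1)[OF t speed_bound, of x] u_nonneg[OF t, of x]
    by (intro mult_mono) auto
  moreover have "(ux t x)\<^sup>2 \<le> (u t x)\<^sup>2"
    using abs_ux_le[OF t, of x] by (intro abs_le_square_iff[THEN iffD1]) linarith
  then have "\<bar>1 - cos ((u t x)\<^sup>2 - (ux t x)\<^sup>2)\<bar> \<le> (u t x)\<^sup>2"
    by (intro order_trans[OF one_minus_cos_le]) auto
  moreover have "3 * (u t x)\<^sup>2 = 2 * u t x * u t x + (u t x)\<^sup>2" by (simp add: power2_eq_square)
  ultimately show ?thesis unfolding J_def by linarith
qed

definition energy :: "real \<Rightarrow> real \<Rightarrow> real" where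
  "energy t L = integral {- L..L} (\<lambda>x. (u t x)\<^sup>2 + (ux t x)\<^sup>2)"

lemma energy_derivative:
  assumes t: "t \<in> {0..T}" and L: "0 \<le> L"
  shows "((\<lambda>t'. energy t' L) has_real_derivative J t L - J t (- L)) (at t within {0..T})"
proof -
  let ?g = "\<lambda>x. 2 * u t x * v t x + 2 * ux t x * vx t x"
  obtain B where "\<And>t x. t \<in> {0..T} \<Longrightarrow> \<bar>u t x\<bar> \<le> B" "\<And>t x. t \<in> {0..T} \<Longrightarrow> \<bar>ux t x\<bar> \<le> B"
    "\<And>t x. t \<in> {0..T} \<Longrightarrow> \<bar>uxx t x\<bar> \<le> B"
    using bounded_u by blast
  note B = this[OF t]
  obtain B' where B': "\<And>x. \<bar>v t x\<bar> \<le> B' \<and> \<bar>vx t x\<bar> \<le> B'"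
    using bounded_v[OF t] by blast
  have bd: "\<bar>u t x\<bar> \<le> max B B'" "\<bar>ux t x\<bar> \<le> max B B'" "\<bar>v t x\<bar> \<le> max B B'" "\<bar>vx t x\<bar> \<le> max B B'" for x
    using B B' by (auto simp: le_max_iff_disj)
  have "unif_deriv {0..T} {- L..L} t (\<lambda>t' x. integral {- L..x} (\<lambda>x. (u t' x)\<^sup>2 + (ux t' x)\<^sup>2)) (\<lambda>x. integral {- L..x} ?g)"
  proof (rule unif_deriv_integral[OF unif_deriv_mono t])
    show "unif_deriv {0..T} UNIV t (\<lambda>t' x. (u t' x)\<^sup>2 + (ux t' x)\<^sup>2) ?g"
      by (intro unif_deriv_add unif_deriv_square[where B = "max B B'"] u_t ux_t t bd)
  qed (auto intro!: continuous_intros continuous_fields t)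
  from unif_deriv_pointwise[OF this, of L] L
  have "((\<lambda>t'. energy t' L) has_real_derivative integral {- L..L} ?g) (at t within {0..T})"
    by (simp add: energy_def)
  moreover have "(?g has_integral J t L - J t (- L)) {- L..L}"
  proof (rule has_integral_DERIV)
    show "(J t has_real_derivative ?g x) (at x)" for x
      unfolding J_def[abs_def]
      by (rule derivative_eq_intros du dux flux_derivative t refl
          | simp add: F_def S_def m_def power2_eq_square algebra_simps)+
  qed (use L in simp)
  ultimately show ?thesis by (simp add: integral_unique)
qed

lemma energy_flux_tendsto_0:
  assumes t: "t \<in> {0..T}" and X: "filterlim (\<lambda>n. \<bar>X n\<bar>) at_top sequentially"
  shows "(\<lambda>n. J t (X n)) \<longlonglongrightarrow> 0"
proof (rule Lim_null_comparison[OF always_eventually])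
  have "(\<lambda>n. 27 * integral {X n..X n + 1} (\<lambda>y. (u t y)\<^sup>2)) \<longlonglongrightarrow> 27 * 0"
    by (intro tendsto_mult tendsto_const integral_unit_interval_tendsto_0 u_L2 t X)
  then show "(\<lambda>n. 27 * integral {X n..X n + 1} (\<lambda>y. (u t y)\<^sup>2)) \<longlonglongrightarrow> 0" by simp
  show "\<forall>n. norm (J t (X n)) \<le> 27 * integral {X n..X n + 1} (\<lambda>y. (u t y)\<^sup>2)"
  proof
    fix n
    show "norm (J t (X n)) \<le> 27 * integral {X n..X n + 1} (\<lambda>y. (u t y)\<^sup>2)"
      using energy_flux_bound[OF t, of "X n"] square_le_local_integral[OF t, of "X n"] by simp
  qed
qed

text \<open>The energy in a window changes only through J at its two ends. These fluxes are bounded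
  and vanish pointwise in time as the window grows, so dominated convergence in time gives energy
  conservation without differentiating an integral over the whole line.\<close>

lemma energy_difference_tendsto_0:
  assumes t: "t \<in> {0..T}"
  shows "(\<lambda>n. energy t (real n) - energy 0 (real n)) \<longlonglongrightarrow> 0"
proof -
  obtain B where B: "\<And>t x. t \<in> {0..T} \<Longrightarrow> \<bar>u t x\<bar> \<le> B" using bounded_u by blast
  have hi: "((\<lambda>t'. J t' (real n) - J t' (- real n)) has_integral energy t (real n) - energy 0 (real n)) {0..t}" for n
  proof (rule fundamental_theorem_of_calculus)
    fix s assume "s \<in> {0..t}"
    then show "((\<lambda>t'. energy t' (real n)) has_vector_derivative J s (real n) - J s (- real n)) (at s within {0..t})"
      using has_field_derivative_subset[OF energy_derivative[of s "real n"], of "{0..t}"] t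
      by (simp add: has_real_derivative_iff_has_vector_derivative)
  qed (use t in simp)
  have "(\<lambda>n. integral {0..t} (\<lambda>t'. J t' (real n) - J t' (- real n))) \<longlonglongrightarrow> integral {0..t} (\<lambda>_. 0)"
  proof (rule dominated_convergence(2))
    show "(\<lambda>t'. J t' (real n) - J t' (- real n)) integrable_on {0..t}" for n using hi by blast
    show "(\<lambda>_. 6 * B\<^sup>2) integrable_on {0..t}" by (intro integrable_const_ivl)
    show "norm (J s (real n) - J s (- real n)) \<le> 6 * B\<^sup>2" if s: "s \<in> {0..t}" for s n
    proof -
      have s': "s \<in> {0..T}" using s t by simp
      have "(u s x)\<^sup>2 \<le> B\<^sup>2" for x
      proof (rule abs_le_square_iff[THEN iffD1])
        have "\<bar>u s x\<bar> \<le> B" by (rule B[OF s'])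
        then show "\<bar>u s x\<bar> \<le> \<bar>B\<bar>" by linarith
      qed
      then have "3 * (u s x)\<^sup>2 \<le> 3 * B\<^sup>2" for x
        by (intro mult_left_mono) auto
      then have "\<bar>J s x\<bar> \<le> 3 * B\<^sup>2" for x
        by (rule order_trans[OF energy_flux_bound[OF s']])
      from this[of "real n"] this[of "- real n"] show ?thesis by simp
    qed
    show "(\<lambda>n. J s (real n) - J s (- real n)) \<longlonglongrightarrow> 0" if s: "s \<in> {0..t}" for s
    proof -
      have s': "s \<in> {0..T}" using s t by simp
      have "(\<lambda>n. J s (real n) - J s (- real n)) \<longlonglongrightarrow> 0 - 0"
        by (intro tendsto_diff energy_flux_tendsto_0 s') (simp_all add: filterlim_real_sequentially)
      then show ?thesis by simp
    qed
  qed
  then show ?thesis unfolding integral_unique[OF hi] by simp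
qed

text \<open>The factor 18 = 9 * 2 consists of the 9 from the local bound and a 2 because |u_x| \<le>
  u makes the initial energy at most twice the integral of u_0^2.\<close>

lemma u_square_bound:
  assumes t: "t \<in> {0..T}" shows "(u t x)\<^sup>2 \<le> 18 * (LBINT y. (u 0 y)\<^sup>2)"
proof -
  have 0: "0 \<in> {0..T}" using T by simp
  let ?E = "2 * (LBINT y. (u 0 y)\<^sup>2)"
  have E0: "energy 0 L \<le> ?E" for L
  proof -
    have "energy 0 L \<le> integral {- L..L} (\<lambda>y. 2 * (u 0 y)\<^sup>2)"
      unfolding energy_def
    proof (rule integral_le)
      show "(u 0 y)\<^sup>2 + (ux 0 y)\<^sup>2 \<le> 2 * (u 0 y)\<^sup>2" for y
        using abs_le_square_iff[of "ux 0 y" "u 0 y"] abs_ux_le[OF 0, of y] by linarith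
    qed (auto intro!: continuous_rules 0)
    also have "\<dots> \<le> (LBINT y. 2 * (u 0 y)\<^sup>2)"
      by (rule integral_interval_le_lborel) (use u_L2[OF 0] in auto)
    finally show ?thesis by simp
  qed
  have "(\<lambda>n. 9 * (?E + (energy t (real n) - energy 0 (real n)))) \<longlonglongrightarrow> 9 * (?E + 0)"
    by (intro tendsto_mult tendsto_add tendsto_const energy_difference_tendsto_0 t)
  then have "(u t x)\<^sup>2 \<le> 9 * (?E + 0)"
  proof (rule LIMSEQ_le_const)
    show "\<exists>N. \<forall>n\<ge>N. (u t x)\<^sup>2 \<le> 9 * (?E + (energy t (real n) - energy 0 (real n)))"
    proof (intro exI allI impI)
      fix n assume "nat \<lceil>\<bar>x\<bar> + 1\<rceil> \<le> n"
      then have n: "\<bar>x\<bar> + 1 \<le> real n" by linarith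
      have "integral {x..x + 1} (\<lambda>y. (u t y)\<^sup>2) \<le> integral {x..x + 1} (\<lambda>y. (u t y)\<^sup>2 + (ux t y)\<^sup>2)"
        by (rule integral_le) (auto intro!: continuous_rules t)
      also have "\<dots> \<le> energy t (real n)"
        unfolding energy_def
        by (rule integral_subset_le)
           (use n in \<open>auto intro!: continuous_rules t\<close>)
      finally have "integral {x..x + 1} (\<lambda>y. (u t y)\<^sup>2) \<le> energy t (real n)" .
      then show "(u t x)\<^sup>2 \<le> 9 * (?E + (energy t (real n) - energy 0 (real n)))"
        using square_le_local_integral[OF t, of x] E0[of "real n"] by (simp add: algebra_simps)
    qed
  qed
  then show ?thesis by simp
qed

text \<open>N depends on u and u_x only, and both have material derivatives. These are at most 2
  P^3, so u^2 - u_x^2 changes at a rate of at most 8 P^4; the sine term, multiplied by |u_x| \<le>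
  P, contributes 8 P^5 and the cosine term 2 P^3.\<close>

lemma N_growth:
  assumes P: "\<And>t x. t \<in> {0..T} \<Longrightarrow> u t x \<le> P" and t: "t \<in> {0..T}"
  shows "N t (q t x) \<le> N 0 x + (8 * P ^ 5 + 2 * P ^ 3) * t"
proof -
  let ?C = "8 * P ^ 5 + 2 * P ^ 3"
  let ?u' = "\<lambda>s y. v s y + ux s y * S s y" and ?ux' = "\<lambda>s y. vx s y + uxx s y * S s y"
  let ?A = "\<lambda>s y. (u s y)\<^sup>2 - (ux s y)\<^sup>2"
  let ?N' = "\<lambda>s y. - sin (?A s y) * (2 * u s y * ?u' s y - 2 * ux s y * ?ux' s y) * ux s y + cos (?A s y) * ?ux' s y"
  have dN: "((\<lambda>s. N s (q s x)) has_real_derivative ?N' s (q s x)) (at s within {0..T})" if s: "s \<in> {0..T}" for s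
  proof -
    have "((\<lambda>s. u s (q s x)) has_real_derivative ?u' s (q s x)) (at s within {0..T})"
      by (rule material_derivative[OF u_t[OF s] dq'[OF s]]) (use isCont_fields[OF s] du[OF s] in auto)
    moreover have "((\<lambda>s. ux s (q s x)) has_real_derivative ?ux' s (q s x)) (at s within {0..T})"
      by (rule material_derivative[OF ux_t[OF s] dq'[OF s]]) (use isCont_fields[OF s] dux[OF s] in auto)
    ultimately show ?thesis
      unfolding N_def
      by - (rule derivative_eq_intros refl | assumption | simp add: power2_eq_square algebra_simps)+
  qed
  have bd: "?N' s y \<le> ?C" if s: "s \<in> {0..T}" for s y
  proof -
    have u: "0 \<le> u s y" "u s y \<le> P" for y using u_nonneg[OF s] P[OF s] by auto
    have P0: "0 \<le> P" using u[of 0] by linarith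
    have sq: "\<bar>?A s y\<bar> \<le> P\<^sup>2" for y
    proof -
      have "(ux s y)\<^sup>2 \<le> (u s y)\<^sup>2"
        using abs_ux_le[OF s, of y] by (intro abs_le_square_iff[THEN iffD1]) linarith
      moreover have "(u s y)\<^sup>2 \<le> P\<^sup>2" using u[of y] by (intro power_mono) auto
      moreover have "0 \<le> (ux s y)\<^sup>2" "0 \<le> (u s y)\<^sup>2" by simp_all
      ultimately show ?thesis by linarith
    qed
    \<comment> \<open>Estimating the sine by its argument, instead of by 1, allows k = P^2 in the
      flux bounds; F and v become cubic in P.\<close>
    have S: "\<bar>S s y\<bar> \<le> P\<^sup>2" for y
      unfolding S_def using sq[of y] abs_sin_x_le_abs_x[of "?A s y"] by linarith
    have F: "\<bar>F s y\<bar> \<le> P\<^sup>2 * P" "\<bar>v s y\<bar> \<le> P\<^sup>2 * P"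
      using flux_bounds[OF s S, of y] mult_left_mono[OF u(2)[of y], of "P\<^sup>2"] by auto
    have ux: "\<bar>ux s y\<bar> \<le> P" using abs_ux_le[OF s, of y] u[of y] by linarith
    have "\<bar>ux s y * S s y\<bar> \<le> P * P\<^sup>2" "\<bar>u s y * S s y\<bar> \<le> P * P\<^sup>2"
      unfolding abs_mult using ux u[of y] S P0 by (intro mult_mono; simp)+
    \<comment> \<open>The decisive cancellation: vx contains S m and the transport term contributes
      S u_xx, which together leave S u. No bound on m is needed for the growth of N.\<close>
    moreover have "?ux' s y = F s y + u s y * S s y" by (simp add: F_def m_def algebra_simps)
    ultimately have u': "\<bar>?u' s y\<bar> \<le> 2 * P ^ 3" "\<bar>?ux' s y\<bar> \<le> 2 * P ^ 3"
      using F by (auto simp: power2_eq_square power3_eq_cube abs_le_iff mult.assoc)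
    have "\<bar>2 * u s y * ?u' s y\<bar> \<le> 2 * P * (2 * P ^ 3)" "\<bar>2 * ux s y * ?ux' s y\<bar> \<le> 2 * P * (2 * P ^ 3)"
      unfolding abs_mult using ux u[of y] u' P0 by (intro mult_mono; simp)+
    then have "\<bar>2 * u s y * ?u' s y - 2 * ux s y * ?ux' s y\<bar> \<le> 8 * P ^ 4"
      by (simp add: abs_le_iff power_numeral_reduce algebra_simps)
    then have "\<bar>- sin (?A s y) * (2 * u s y * ?u' s y - 2 * ux s y * ?ux' s y)\<bar> \<le> 1 * (8 * P ^ 4)"
      unfolding abs_mult by (intro mult_mono) auto
    then have "\<bar>- sin (?A s y) * (2 * u s y * ?u' s y - 2 * ux s y * ?ux' s y) * ux s y\<bar> \<le> (1 * (8 * P ^ 4)) * P"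
      unfolding abs_mult[of _ "ux s y"] using ux P0 by (intro mult_mono) auto
    moreover have "\<bar>cos (?A s y) * ?ux' s y\<bar> \<le> 1 * (2 * P ^ 3)"
      unfolding abs_mult using u' by (intro mult_mono) auto
    moreover have "(1 * (8 * P ^ 4)) * P = 8 * P ^ 5" by (simp add: power_numeral_reduce)
    ultimately show ?thesis by linarith
  qed
  have "N t (q t x) - ?C * t \<le> N 0 (q 0 x) - ?C * 0"
  proof (rule DERIV_within_nonincreasing[where f = "\<lambda>s. N s (q s x) - ?C * s"])
    show "((\<lambda>s. N s (q s x) - ?C * s) has_real_derivative ?N' s (q s x) - ?C * 1) (at s within {0..t})"
      if "s \<in> {0..t}" for s
      using that t by (intro DERIV_diff DERIV_cmult DERIV_ident has_field_derivative_subset[OF dN]) auto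
    show "?N' s (q s x) - ?C * 1 \<le> 0" if "s \<in> {0..t}" for s
      using bd[of s "q s x"] that t by simp
  qed (use t in simp)
  then show ?thesis by (simp add: q0)
qed

text \<open>The distance between two characteristics divided by the conserved mass between them replaces the
  reciprocal momentum along a characteristic, so that no derivative of the momentum is needed.\<close>
lemma characteristic_gap:
  assumes P: "\<And>t x. t \<in> {0..T} \<Longrightarrow> u t x \<le> P" and t: "t \<in> {0..T}" and h: "0 < h"
    and N: "\<And>x. x \<in> {x0..x0 + h} \<Longrightarrow> N 0 x \<le> n"
  shows "0 < h + (2 * n * t + (8 * P ^ 5 + 2 * P ^ 3) * t\<^sup>2) * integral {x0..x0 + h} (m 0)"
proof -
  let ?C = "8 * P ^ 5 + 2 * P ^ 3" and ?\<mu> = "integral {x0..x0 + h} (m 0)"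
  let ?\<delta> = "\<lambda>s. q s (x0 + h) - q s x0"
  have d: "(?\<delta> has_real_derivative S s (q s (x0 + h)) - S s (q s x0)) (at s within {0..t})" if "s \<in> {0..t}" for s
    using that t by (intro DERIV_diff has_field_derivative_subset[OF dq']) auto
  have le: "S s (q s (x0 + h)) - S s (q s x0) \<le> 2 * (n + ?C * s) * ?\<mu>" if "s \<in> {0..t}" for s
  proof -
    have s: "s \<in> {0..T}" using that t by simp
    have ord: "q s x0 \<le> q s (x0 + h)" using characteristic_mono[OF s] h by simp
    have "((\<lambda>y. 2 * N s y * m s y) has_integral S s (q s (x0 + h)) - S s (q s x0)) {q s x0..q s (x0 + h)}"
      by (rule has_integral_DERIV[OF dS[OF s] ord])
    then have "S s (q s (x0 + h)) - S s (q s x0) = integral {q s x0..q s (x0 + h)} (\<lambda>y. 2 * N s y * m s y)"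
      by (simp add: integral_unique)
    also have "\<dots> \<le> integral {q s x0..q s (x0 + h)} (\<lambda>y. 2 * (n + ?C * s) * m s y)"
    proof (rule integral_le)
      fix y assume y: "y \<in> {q s x0..q s (x0 + h)}"
      \<comment> \<open>Every point between the two characteristics lies on one that started in
        [x0, x0 + h], where the initial bound on N holds.\<close>
      obtain x where x: "q s x = y" using characteristic_surj[OF s] by blast
      have "x \<in> {x0..x0 + h}"
        using characteristic_strict_mono[OF s, of x x0] characteristic_strict_mono[OF s, of "x0 + h" x] x y by force
      then have "N s y \<le> n + ?C * s" using N_growth[OF P s, of x] N[of x] x by auto
      then show "2 * N s y * m s y \<le> 2 * (n + ?C * s) * m s y"
        using m_nonneg[OF s, of y] by (intro mult_right_mono) auto
    qed (auto intro!: continuous_rules s)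
    also have "\<dots> = 2 * (n + ?C * s) * integral {q s x0..q s (x0 + h)} (m s)"
      by simp
    also have "integral {q s x0..q s (x0 + h)} (m s) = ?\<mu>"
      using h by (intro mass_conserved s) auto
    finally show ?thesis .
  qed
  have "?\<delta> t - (2 * n * t + ?C * t\<^sup>2) * ?\<mu> \<le> ?\<delta> 0 - (2 * n * 0 + ?C * 0\<^sup>2) * ?\<mu>"
  proof (rule DERIV_within_nonincreasing[where f = "\<lambda>s. ?\<delta> s - (2 * n * s + ?C * s\<^sup>2) * ?\<mu>"])
    show "((\<lambda>s. ?\<delta> s - (2 * n * s + ?C * s\<^sup>2) * ?\<mu>) has_real_derivative
       (S s (q s (x0 + h)) - S s (q s x0)) - 2 * (n + ?C * s) * ?\<mu>) (at s within {0..t})" if "s \<in> {0..t}" for s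
    proof (rule DERIV_diff[OF d[OF that]])
      show "((\<lambda>s. (2 * n * s + ?C * s\<^sup>2) * ?\<mu>) has_real_derivative 2 * (n + ?C * s) * ?\<mu>) (at s within {0..t})"
        by (rule derivative_eq_intros refl | simp add: algebra_simps)+
    qed
    show "(S s (q s (x0 + h)) - S s (q s x0)) - 2 * (n + ?C * s) * ?\<mu> \<le> 0" if "s \<in> {0..t}" for s
      using le[OF that] by simp
  qed (use t in simp)
  moreover have "0 < ?\<delta> t" using characteristic_strict_mono[OF t, of x0 "x0 + h"] h by simp
  ultimately show ?thesis by (simp add: q0)
qed

text \<open>This is the gap estimate divided by the mass, as h tends to 0. The limit is replaced by
  a contradiction: a strictly negative right-hand side stays negative under small changes of m_0 and
  N_0, hence on a short interval next to x0.\<close>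

lemma reciprocal_momentum_bound:
  assumes P: "\<And>t x. t \<in> {0..T} \<Longrightarrow> u t x \<le> P" and t: "t \<in> {0..T}" and m: "0 < m 0 x0"
  shows "0 \<le> 1 / m 0 x0 + 2 * N 0 x0 * t + (8 * P ^ 5 + 2 * P ^ 3) * t\<^sup>2"
proof (rule ccontr)
  let ?C = "8 * P ^ 5 + 2 * P ^ 3"
  have 0: "0 \<in> {0..T}" using T by simp
  assume "\<not> ?thesis"
  then have neg: "1 / m 0 x0 + (2 * N 0 x0 * t + ?C * t\<^sup>2) < 0" by simp
  \<comment> \<open>The margin e is taken off m_0 and added to N_0, the unfavourable direction for
    both, while the expression stays negative.\<close>
  obtain e where e: "e > 0" "e < m 0 x0" "1 / (m 0 x0 - e) + (2 * (N 0 x0 + e) * t + ?C * t\<^sup>2) < 0"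
  proof -
    have "((\<lambda>e. 1 / (m 0 x0 - e) + (2 * (N 0 x0 + e) * t + ?C * t\<^sup>2)) \<longlongrightarrow>
        1 / (m 0 x0 - 0) + (2 * (N 0 x0 + 0) * t + ?C * t\<^sup>2)) (at_right 0)"
      using m by (intro tendsto_add tendsto_mult tendsto_divide tendsto_diff tendsto_const tendsto_ident_at) auto
    then have "\<forall>\<^sub>F e in at_right 0. 1 / (m 0 x0 - e) + (2 * (N 0 x0 + e) * t + ?C * t\<^sup>2) < 0"
      using neg by (intro order_tendstoD(2)) auto
    moreover have "\<forall>\<^sub>F e in at_right 0. 0 < e \<and> e < m 0 x0"
      using m by (auto simp: eventually_at_right_field)
    ultimately have "\<forall>\<^sub>F e in at_right 0. (0 < e \<and> e < m 0 x0) \<and>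
        1 / (m 0 x0 - e) + (2 * (N 0 x0 + e) * t + ?C * t\<^sup>2) < 0"
      by eventually_elim simp
    then obtain e where "(0 < e \<and> e < m 0 x0) \<and> 1 / (m 0 x0 - e) + (2 * (N 0 x0 + e) * t + ?C * t\<^sup>2) < 0"
      using eventually_happens'[OF trivial_limit_at_right_real] by blast
    then show thesis using that by blast
  qed
  obtain d where d: "d > 0" "\<And>x. \<bar>x - x0\<bar> < d \<Longrightarrow> m 0 x0 - e \<le> m 0 x \<and> N 0 x \<le> N 0 x0 + e"
  proof -
    obtain d1 where d1: "d1 > 0" "\<And>x. \<bar>x - x0\<bar> < d1 \<Longrightarrow> \<bar>m 0 x - m 0 x0\<bar> < e"
      using isCont_fields(6)[OF 0, of x0] e(1) unfolding continuous_at_eps_delta dist_real_def by blast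
    obtain d2 where d2: "d2 > 0" "\<And>x. \<bar>x - x0\<bar> < d2 \<Longrightarrow> \<bar>N 0 x - N 0 x0\<bar> < e"
      using isCont_fields(8)[OF 0, of x0] e(1) unfolding continuous_at_eps_delta dist_real_def by blast
    show thesis
    proof (rule that[of "min d1 d2"])
      show "m 0 x0 - e \<le> m 0 x \<and> N 0 x \<le> N 0 x0 + e" if "\<bar>x - x0\<bar> < min d1 d2" for x
        using d1(2)[of x] d2(2)[of x] that by auto
    qed (use d1 d2 in simp)
  qed
  define h where "h = d / 2"
  have h: "0 < h" using d by (simp add: h_def)
  have near: "m 0 x0 - e \<le> m 0 x \<and> N 0 x \<le> N 0 x0 + e" if "x \<in> {x0..x0 + h}" for x
    using d that by (auto simp: h_def)
  let ?c = "2 * (N 0 x0 + e) * t + ?C * t\<^sup>2" and ?\<mu> = "integral {x0..x0 + h} (m 0)"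
  have "0 < h + ?c * ?\<mu>"
    by (rule characteristic_gap[OF P t h]) (use near in auto)
  moreover have "integral {x0..x0 + h} (\<lambda>_. m 0 x0 - e) \<le> ?\<mu>"
    using near by (intro integral_le) (auto intro!: continuous_rules 0)
  then have mu: "h * (m 0 x0 - e) \<le> ?\<mu>" using h by simp
  moreover have "0 < 1 / (m 0 x0 - e)" using e by simp
  then have "?c < 0" using e(3) by linarith
  \<comment> \<open>Since \<open>?c\<close> is negative, the lower bound for the mass gives an upper
    bound for the product.\<close>
  then have "?c * ?\<mu> \<le> ?c * (h * (m 0 x0 - e))"
    using mu by (intro mult_left_mono_neg) auto
  ultimately have "0 < h * (1 + ?c * (m 0 x0 - e))" by (simp add: algebra_simps)
  then have "0 < 1 + ?c * (m 0 x0 - e)" using h by (simp add: zero_less_mult_iff)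
  moreover have "(1 / (m 0 x0 - e) + ?c) * (m 0 x0 - e) < 0"
    using e by (intro mult_neg_pos) auto
  then have "1 + ?c * (m 0 x0 - e) < 0" using e(2) by (simp add: distrib_right)
  ultimately show False by simp
qed

end

section \<open>Strong solutions\<close>

text \<open>Compactness in time. The bound at t itself is a separate hypothesis because the filter
  \<open>at t within K\<close> leaves t out.\<close>

lemma bounded_of_locally_bounded:
  fixes f :: "real \<Rightarrow> real \<Rightarrow> real"
  assumes K: "compact K"
    and loc: "\<And>t. t \<in> K \<Longrightarrow> \<exists>B. \<forall>\<^sub>F t' in at t within K. \<forall>x. \<bar>f t' x\<bar> \<le> B"
    and bd: "\<And>t. t \<in> K \<Longrightarrow> \<exists>B. \<forall>x. \<bar>f t x\<bar> \<le> B"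
  shows "\<exists>B. \<forall>t\<in>K. \<forall>x. \<bar>f t x\<bar> \<le> B"
proof -
  \<comment> \<open>The pair consists of an open neighbourhood and the bound valid on it, to be
    chosen together.\<close>
  have "\<forall>t\<in>K. \<exists>p. open (fst p) \<and> t \<in> fst p \<and> (\<forall>t'\<in>fst p \<inter> K. \<forall>x. \<bar>f t' x\<bar> \<le> snd p)"
  proof
    fix t assume t: "t \<in> K"
    obtain B1 U where 1: "open U" "t \<in> U" "\<And>t' x. t' \<in> U \<Longrightarrow> t' \<noteq> t \<Longrightarrow> t' \<in> K \<Longrightarrow> \<bar>f t' x\<bar> \<le> B1"
      using loc[OF t] unfolding eventually_at_topological by blast
    obtain B2 where 2: "\<And>x. \<bar>f t x\<bar> \<le> B2" using bd[OF t] by blast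
    have "\<bar>f t' x\<bar> \<le> max B1 B2" if "t' \<in> U \<inter> K" for t' x
      using 1(3)[of t' x] 2[of x] that by (cases "t' = t") auto
    then show "\<exists>p. open (fst p) \<and> t \<in> fst p \<and> (\<forall>t'\<in>fst p \<inter> K. \<forall>x. \<bar>f t' x\<bar> \<le> snd p)"
      using 1(1,2) by (intro exI[of _ "(U, max B1 B2)"]) auto
  qed
  then obtain p where p: "\<And>t. t \<in> K \<Longrightarrow> open (fst (p t))" "\<And>t. t \<in> K \<Longrightarrow> t \<in> fst (p t)"
    "\<And>t t' x. t \<in> K \<Longrightarrow> t' \<in> fst (p t) \<Longrightarrow> t' \<in> K \<Longrightarrow> \<bar>f t' x\<bar> \<le> snd (p t)"
    by (metis IntI)
  obtain D where D: "D \<subseteq> K" "finite D" "K \<subseteq> (\<Union>t\<in>D. fst (p t))"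
    by (rule compactE_image[OF K, of K "\<lambda>t. fst (p t)"]) (use p in auto)
  have "\<bar>f t' x\<bar> \<le> (\<Sum>t\<in>D. \<bar>snd (p t)\<bar>)" if t': "t' \<in> K" for t' x
  proof -
    obtain t where t: "t \<in> D" "t' \<in> fst (p t)" using D t' by blast
    have "\<bar>f t' x\<bar> \<le> snd (p t)" using p(3) t D t' by blast
    also have "\<dots> \<le> \<bar>snd (p t)\<bar>" by simp
    also have "\<dots> \<le> (\<Sum>t\<in>D. \<bar>snd (p t)\<bar>)"
      by (rule member_le_sum[OF t(1) _ D(2)]) simp
    finally show ?thesis .
  qed
  then show ?thesis by blast
qed

lemma sobolev_C0_bounded:
  assumes u: "sobolev_C0 r {a..b} u" and r: "r > real j + 1/2"
  shows "\<exists>B. \<forall>t\<in>{a..b}. \<forall>x. \<bar>fourier_deriv j (u t) x\<bar> \<le> B"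
proof (rule bounded_of_locally_bounded)
  fix t assume t: "t \<in> {a..b}"
  have W: "fourier (u t) \<in> weighted_L2 r"
    using u t by (auto simp: sobolev_C0_def intro: in_sobolev_fourier)
  define B where "B = embedding_const r j * weighted_norm r (fourier (u t))"
  have B: "\<bar>fourier_deriv j (u t) x\<bar> \<le> B" for x
    unfolding B_def by (rule abs_inv_ft_deriv_le[OF W r])
  then show "\<exists>B. \<forall>x. \<bar>fourier_deriv j (u t) x\<bar> \<le> B" by blast
  have "\<forall>\<^sub>F t' in at t within {a..b}. \<forall>x. \<bar>fourier_deriv j (u t') x\<bar> \<le> B + 1"
    using sobolev_C0_uniform[OF u r t zero_less_one]
  proof eventually_elim
    case (elim t')
    show ?case
    proof
      fix x
      show "\<bar>fourier_deriv j (u t') x\<bar> \<le> B + 1"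
        using spec[OF elim, of x] B[of x] by linarith
    qed
  qed
  then show "\<exists>B. \<forall>\<^sub>F t' in at t within {a..b}. \<forall>x. \<bar>fourier_deriv j (u t') x\<bar> \<le> B" by blast
qed simp

text \<open>Sobolev thresholds: s + 2 > 5/2 makes u, u_x and u_xx continuous and bounded, while s +
  1 > 3/2 suffices for uniform time derivatives of u and u_x, but not of u_xx.\<close>

lemma strong_solution_wave_flow:
  assumes sol: "strong_solution s m0 T u" and s: "s > 1/2" and T: "0 < T"
    and m0: "\<And>x. 0 \<le> m0 x" and q0: "\<And>x. q 0 x = x"
    and q: "\<And>t x. t \<in> {0..T} \<Longrightarrow>
       ((\<lambda>t'. q t' x) has_real_derivative velocity (u t) (q t x)) (at t within {0..T})"
  obtains v vx where "wave_flow T u (\<lambda>t. deriv (u t)) (\<lambda>t. deriv (deriv (u t))) v vx q"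
proof -
  let ?I = "{0..T}"
  have uc: "\<And>t. t \<in> ?I \<Longrightarrow> continuous_on UNIV (u t)" and C0: "sobolev_C0 (s + 2) ?I u"
    and C1: "sobolev_C1 (s + 1) ?I u"
    and weak: "\<And>t \<phi>. t \<in> ?I \<Longrightarrow> test_function \<phi> \<Longrightarrow>
        ((\<lambda>t'. LBINT x. momentum (u t') x * \<phi> x) has_real_derivative
           (LBINT x. velocity (u t) x * momentum (u t) x * deriv \<phi> x)) (at t within ?I)"
    and init: "\<And>x. momentum (u 0) x = m0 x"
    using sol unfolding strong_solution_def by blast+
  have us: "in_sobolev (s + 2) (u t)" if "t \<in> ?I" for t
    using C0 that by (simp add: sobolev_C0_def)
  obtain w where w: "\<And>t. t \<in> ?I \<Longrightarrow> w t \<in> weighted_L2 (s + 1)"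
    and wd: "\<And>t e j. \<lbrakk>t \<in> ?I; e > 0; s + 1 > real j + 1/2\<rbrakk> \<Longrightarrow> \<forall>\<^sub>F t' in at t within ?I. \<forall>x.
       \<bar>fourier_deriv j (u t') x - fourier_deriv j (u t) x
          - (t' - t) * inv_ft_deriv j (w t) x\<bar> \<le> e * \<bar>t' - t\<bar>"
    using sobolev_C1_uniform[OF C1] by blast
  let ?v = "\<lambda>t. inv_ft_deriv 0 (w t)" and ?vx = "\<lambda>t. inv_ft_deriv 1 (w t)"
  have u0: "u t = fourier_deriv 0 (u t)" and u1: "deriv (u t) = fourier_deriv 1 (u t)"
    and u2: "deriv (deriv (u t)) = fourier_deriv 2 (u t)" if "t \<in> ?I" for t
    using in_sobolev_inversion[OF us[OF that] uc[OF that]] in_sobolev_C2[OF us[OF that] uc[OF that]] s by simp_all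
  have unif: "unif_deriv ?I UNIV t f (inv_ft_deriv j (w t))"
    if t: "t \<in> ?I" and j: "j \<le> 1" and f: "\<And>t. t \<in> ?I \<Longrightarrow> f t = fourier_deriv j (u t)" for t f j
    unfolding unif_deriv_def
  proof (intro allI impI)
    fix e :: real assume e: "0 < e"
    have "\<forall>\<^sub>F t' in at t within ?I. t' \<in> ?I" by (simp add: eventually_at_filter)
    moreover have "s + 1 > real j + 1/2" using j s by simp
    note wd[OF t e this]
    ultimately show "\<forall>\<^sub>F t' in at t within ?I. \<forall>x\<in>UNIV. \<bar>f t' x - f t x - (t' - t) * inv_ft_deriv j (w t) x\<bar> \<le> e * \<bar>t' - t\<bar>"
      by eventually_elim (use f t in simp)
  qed
  have "wave_flow T u (\<lambda>t. deriv (u t)) (\<lambda>t. deriv (deriv (u t))) ?v ?vx q"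
  proof
    fix t x assume t: "t \<in> ?I"
    have s2: "s + 2 > 5/2" using s by simp
    show "(u t has_real_derivative deriv (u t) x) (at x)"
      "(deriv (u t) has_real_derivative deriv (deriv (u t)) x) (at x)" "isCont (deriv (deriv (u t))) x"
      using in_sobolev_C2[OF us[OF t] uc[OF t] s2] by blast+
    show "(?v t has_real_derivative ?vx t x) (at x)"
      using inv_ft_deriv_has_derivative[OF w[OF t], of 0 x] s by simp
    show "isCont (?vx t) x"
      using isCont_inv_ft_deriv[OF w[OF t], of 1 x] s by simp
    show "unif_deriv ?I UNIV t u (?v t)"
      using unif[OF t, of 0 u] u0 by simp
    show "unif_deriv ?I UNIV t (\<lambda>t. deriv (u t)) (?vx t)"
      using unif[OF t, of 1 "\<lambda>t. deriv (u t)"] u1 by simp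
    show "\<exists>B. \<forall>x. \<bar>?v t x\<bar> \<le> B \<and> \<bar>?vx t x\<bar> \<le> B"
    proof -
      let ?K = "\<lambda>j. embedding_const (s + 1) j * weighted_norm (s + 1) (w t)"
      have "\<bar>?v t x\<bar> \<le> ?K 0"
        "\<bar>?vx t x\<bar> \<le> ?K 1" for x
        using abs_inv_ft_deriv_le[OF w[OF t]] s by simp_all
      then show ?thesis
        by (intro exI[of _ "max (?K 0) (?K 1)"]) (auto simp: le_max_iff_disj)
    qed
    show "((\<lambda>t'. LBINT x. (u t' x - deriv (deriv (u t')) x) * \<phi> x) has_real_derivative
         (LBINT x. sin ((u t x)\<^sup>2 - (deriv (u t) x)\<^sup>2) * (u t x - deriv (deriv (u t)) x) * deriv \<phi> x)) (at t within ?I)"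
      if "test_function \<phi>" for \<phi>
      using weak[OF t that] by (simp add: momentum_def velocity_def)
    show "integrable lborel (\<lambda>x. (u t x)\<^sup>2)"
      using in_sobolev_fourier(1)[OF us[OF t]] by (simp add: L2_fourier_def)
    show "((\<lambda>t'. q t' x) has_real_derivative sin ((u t (q t x))\<^sup>2 - (deriv (u t) (q t x))\<^sup>2)) (at t within ?I)"
      using q[OF t, of x] by (simp add: velocity_def)
  next
    have "\<exists>B. \<forall>t\<in>?I. \<forall>x. \<bar>fourier_deriv j (u t) x\<bar> \<le> B" if "j \<le> 2" for j
      by (rule sobolev_C0_bounded[OF C0]) (use that s in simp)
    then obtain B where B: "\<And>j t x. j \<le> 2 \<Longrightarrow> t \<in> ?I \<Longrightarrow> \<bar>fourier_deriv j (u t) x\<bar> \<le> B j"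
      by metis
    show "\<exists>B. \<forall>t\<in>?I. \<forall>x. \<bar>u t x\<bar> \<le> B \<and> \<bar>deriv (u t) x\<bar> \<le> B \<and> \<bar>deriv (deriv (u t)) x\<bar> \<le> B"
    proof (intro exI ballI allI)
      fix t x assume t: "t \<in> ?I"
      show "\<bar>u t x\<bar> \<le> max (B 0) (max (B 1) (B 2)) \<and> \<bar>deriv (u t) x\<bar> \<le> max (B 0) (max (B 1) (B 2))
          \<and> \<bar>deriv (deriv (u t)) x\<bar> \<le> max (B 0) (max (B 1) (B 2))"
        using B[OF _ t, of 0 x] B[OF _ t, of 1 x] B[OF _ t, of 2 x] fun_cong[OF u0[OF t], of x]
        by (simp only: u2[OF t]) (auto simp: u1[OF t] le_max_iff_disj)
    qed
    show "0 \<le> u 0 x - deriv (deriv (u 0)) x" for x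
      using m0[of x] init[of x] by (simp add: momentum_def)
  qed (use T q0 in auto)
  then show thesis by (rule that)
qed

text \<open>The difference w satisfies w - w'' = 0 and is bounded together with w', so the
  comparison lemma makes both w and -w nonnegative. It identifies u(0) with u_0, since
  \<open>strong_solution\<close> prescribes only the initial momentum.\<close>

lemma momentum_determines:
  assumes f: "in_sobolev r f" "continuous_on UNIV f" and g: "in_sobolev r g" "continuous_on UNIV g"
    and r: "r > 5/2" and eq: "\<And>x. momentum f x = momentum g x"
  shows "f = g"
proof
  fix x
  have main: "\<bar>deriv a x - deriv b x\<bar> \<le> a x - b x"
    if a: "in_sobolev r a" "continuous_on UNIV a" and b: "in_sobolev r b" "continuous_on UNIV b"
      and e: "\<And>x. momentum a x = momentum b x" for a b
  proof -
    have bd: "\<exists>B. \<forall>x. \<bar>c x\<bar> \<le> B \<and> \<bar>deriv c x\<bar> \<le> B" if c: "in_sobolev r c" "continuous_on UNIV c" for c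
    proof -
      let ?K = "\<lambda>j. embedding_const r j * weighted_norm r (fourier c)"
      have c0: "c x = fourier_deriv 0 c x" for x
        by (rule fun_cong[OF in_sobolev_inversion[OF c]]) (use r in simp)
      have "\<bar>c x\<bar> \<le> ?K 0"
        "\<bar>deriv c x\<bar> \<le> ?K 1" for x
        using abs_inv_ft_deriv_le[OF in_sobolev_fourier(2)[OF c(1)], of 0 x]
          abs_inv_ft_deriv_le[OF in_sobolev_fourier(2)[OF c(1)], of 1 x]
          r c0[of x] in_sobolev_C2(3)[OF c r] by simp_all
      then show ?thesis
        by (intro exI[of _ "max (?K 0) (?K 1)"]) (auto simp: le_max_iff_disj)
    qed
    obtain A where A: "\<And>x. \<bar>a x\<bar> \<le> A \<and> \<bar>deriv a x\<bar> \<le> A" using bd[OF a] by blast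
    obtain B where B: "\<And>x. \<bar>b x\<bar> \<le> B \<and> \<bar>deriv b x\<bar> \<le> B" using bd[OF b] by blast
    show ?thesis
    proof (rule abs_deriv_le_of_supersolution[where w = "\<lambda>x. a x - b x" and w' = "\<lambda>x. deriv a x - deriv b x"
          and w'' = "\<lambda>x. deriv (deriv a) x - deriv (deriv b) x"])
      show "((\<lambda>x. a x - b x) has_real_derivative deriv a x - deriv b x) (at x)"
        "((\<lambda>x. deriv a x - deriv b x) has_real_derivative deriv (deriv a) x - deriv (deriv b) x) (at x)" for x
        by (intro DERIV_diff in_sobolev_C2[OF a r] in_sobolev_C2[OF b r])+
      show "0 \<le> a x - b x - (deriv (deriv a) x - deriv (deriv b) x)" for x
        using e[of x] by (simp add: momentum_def)
      show "\<bar>a x - b x\<bar> \<le> A + B" "\<bar>deriv a x - deriv b x\<bar> \<le> A + B" for x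
        using A[of x] B[of x] by linarith+
    qed
  qed
  show "f x = g x"
    using main[OF f g eq] main[OF g f eq[symmetric]] by linarith
qed

lemma strong_solution_initial:
  assumes sol: "strong_solution s m0 T u" and T: "0 \<le> T" and s: "s > 1/2"
    and u0: "continuous_on UNIV u0" "in_sobolev (s + 2) u0" "\<And>x. m0 x = momentum u0 x"
  shows "u 0 = u0"
proof (rule momentum_determines[of "s + 2"])
  have "0 \<in> {0..T}" using T by simp
  then show "in_sobolev (s + 2) (u 0)" "continuous_on UNIV (u 0)"
    using sol unfolding strong_solution_def sobolev_C0_def by blast+
  show "momentum (u 0) x = momentum u0 x" for x
    using sol u0(3)[of x] unfolding strong_solution_def by simp
qed (use u0 s in auto)

text \<open>Since 18 \<le> 5^2, P can be 5 times the H^1 norm of u_0; then 25000 = 8 * 5^5 also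
  dominates 2 * 5^3. Each t is treated with the solution on [0, t] alone, so no bound uniform up to
  \<open>Tstar\<close> is involved.\<close>

lemma strong_solution_reciprocal_momentum_bound:
  assumes s: "s > 1/2" and u0: "continuous_on UNIV u0" "in_sobolev (s + 2) u0"
    and m0: "\<And>x. m0 x = momentum u0 x" "\<And>x. 0 \<le> m0 x" "0 < m0 x0"
    and sol: "maximal_strong_solution s m0 Tstar u" and q: "characteristic_flow Tstar u q"
    and t: "0 < t" "ereal t < Tstar"
  shows "0 \<le> 1 / m0 x0 + 2 * (cos ((u0 x0)\<^sup>2 - (deriv u0 x0)\<^sup>2) * deriv u0 x0) * t
     + 25000 * (sobolev_norm 1 u0 ^ 5 + sobolev_norm 1 u0 ^ 3) * t\<^sup>2"
proof -
  let ?H = "sobolev_norm 1 u0"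
  have sol_t: "strong_solution s m0 t u" using sol t by (simp add: maximal_strong_solution_def)
  have sub: "{0..t} \<subseteq> {t'. 0 \<le> t' \<and> ereal t' < Tstar}"
    using t by (auto intro: le_less_trans[of "ereal _" "ereal t"])
  have q0: "q 0 x = x" for x using q by (simp add: characteristic_flow_def)
  have dq: "((\<lambda>t'. q t' x) has_real_derivative velocity (u t') (q t' x)) (at t' within {0..t})" if "t' \<in> {0..t}" for t' x
  proof -
    have "0 \<le> t'" "ereal t' < Tstar" using sub that by auto
    then show ?thesis
      using q sub unfolding characteristic_flow_def by (blast intro: has_field_derivative_subset)
  qed
  obtain v vx where "wave_flow t u (\<lambda>t. deriv (u t)) (\<lambda>t. deriv (deriv (u t))) v vx q"
    using strong_solution_wave_flow[OF sol_t s t(1) m0(2) q0 dq] by blast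
  then interpret wave_flow t u "\<lambda>t. deriv (u t)" "\<lambda>t. deriv (deriv (u t))" v vx q .
  have eq: "u 0 = u0"
    by (rule strong_solution_initial[OF sol_t _ s u0 m0(1)]) (use t in auto)
  have H0: "0 \<le> ?H" by (simp add: sobolev_norm_def)
  have P: "u t' x \<le> 5 * ?H" if t': "t' \<in> {0..t}" for t' x
  proof (rule power2_le_imp_le)
    have "(u t' x)\<^sup>2 \<le> 18 * (LBINT y. (u0 y)\<^sup>2)"
      using u_square_bound[OF t', of x] by (simp add: eq)
    also have "\<dots> \<le> 18 * ?H\<^sup>2"
      using in_sobolev_L2_bound(2)[OF u0(2,1)] s by simp
    also have "\<dots> \<le> (5 * ?H)\<^sup>2" by (simp add: power_mult_distrib)
    finally show "(u t' x)\<^sup>2 \<le> (5 * ?H)\<^sup>2" .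
  qed (use H0 in simp)
  have m: "m 0 x0 = m0 x0" by (simp add: m_def eq m0(1) momentum_def)
  have "0 \<le> 1 / m 0 x0 + 2 * N 0 x0 * t + (8 * (5 * ?H) ^ 5 + 2 * (5 * ?H) ^ 3) * t\<^sup>2"
    by (rule reciprocal_momentum_bound[OF P]) (use t m m0(3) in auto)
  also have "\<dots> \<le> 1 / m 0 x0 + 2 * N 0 x0 * t + 25000 * (?H ^ 5 + ?H ^ 3) * t\<^sup>2"
    using H0 by (intro add_left_mono mult_right_mono) (auto simp: power_mult_distrib)
  finally show ?thesis by (simp add: m N_def eq)
qed

theorem theorem1p3:
  "\<exists>C::real. C > 0 \<and>
    (\<forall>(s::real) (m0::real \<Rightarrow> real) (u0::real \<Rightarrow> real) (Tstar::ereal)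
      (u::real \<Rightarrow> real \<Rightarrow> real) (q::real \<Rightarrow> real \<Rightarrow> real) (x0::real).
      s > 1/2 \<longrightarrow>
      continuous_on UNIV m0 \<longrightarrow> in_sobolev s m0 \<longrightarrow>
      continuous_on UNIV u0 \<longrightarrow> in_sobolev (s + 2) u0 \<longrightarrow>
      (\<forall>x. m0 x = momentum u0 x) \<longrightarrow>
      maximal_strong_solution s m0 Tstar u \<longrightarrow>
      characteristic_flow Tstar u q \<longrightarrow>
      (\<forall>x. m0 x \<ge> 0) \<longrightarrow> m0 x0 > 0 \<longrightarrow>
      (let Mbar = (\<lambda>t. M_fun (u t) (q t x0));
           mbar = (\<lambda>t. momentum (u t) (q t x0));
           C1 = C * (sobolev_norm 1 u0 ^ 5 + sobolev_norm 1 u0 ^ 3);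
           \<xi> = - Mbar 0 / (C1 * mbar 0)
       in Mbar 0 < 0 \<longrightarrow>
          Mbar 0 / mbar 0 * \<xi> + 1/2 * C1 * \<xi>\<^sup>2 + 1 / mbar 0 < 0 \<longrightarrow>
          Tstar < \<infinity> \<and> 0 < Tstar \<and> Tstar < ereal \<xi>))"
  unfolding Let_def
proof (intro exI[of _ "25000 :: real"] conjI allI impI)
  fix s m0 u0 Tstar u q x0
  assume s: "s > 1/2" and u0: "continuous_on UNIV u0" "in_sobolev (s + 2) u0"
    and m0: "\<forall>x. m0 x = momentum u0 x" "\<forall>x. m0 x \<ge> 0" "m0 x0 > 0"
    and sol: "maximal_strong_solution s m0 Tstar u" and q: "characteristic_flow Tstar u q"
  define C1 where "C1 = 25000 * (sobolev_norm 1 u0 ^ 5 + sobolev_norm 1 u0 ^ 3)"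
  define \<nu> where "\<nu> = cos ((u0 x0)\<^sup>2 - (deriv u0 x0)\<^sup>2) * deriv u0 x0"
  let ?\<xi> = "- M_fun (u 0) (q 0 x0) / (C1 * momentum (u 0) (q 0 x0))"
  assume M: "M_fun (u 0) (q 0 x0) < 0"
    and cond: "M_fun (u 0) (q 0 x0) / momentum (u 0) (q 0 x0) * ?\<xi> + 1/2 * C1 * ?\<xi>\<^sup>2
       + 1 / momentum (u 0) (q 0 x0) < 0"
  have T0: "0 < Tstar" using sol unfolding maximal_strong_solution_def by blast
  \<comment> \<open>Any positive time below \<open>Tstar\<close> will do; it only serves to identify
    u(0) with u_0.\<close>
  then obtain T where T: "0 < T" "ereal T < Tstar"
    using ereal_dense2[OF T0] by (auto simp: zero_ereal_def)
  have "u 0 = u0"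
    by (rule strong_solution_initial[of s m0 T])
       (use sol T s u0 m0 in \<open>auto simp: maximal_strong_solution_def\<close>)
  moreover have "q 0 x0 = x0" using q by (simp add: characteristic_flow_def)
  ultimately have mu: "momentum (u 0) (q 0 x0) = m0 x0" and Mnu: "M_fun (u 0) (q 0 x0) = \<nu> * m0 x0"
    using m0(1) by (simp_all add: M_fun_def \<nu>_def)
  have "?\<xi> = - \<nu> / C1" unfolding mu Mnu using m0(3) by simp
  moreover define \<xi> where "\<xi> = - \<nu> / C1"
  ultimately have xi: "?\<xi> = \<xi>" by simp
  have nu: "\<nu> < 0" using M m0(3) unfolding Mnu by (simp add: mult_less_0_iff)
  have cond': "\<nu> * \<xi> + 1/2 * C1 * \<xi>\<^sup>2 + 1 / m0 x0 < 0"
    using cond m0(3) unfolding xi unfolding mu Mnu by simp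
  have "0 \<le> C1" by (simp add: C1_def sobolev_norm_def)
  \<comment> \<open>For C1 = 0 division by zero makes \<xi> = 0, and the hypothesis would read 1 /
    m0 x0 < 0.\<close>
  moreover have "C1 \<noteq> 0"
  proof
    assume "C1 = 0"
    then have "1 / m0 x0 < 0" using cond' by (simp add: \<xi>_def)
    then show False using m0(3) by simp
  qed
  ultimately have C1: "0 < C1" by simp
  then have xi0: "0 < \<xi>" and nu_xi: "\<nu> = - (C1 * \<xi>)" using nu by (simp_all add: \<xi>_def divide_less_0_iff)
  \<comment> \<open>With \<nu> = -C1 \<xi> the hypothesis says 1 / m0 x0 < C1 \<xi>^2 / 2, whereas
    the lower bound at time \<xi> / 2 demands 1 / m0 x0 \<ge> 3/4 C1 \<xi>^2. Using a time strictly
    before \<xi> yields the strict inequality, since \<open>Tstar\<close> = \<xi> is excluded as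
    well.\<close>
  have less: "Tstar < ereal \<xi>"
  proof (rule ccontr)
    assume "\<not> Tstar < ereal \<xi>"
    moreover have "ereal (\<xi> / 2) < ereal \<xi>" using xi0 by simp
    ultimately have "ereal (\<xi> / 2) < Tstar" by (metis less_le_trans not_less)
    then have "0 \<le> 1 / m0 x0 + 2 * \<nu> * (\<xi> / 2) + C1 * (\<xi> / 2)\<^sup>2"
      unfolding \<nu>_def C1_def
      by (intro strong_solution_reciprocal_momentum_bound[OF s u0 _ _ m0(3) sol q]) (use m0 xi0 in auto)
    then have "0 \<le> 1 / m0 x0 - 3 / 4 * (C1 * \<xi>\<^sup>2)"
      by (simp add: nu_xi power2_eq_square field_simps)
    moreover have "1 / m0 x0 < 1 / 2 * (C1 * \<xi>\<^sup>2)"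
      using cond' by (simp add: nu_xi power2_eq_square field_simps)
    moreover have "0 < C1 * \<xi>\<^sup>2" using C1 xi0 by simp
    ultimately show False by linarith
  qed
  then show "Tstar < ereal ?\<xi>" unfolding xi .
  show "0 < Tstar" by (rule T0)
  show "Tstar < \<infinity>" using less by (metis ereal_less_PInfty less_trans)
qed simp

end
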